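(* Let $X=\mathbb{C}^2/\Lambda$ be a two-dimensional non-compact theta toroidal group. With the definition of Aeppli cohomology $H^{r,s}_A(X)$ given in the context, let $h^{r,s}_A=\dim_{\mathbb{C}}H^{r,s}_A(X)$, and let $\tilde h^{r,s}_A$ be the complex dimension of the Hausdorff completion of $H^{r,s}_A(X)$. Then $$h^{0,0}_A=1,\quad \tilde h^{1,0}_A=\tilde h^{0,1}_A=1,\quad \tilde h^{1,1}_A=2,\quad h^{2,0}_A=h^{0,2}_A=0,\quad h^{2,1}_A=h^{1,2}_A=0,\quad h^{2,2}_A=0.$$
   Context: A toroidal group is a connected abelian complex Lie group with no non-constant holomorphic functions; it is always a quotient $\mathbb{C}^n/\Lambda$ by a discrete subgroup. It is a theta toroidal group if all the cohomology groups $H^{r,s}(X,\mathcal{O})$ (the Dolbeault cohomology groups, i.e. $H^s(X,\Omega^r)$) are finite-dimensional. Every two-dimensional non-compact theta toroidal group can be written as $X=\mathbb{C}^2/\Lambda_{\tau,\alpha,\beta}$ with $\Lambda_{\tau,\alpha,\beta}=\mathbb{Z}(0,1)+\mathbb{Z}(1,\alpha)+\mathbb{Z}(\tau,\beta)$, where $\tau\in\mathbb{C}$, $\operatorname{Im}\tau>0$, and $\alpha,\beta\in\mathbb{R}$. Notation: $\mathcal{A}^{r,s}(X)$ is the space of complex-valued $C^\infty$ $(r,s)$-forms on $X$, $\mathcal{A}=\mathcal{A}^{0,0}$; $\Omega^r(X)$ is the space of holomorphic $r$-forms, and $\overline{\Omega}^s(X)$ the space of antiholomorphic $s$-forms (complex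 conjugates of holomorphic $s$-forms), with $\Omega^0=\mathcal{O}$, $\overline{\Omega}^0=\overline{\mathcal{O}}$. Definition of Aeppli cohomology used here: $$H^{r,s}_{A}(X)=\begin{cases}\dfrac{\operatorname{Ker}\partial\bar\partial\cap\mathcal{A}^{r,s}(X)}{\partial\mathcal{A}^{r-1,s}(X)+\bar\partial\mathcal{A}^{r,s-1}(X)} & r\ge1,\ s\ge1,\\[2ex] \dfrac{\operatorname{Ker}\partial\bar\partial\cap\mathcal{A}^{r,0}(X)}{\partial\mathcal{A}^{r-1,0}(X)+\Omega^{r}(X)} & r\ge1,\ s=0,\\[2ex] \dfrac{\operatorname{Ker}\partial\bar\partial\cap\mathcal{A}^{0,s}(X)}{\bar\partial\mathcal{A}^{0,s-1}(X)+\overline{\Omega}^{s}(X)} & r=0,\ s\ge1,\\[2ex] \dfrac{\operatorname{Ker}\partial\bar\partial\cap\mathcal{A}(X)}{\mathcal{O}(X)+\overline{\mathcal{O}}(X)} & r=s=0.\end{cases}$$ Topology: $\mathcal{A}^{r,s}(X)$ carries the topology of uniform convergence of all derivatives of the coefficients on compact sets, and $H^{r,s}_A(X)$ the quotient topology (of the subspace $\operatorname{Ker}\partial\bar\partial\cap\mathcal{A}^{r,s}(X)$). The Hausdorff completion of $H^{r,s}_A(X)$ is the quotient of the numerator $\operatorname{Ker}\partial\bar\partial\cap\mathcal{A}^{r,s}(X)$ by the closure of the denominator. *)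

theory Defs
  imports "HOL-Analysis.Analysis" "HOL-Library.Function_Algebras" "HOL-Library.Extended_Nat"
begin

section \<open>Dimension of a quotient of vector spaces\<close>

text \<open>The residue classes of the elements of \<open>B\<close> form a basis of \<open>V / W\<close>
  (distinct elements of \<open>B\<close> then automatically have distinct classes).\<close>

definition finite_quotient_basis ::
  "('a::field \<Rightarrow> 'b::ab_group_add \<Rightarrow> 'b) \<Rightarrow> 'b set \<Rightarrow> 'b set \<Rightarrow> 'b set \<Rightarrow> bool" where
  "finite_quotient_basis sc V W B \<longleftrightarrow> finite B \<and> B \<subseteq> V \<and>
     (\<forall>u. (\<Sum>b\<in>B. sc (u b) b) \<in> W \<longrightarrow> (\<forall>b\<in>B. u b = 0)) \<and>
     (\<forall>v\<in>V. \<exists>u. v - (\<Sum>b\<in>B. sc (u b) b) \<in> W)"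

definition quotient_dim ::
  "('a::field \<Rightarrow> 'b::ab_group_add \<Rightarrow> 'b) \<Rightarrow> 'b set \<Rightarrow> 'b set \<Rightarrow> enat" where
  "quotient_dim sc V W =
     (if \<exists>B. finite_quotient_basis sc V W B
      then enat (card (SOME B. finite_quotient_basis sc V W B)) else \<infinity>)"

lemma finite_quotient_basis_card_le:
  assumes V: "vector_space sc" and W: "module.subspace sc W" and B: "finite_quotient_basis sc V W B"
    and B': "finite_quotient_basis sc V W B'"
  shows "card B' \<le> card B"
proof -
  interpret v: vector_space sc by (rule V)
  have fB: "finite B" and fB': "finite B'"
    using B B' by (auto simp: finite_quotient_basis_def)
  have "\<forall>v\<in>B'. \<exists>u. v - (\<Sum>b\<in>B. sc (u b) b) \<in> W"
    using B B' by (auto simp: finite_quotient_basis_def)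
  then obtain u where "\<forall>v\<in>B'. v - (\<Sum>b\<in>B. sc (u v b) b) \<in> W"
    unfolding bchoice_iff by (elim exE)
  then have u: "\<And>v. v \<in> B' \<Longrightarrow> v - (\<Sum>b\<in>B. sc (u v b) b) \<in> W"
    by (rule bspec)
  define F where "F = (\<lambda>v. v - (\<Sum>b\<in>B. sc (u v b) b)) ` B'"
  obtain E where E: "E \<subseteq> F" "v.independent E" "F \<subseteq> v.span E"
    by (rule v.maximal_independent_subset[of F])
  have FW: "F \<subseteq> W" using u by (auto simp: F_def)
  have fE: "finite E" using E(1) fB' by (auto simp: F_def intro: finite_subset)
  have EW: "E \<subseteq> W" using E(1) FW by blast
  have ind: "u b = 0" if "(\<Sum>b\<in>B'. sc (u b) b) \<in> W" "b \<in> B'" for u b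
    using B' that by (simp add: finite_quotient_basis_def)
  have sp: "B' \<union> E \<subseteq> v.span (B \<union> E)"
  proof
    fix v assume v: "v \<in> B' \<union> E"
    show "v \<in> v.span (B \<union> E)"
    proof (cases "v \<in> E")
      case True then show ?thesis by (simp add: v.span_base)
    next
      case False
      with v have vB: "v \<in> B'" by simp
      have "v - (\<Sum>b\<in>B. sc (u v b) b) \<in> v.span (B \<union> E)"
        using E(3) vB v.span_mono[of E "B \<union> E"] by (auto simp: F_def)
      moreover have "(\<Sum>b\<in>B. sc (u v b) b) \<in> v.span (B \<union> E)"
        by (intro v.span_sum v.span_scale v.span_base) auto
      ultimately have "(v - (\<Sum>b\<in>B. sc (u v b) b)) + (\<Sum>b\<in>B. sc (u v b) b) \<in> v.span (B \<union> E)"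
        by (rule v.span_add)
      then show ?thesis by simp
    qed
  qed
  have disj: "B' \<inter> E = {}"
  proof (rule ccontr)
    assume "B' \<inter> E \<noteq> {}"
    then obtain x where x: "x \<in> B'" "x \<in> E" by blast
    have "(\<Sum>b\<in>B'. sc ((if b = x then 1 else 0)) b) = (\<Sum>b\<in>B'. if b = x then b else 0)"
      by (intro sum.cong) auto
    also have "\<dots> = x" using fB' x by simp
    finally have "(\<Sum>b\<in>B'. sc ((if b = x then 1 else 0)) b) \<in> W" using x EW by auto
    from ind[OF this x(1)] show False by simp
  qed
  have indep: "v.independent (B' \<union> E)"
  proof (rule v.independent_if_scalars_zero)
    show "finite (B' \<union> E)" using fB' fE by simp
    fix f x assume s: "(\<Sum>x\<in>B' \<union> E. sc (f x) x) = 0" and x: "x \<in> B' \<union> E"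
    have s': "(\<Sum>x\<in>B'. sc (f x) x) + (\<Sum>x\<in>E. sc (f x) x) = 0"
      using s disj fB' fE by (simp add: sum.union_disjoint)
    have "(\<Sum>x\<in>E. sc (f x) x) \<in> W"
      using W EW by (intro v.subspace_sum v.subspace_scale) auto
    then have "- (\<Sum>x\<in>E. sc (f x) x) \<in> W"
      using W by (rule v.subspace_neg[rotated])
    moreover have "(\<Sum>x\<in>B'. sc (f x) x) = - (\<Sum>x\<in>E. sc (f x) x)"
      using s' by (simp add: eq_neg_iff_add_eq_0)
    ultimately have "(\<Sum>x\<in>B'. sc (f x) x) \<in> W" by simp
    then have z: "f b = 0" if "b \<in> B'" for b using ind that by blast
    then have "(\<Sum>x\<in>E. sc (f x) x) = 0" using s' by simp
    then have "f b = 0" if "b \<in> E" for b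
      using E(2) fE that v.independentD[OF E(2) fE order_refl] by blast
    with z x show "f x = 0" by blast
  qed
  have "card (B' \<union> E) \<le> card (B \<union> E)"
    using v.independent_span_bound[OF _ indep sp] fB fE by simp
  also have "\<dots> \<le> card B + card E" by (rule card_Un_le)
  finally show ?thesis using disj fB' fE by (simp add: card_Un_disjoint)
qed

lemma quotient_dim_eq_card:
  assumes V: "vector_space sc" and W: "module.subspace sc W" and B: "finite_quotient_basis sc V W B"
  shows "quotient_dim sc V W = enat (card B)"
proof -
  have S: "finite_quotient_basis sc V W (SOME B. finite_quotient_basis sc V W B)"
    using B by (rule someI)
  have "card (SOME B. finite_quotient_basis sc V W B) = card B"
    using finite_quotient_basis_card_le[OF V W B S]
      finite_quotient_basis_card_le[OF V W S B] by simp
  then show ?thesis using B by (auto simp: quotient_dim_def)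
qed


section \<open>Smooth and holomorphic functions of several complex variables\<close>

definition dir_deriv :: "complex^'n \<Rightarrow> (complex^'n \<Rightarrow> complex) \<Rightarrow> complex^'n \<Rightarrow> complex" where
  "dir_deriv v f = (\<lambda>z. frechet_derivative f (at z) v)"

definition iter_deriv :: "(complex^'n) list \<Rightarrow> (complex^'n \<Rightarrow> complex) \<Rightarrow> complex^'n \<Rightarrow> complex" where
  "iter_deriv vs f = foldr dir_deriv vs f"

text \<open>Here differentiability is over the reals.\<close>

definition smooth :: "(complex^'n \<Rightarrow> complex) \<Rightarrow> bool" where
  "smooth f \<longleftrightarrow> (\<forall>vs. iter_deriv vs f differentiable_on UNIV)"

definition holomorphic :: "(complex^'n \<Rightarrow> complex) \<Rightarrow> bool" where
  "holomorphic f \<longleftrightarrow>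
     (\<forall>z. \<exists>D. (f has_derivative D) (at z) \<and> (\<forall>c v. D (c *s v) = c * D v))"

text \<open>The Wirtinger derivatives with respect to \<open>z\<^sub>k\<close> and to its conjugate.\<close>

definition dz :: "'n \<Rightarrow> (complex^'n \<Rightarrow> complex) \<Rightarrow> complex^'n \<Rightarrow> complex" where
  "dz k f = (\<lambda>z. (dir_deriv (axis k 1) f z - \<i> * dir_deriv (axis k \<i>) f z) / 2)"

definition dzbar :: "'n \<Rightarrow> (complex^'n \<Rightarrow> complex) \<Rightarrow> complex^'n \<Rightarrow> complex" where
  "dzbar k f = (\<lambda>z. (dir_deriv (axis k 1) f z + \<i> * dir_deriv (axis k \<i>) f z) / 2)"


section \<open>The group \<open>\<complex>\<^sup>n / \<Lambda>\<close>\<close>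

definition discrete_subgroup :: "(complex^'n) set \<Rightarrow> bool" where
  "discrete_subgroup \<Lambda> \<longleftrightarrow> 0 \<in> \<Lambda> \<and> (\<forall>x\<in>\<Lambda>. \<forall>y\<in>\<Lambda>. x - y \<in> \<Lambda>) \<and> discrete \<Lambda>"

definition cosets :: "(complex^'n) set \<Rightarrow> (complex^'n) set set" where
  "cosets \<Lambda> = UNIV // {(x, y). y - x \<in> \<Lambda>}"

definition quotient_top :: "(complex^'n) set \<Rightarrow> (complex^'n) set topology" where
  "quotient_top \<Lambda> = topology (\<lambda>U. U \<subseteq> cosets \<Lambda> \<and> open (\<Union>U))"

lemma openin_quotient_top:
  assumes "discrete_subgroup \<Lambda>"
  shows "openin (quotient_top \<Lambda>) U \<longleftrightarrow> U \<subseteq> cosets \<Lambda> \<and> open (\<Union>U)"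
proof -
  have minus: "- x \<in> \<Lambda>" if "x \<in> \<Lambda>" for x
    using assms that unfolding discrete_subgroup_def by (metis diff_0)
  have add: "x + y \<in> \<Lambda>" if "x \<in> \<Lambda>" "y \<in> \<Lambda>" for x y
    using assms minus[OF that(2)] that(1) unfolding discrete_subgroup_def
    by (metis diff_minus_eq_add)
  have "equiv UNIV {(x, y). y - x \<in> \<Lambda>}"
  proof (rule equivI)
    show "{(x, y). y - x \<in> \<Lambda>} \<subseteq> UNIV \<times> UNIV" by simp
    show "refl {(x, y). y - x \<in> \<Lambda>}"
      using assms by (auto simp: refl_on_def discrete_subgroup_def)
    show "sym {(x, y). y - x \<in> \<Lambda>}"
      using minus by (force simp: sym_def)
    show "trans {(x, y). y - x \<in> \<Lambda>}"
      using add by (force simp: trans_def)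
  qed
  then have disj: "C = D \<or> C \<inter> D = {}" if "C \<in> cosets \<Lambda>" "D \<in> cosets \<Lambda>" for C D
    using that quotient_disj unfolding cosets_def by blast
  have "istopology (\<lambda>U. U \<subseteq> cosets \<Lambda> \<and> open (\<Union>U))"
    unfolding istopology_def
  proof (intro conjI allI impI)
    fix S T assume S: "S \<subseteq> cosets \<Lambda> \<and> open (\<Union>S)" and T: "T \<subseteq> cosets \<Lambda> \<and> open (\<Union>T)"
    have "\<Union>(S \<inter> T) = \<Union>S \<inter> \<Union>T" using disj S T by blast
    then show "open (\<Union>(S \<inter> T))" using S T by auto
    show "S \<inter> T \<subseteq> cosets \<Lambda>" using S by blast
  next
    fix K assume K: "\<forall>S\<in>K. S \<subseteq> cosets \<Lambda> \<and> open (\<Union>S)"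
    have "\<Union>(\<Union>K) = (\<Union>S\<in>K. \<Union>S)" by blast
    then show "open (\<Union>(\<Union>K))" using K by auto
    show "\<Union>K \<subseteq> cosets \<Lambda>" using K by blast
  qed
  then show ?thesis by (simp add: quotient_top_def topology_inverse')
qed

text \<open>Functions on \<open>\<complex>\<^sup>n / \<Lambda>\<close> are identified with their pullbacks to \<open>\<complex>\<^sup>n\<close>.\<close>

definition periodic :: "(complex^'n) set \<Rightarrow> (complex^'n \<Rightarrow> complex) \<Rightarrow> bool" where
  "periodic \<Lambda> f \<longleftrightarrow> (\<forall>l\<in>\<Lambda>. \<forall>z. f (z + l) = f z)"

definition toroidal :: "(complex^'n) set \<Rightarrow> bool" where
  "toroidal \<Lambda> \<longleftrightarrow> discrete_subgroup \<Lambda> \<and>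
     (\<forall>f. holomorphic f \<and> periodic \<Lambda> f \<longrightarrow> f constant_on UNIV)"


section \<open>Differential forms on \<open>\<complex>\<^sup>n / \<Lambda>\<close>\<close>

text \<open>A form is given by its coefficients: \<open>\<phi> I J\<close> is the coefficient of
  \<open>dz\<^sub>I \<and> d\<bar>z\<^sub>J\<close>, where \<open>dz\<^sub>I\<close> is the wedge product of the \<open>dz\<^sub>i\<close>, \<open>i \<in> I\<close>, in increasing
  order.  Since all \<open>dz\<^sub>i\<close> are invariant under translations, a form on \<open>\<complex>\<^sup>n\<close> is the pullback of
  a form on \<open>\<complex>\<^sup>n / \<Lambda>\<close> iff all its coefficients are periodic.\<close>

type_synonym 'n form = "'n set \<Rightarrow> 'n set \<Rightarrow> complex^'n \<Rightarrow> complex"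

definition form_scale :: "complex \<Rightarrow> 'n form \<Rightarrow> 'n form" where
  "form_scale c \<phi> = (\<lambda>I J z. c * \<phi> I J z)"

global_interpretation form: vector_space form_scale
  by standard (simp_all add: form_scale_def fun_eq_iff algebra_simps)

definition forms :: "(complex^'n::finite) set \<Rightarrow> nat \<Rightarrow> nat \<Rightarrow> ('n::finite) form set" where
  "forms \<Lambda> r s = {\<phi>. \<forall>I J. smooth (\<phi> I J) \<and> periodic \<Lambda> (\<phi> I J) \<and>
                      ((card I, card J) \<noteq> (r, s) \<longrightarrow> \<phi> I J = 0)}"

text \<open>The signs come from sorting \<open>dz\<^sub>k \<and> dz\<^sub>I \<and> d\<bar>z\<^sub>J\<close> and \<open>d\<bar>z\<^sub>k \<and> dz\<^sub>I \<and> d\<bar>z\<^sub>J\<close>.\<close>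

definition del :: "('n::{finite,linorder}) form \<Rightarrow> ('n::{finite,linorder}) form" where
  "del \<phi> = (\<lambda>I J z. \<Sum>k\<in>I. (-1) ^ card {i\<in>I. i < k} * dz k (\<phi> (I - {k}) J) z)"

definition delbar :: "('n::{finite,linorder}) form \<Rightarrow> ('n::{finite,linorder}) form" where
  "delbar \<phi> = (\<lambda>I J z. \<Sum>k\<in>J. (-1) ^ (card I + card {j\<in>J. j < k}) * dzbar k (\<phi> I (J - {k})) z)"

definition conj_form :: "('n::finite) form \<Rightarrow> ('n::finite) form" where
  "conj_form \<phi> = (\<lambda>I J z. (-1) ^ (card I * card J) * cnj (\<phi> J I z))"

definition holomorphic_forms :: "(complex^'n::finite) set \<Rightarrow> nat \<Rightarrow> ('n::finite) form set" where
  "holomorphic_forms \<Lambda> r = {\<phi> \<in> forms \<Lambda> r 0. \<forall>I J. holomorphic (\<phi> I J)}"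

definition antiholomorphic_forms :: "(complex^'n::finite) set \<Rightarrow> nat \<Rightarrow> ('n::finite) form set" where
  "antiholomorphic_forms \<Lambda> s = conj_form ` holomorphic_forms \<Lambda> s"


section \<open>Dolbeault cohomology and theta toroidal groups\<close>

definition dolbeault_cocycles :: "(complex^'n::{finite,linorder}) set \<Rightarrow> nat \<Rightarrow> nat \<Rightarrow> ('n::{finite,linorder}) form set" where
  "dolbeault_cocycles \<Lambda> r s = {\<phi> \<in> forms \<Lambda> r s. delbar \<phi> = 0}"

fun dolbeault_coboundaries :: "(complex^'n::{finite,linorder}) set \<Rightarrow> nat \<Rightarrow> nat \<Rightarrow> ('n::{finite,linorder}) form set" where
  "dolbeault_coboundaries \<Lambda> r 0 = {0}"
| "dolbeault_coboundaries \<Lambda> r (Suc s) = delbar ` forms \<Lambda> r s"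

definition theta_toroidal :: "(complex^'n::{finite,linorder}) set \<Rightarrow> bool" where
  "theta_toroidal \<Lambda> \<longleftrightarrow> toroidal \<Lambda> \<and>
     (\<forall>r s. quotient_dim form_scale (dolbeault_cocycles \<Lambda> r s) (dolbeault_coboundaries \<Lambda> r s) \<noteq> \<infinity>)"


section \<open>Aeppli cohomology\<close>

definition aeppli_num :: "(complex^'n::{finite,linorder}) set \<Rightarrow> nat \<Rightarrow> nat \<Rightarrow> ('n::{finite,linorder}) form set" where
  "aeppli_num \<Lambda> r s = {\<phi> \<in> forms \<Lambda> r s. del (delbar \<phi>) = 0}"

fun aeppli_denom :: "(complex^'n::{finite,linorder}) set \<Rightarrow> nat \<Rightarrow> nat \<Rightarrow> ('n::{finite,linorder}) form set" where
  "aeppli_denom \<Lambda> (Suc r) (Suc s) =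
     {del \<alpha> + delbar \<beta> |\<alpha> \<beta>. \<alpha> \<in> forms \<Lambda> r (Suc s) \<and> \<beta> \<in> forms \<Lambda> (Suc r) s}"
| "aeppli_denom \<Lambda> (Suc r) 0 =
     {del \<alpha> + \<omega> |\<alpha> \<omega>. \<alpha> \<in> forms \<Lambda> r 0 \<and> \<omega> \<in> holomorphic_forms \<Lambda> (Suc r)}"
| "aeppli_denom \<Lambda> 0 (Suc s) =
     {delbar \<beta> + \<omega> |\<beta> \<omega>. \<beta> \<in> forms \<Lambda> 0 s \<and> \<omega> \<in> antiholomorphic_forms \<Lambda> (Suc s)}"
| "aeppli_denom \<Lambda> 0 0 =
     {\<omega> + \<omega>' |\<omega> \<omega>'. \<omega> \<in> holomorphic_forms \<Lambda> 0 \<and> \<omega>' \<in> antiholomorphic_forms \<Lambda> 0}"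

definition aeppli_dim :: "(complex^'n::{finite,linorder}) set \<Rightarrow> nat \<Rightarrow> nat \<Rightarrow> enat" where
  "aeppli_dim \<Lambda> r s = quotient_dim form_scale (aeppli_num \<Lambda> r s) (aeppli_denom \<Lambda> r s)"

text \<open>Uniform convergence of all derivatives of the coefficients on compact sets.
  By periodicity, compact subsets of \<open>\<complex>\<^sup>n\<close> and of \<open>\<complex>\<^sup>n / \<Lambda>\<close> give the same topology.\<close>

definition forms_ball ::
  "(complex^'n) set \<Rightarrow> nat \<Rightarrow> nat \<Rightarrow> (complex^'n) set \<Rightarrow> (complex^'n) list \<Rightarrow> real
     \<Rightarrow> ('n::finite) form \<Rightarrow> ('n::finite) form set" where
  "forms_ball \<Lambda> r s K vs e \<phi> = {\<psi> \<in> forms \<Lambda> r s. \<forall>I J. \<forall>z\<in>K.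
     cmod (iter_deriv vs (\<psi> I J) z - iter_deriv vs (\<phi> I J) z) < e}"

definition forms_top :: "(complex^'n::finite) set \<Rightarrow> nat \<Rightarrow> nat \<Rightarrow> ('n::finite) form topology" where
  "forms_top \<Lambda> r s = topology_generated_by
     {forms_ball \<Lambda> r s K vs e \<phi> |K vs e \<phi>. compact K \<and> 0 < e \<and> \<phi> \<in> forms \<Lambda> r s}"

definition aeppli_hausdorff_dim :: "(complex^'n::{finite,linorder}) set \<Rightarrow> nat \<Rightarrow> nat \<Rightarrow> enat" where
  "aeppli_hausdorff_dim \<Lambda> r s = quotient_dim form_scale (aeppli_num \<Lambda> r s)
     (subtopology (forms_top \<Lambda> r s) (aeppli_num \<Lambda> r s) closure_of aeppli_denom \<Lambda> r s)"

end

theory Submission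
  imports Defs
begin

text \<open>
  Since the quotient is not compact, \<open>\<Lambda>\<close> does not span \<open>\<complex>\<^sup>2\<close> over the reals, and there is a complex
  linear form \<open>L\<close>, real on \<open>\<Lambda>\<close>, whose real hyperplane \<open>Im L = 0\<close> is the span of \<open>\<Lambda>\<close>. The values of \<open>L\<close>
  on \<open>\<Lambda>\<close> are dense in \<open>\<real>\<close>, as otherwise some \<open>exp (2 \<pi> i L / c)\<close> would be a non-constant holomorphic
  function on the quotient. Let \<open>e\<close> span the kernel of \<open>L\<close> and let \<open>u \<in> \<Lambda>\<close> satisfy \<open>L u = 1\<close>.

  Averaging over discs in the direction of \<open>e\<close> changes a function by a derivative along \<open>e\<close>, and as the
  radius grows the averages converge, in the smooth topology, to the mean over the maximal compact
  torus, because \<open>\<complex> e + \<Lambda>\<close> is dense in the hyperplane. Hence a form lies in the closure of the exact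
  forms if and only if its mean over the torus is exact. Such means depend on \<open>t = Im L\<close> only, and there
  the equations are ordinary differential equations in \<open>t\<close>; the obstruction is a constant in degree
  \<open>(1,0)\<close> and a function \<open>a + b t\<close> in degree \<open>(1,1)\<close>, which gives the dimensions 1 and 2.

  In the remaining degrees one needs that the antiholomorphic derivative along \<open>u\<close> is surjective on
  smooth functions on the quotient. It is inverted mode by mode in the Fourier series along \<open>u\<close>,
  integrating in \<open>t\<close> from base points that tend to infinity with the frequency, so slowly that the
  growth of the given function is compensated by the rapid decay of its Fourier coefficients.
\<close>

text \<open>No Fourier analysis on the full torus enters, so small divisors never occur. Along
  \<open>e\<close> an equation is solved only up to a disc average, by a potential with compactly
  supported kernel. No limit of the potentials is taken as the radius grows, only of their
  derivatives; this is why the argument yields closures in the degrees (1,0), (0,1) and (1,1).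
  Transversally a Fourier series along the single period \<open>u\<close> is enough: each mode obeys
  a first order equation in t, solved by integration without dividing by a frequency.

  The obstructions arise as follows. In degree (1,0) the numerator condition says that the
  coefficient of the \<partial>-derivative is holomorphic, hence constant. In degree (1,1) the
  condition, evaluated on \<open>e\<close>, \<open>u\<close> and their conjugates, expresses the
  second t-derivative of the (e,e) component by derivatives along \<open>e\<close> of other
  components. Torus means kill these, so the mean of that component is affine in t.\<close>

section \<open>Calculus of smooth functions\<close>

lemma iter_deriv_Nil [simp]: "iter_deriv [] f = f"
  by (simp add: iter_deriv_def)

lemma iter_deriv_Cons [simp]: "iter_deriv (v # vs) f = dir_deriv v (iter_deriv vs f)"
  by (simp add: iter_deriv_def)

lemma iter_deriv_append: "iter_deriv (vs @ ws) f = iter_deriv vs (iter_deriv ws f)"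
  by (simp add: iter_deriv_def)

lemma smooth_dir_deriv: "smooth f \<Longrightarrow> smooth (dir_deriv v f)"
  unfolding smooth_def using iter_deriv_append[of _ "[v]" f] by (metis iter_deriv_Cons iter_deriv_Nil)

lemma smooth_iter_deriv: "smooth f \<Longrightarrow> smooth (iter_deriv vs f)"
  by (induction vs) (auto intro: smooth_dir_deriv)

lemma smooth_has_derivative:
  assumes "smooth f"
  shows "(f has_derivative (\<lambda>v. dir_deriv v f z)) (at z)"
proof -
  have "f differentiable (at z)"
    using assms by (metis smooth_def iter_deriv_Nil differentiable_on_def UNIV_I)
  then show ?thesis unfolding dir_deriv_def by (simp add: frechet_derivative_works)
qed

lemma dir_deriv_eqI: "(f has_derivative D) (at z) \<Longrightarrow> dir_deriv v f z = D v"
  unfolding dir_deriv_def by (metis frechet_derivative_at)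

text \<open>A class of differentiable functions that contains all directional derivatives of its
  members consists of smooth functions. Sums, averages and series below each supply such a class, so
  no induction over lists of directions is needed there.\<close>

lemma smooth_coinduct [consumes 1, case_names deriv]:
  assumes "P f"
    and "\<And>f. P f \<Longrightarrow> \<exists>D. (\<forall>z. (f has_derivative D z) (at z)) \<and> (\<forall>v. P (\<lambda>z. D z v))"
  shows "smooth f"
proof -
  have ex: "\<exists>D. (\<forall>z. (f has_derivative D z) (at z)) \<and> (\<forall>v. P (dir_deriv v f))" if P: "P f" for f
  proof -
    obtain D where D: "\<forall>z. (f has_derivative D z) (at z)" "\<forall>v. P (\<lambda>z. D z v)"
      using assms(2)[OF P] by blast
    then have "dir_deriv v f = (\<lambda>z. D z v)" for v
      by (auto simp: fun_eq_iff intro!: dir_deriv_eqI)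
    then show ?thesis using D by auto
  qed
  have P: "P (iter_deriv vs f)" for vs
    using assms(1) ex by (induction vs) auto
  show ?thesis unfolding smooth_def differentiable_on_def differentiable_def
    using ex[OF P] by (blast intro: has_derivative_at_withinI)
qed

lemma dir_deriv_add: "smooth f \<Longrightarrow> dir_deriv (v + w) f z = dir_deriv v f z + dir_deriv w f z"
  and dir_deriv_scaleR: "smooth f \<Longrightarrow> dir_deriv (c *\<^sub>R v) f z = c *\<^sub>R dir_deriv v f z"
  by (metis (no_types, lifting) has_derivative_bounded_linear smooth_has_derivative linear_simps(1),
      metis (no_types, lifting) has_derivative_bounded_linear smooth_has_derivative linear_simps(5))

lemma dir_deriv_Basis:
  assumes "smooth f" shows "dir_deriv v f z = (\<Sum>b\<in>Basis. (v \<bullet> b) *\<^sub>R dir_deriv b f z)"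
proof -
  interpret linear "\<lambda>v. dir_deriv v f z"
    using has_derivative_linear[OF smooth_has_derivative[OF assms]] .
  have "dir_deriv v f z = dir_deriv (\<Sum>b\<in>Basis. (v \<bullet> b) *\<^sub>R b) f z"
    by (simp add: euclidean_representation)
  then show ?thesis by (simp add: sum scale)
qed

lemma smooth_continuous: "smooth f \<Longrightarrow> continuous_on S f"
  by (meson continuous_at_imp_continuous_on has_derivative_continuous smooth_has_derivative)

lemma continuous_on_smooth: "smooth f \<Longrightarrow> continuous_on S g \<Longrightarrow> continuous_on S (\<lambda>x. f (g x))"
  by (rule continuous_on_compose2[OF smooth_continuous[of f UNIV]]) auto

lemma dir_deriv_smooth_plus:
  "smooth f \<Longrightarrow> smooth g \<Longrightarrow> dir_deriv v (\<lambda>z. f z + g z) = (\<lambda>z. dir_deriv v f z + dir_deriv v g z)"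
  by (rule ext, rule dir_deriv_eqI) (intro has_derivative_add smooth_has_derivative)

lemma smooth_plus: "smooth f \<Longrightarrow> smooth g \<Longrightarrow> smooth (\<lambda>z. f z + g z)"
proof (coinduction arbitrary: f g rule: smooth_coinduct)
  case (deriv f g)
  show ?case using deriv
    by (intro exI[of _ "\<lambda>z v. dir_deriv v f z + dir_deriv v g z"])
      (auto intro!: has_derivative_add smooth_has_derivative smooth_dir_deriv)
qed

lemma dir_deriv_const [simp]: "dir_deriv v (\<lambda>z. c) = (\<lambda>z. 0)"
  by (rule ext, rule dir_deriv_eqI) auto

lemma smooth_const [simp, intro]: "smooth (\<lambda>z. c)"
proof (coinduction arbitrary: c rule: smooth_coinduct)
  case deriv
  then show ?case by (intro exI[of _ "\<lambda>z v. 0"]) auto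
qed

lemma dir_deriv_smooth_cmult:
  "smooth f \<Longrightarrow> dir_deriv v (\<lambda>z. c * f z) = (\<lambda>z. c * dir_deriv v f z)"
  by (rule ext, rule dir_deriv_eqI) (intro has_derivative_mult_right smooth_has_derivative)

lemma smooth_cmult: "smooth f \<Longrightarrow> smooth (\<lambda>z. c * f z)"
proof (coinduction arbitrary: f rule: smooth_coinduct)
  case (deriv f)
  then show ?case
    by (intro exI[of _ "\<lambda>z v. c * dir_deriv v f z"])
      (auto intro!: has_derivative_mult_right smooth_has_derivative smooth_dir_deriv)
qed

lemma smooth_minus: "smooth f \<Longrightarrow> smooth (\<lambda>z. - f z)"
  using smooth_cmult[of f "-1"] by simp

lemma smooth_diff: "smooth f \<Longrightarrow> smooth g \<Longrightarrow> smooth (\<lambda>z. f z - g z)"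
  using smooth_plus[of f "\<lambda>z. - g z"] smooth_minus[of g] by simp

lemma dir_deriv_smooth_minus: "smooth f \<Longrightarrow> dir_deriv v (\<lambda>z. - f z) = (\<lambda>z. - dir_deriv v f z)"
  using dir_deriv_smooth_cmult[of f v "-1"] by simp

lemma dir_deriv_smooth_diff:
  "smooth f \<Longrightarrow> smooth g \<Longrightarrow> dir_deriv v (\<lambda>z. f z - g z) = (\<lambda>z. dir_deriv v f z - dir_deriv v g z)"
  using dir_deriv_smooth_plus[of f "\<lambda>z. - g z"] smooth_minus[of g] dir_deriv_smooth_minus[of g] by simp

lemma dir_deriv_cnj:
  "smooth f \<Longrightarrow> dir_deriv v (\<lambda>z. cnj (f z)) = (\<lambda>z. cnj (dir_deriv v f z))"
  by (rule ext, rule dir_deriv_eqI) (intro has_derivative_cnj smooth_has_derivative)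

lemma smooth_cnj: "smooth f \<Longrightarrow> smooth (\<lambda>z. cnj (f z))"
proof (coinduction arbitrary: f rule: smooth_coinduct)
  case (deriv f)
  then show ?case
    by (intro exI[of _ "\<lambda>z v. cnj (dir_deriv v f z)"])
      (auto intro!: has_derivative_cnj smooth_has_derivative smooth_dir_deriv)
qed

lemma dir_deriv_linear: "bounded_linear f \<Longrightarrow> dir_deriv v f = (\<lambda>z. f v)"
  by (rule ext, rule dir_deriv_eqI) (rule bounded_linear_imp_has_derivative)

lemma smooth_linear:
  assumes "bounded_linear f" shows "smooth f"
proof (rule smooth_coinduct[where P="\<lambda>g. g = f \<or> smooth g"])
  show "f = f \<or> smooth f" by simp
  fix g assume "g = f \<or> smooth g"
  then show "\<exists>D. (\<forall>z. (g has_derivative D z) (at z)) \<and> (\<forall>v. (\<lambda>z. D z v) = f \<or> smooth (\<lambda>z. D z v))"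
  proof
    assume "g = f" then show ?thesis
      using assms by (intro exI[of _ "\<lambda>z v. f v"]) (auto intro: bounded_linear_imp_has_derivative)
  next
    assume "smooth g" then show ?thesis
      by (intro exI[of _ "\<lambda>z v. dir_deriv v g z"]) (auto intro!: smooth_has_derivative smooth_dir_deriv)
  qed
qed

subsection \<open>Integral averages of translates\<close>

text \<open>One operator for all averages that occur: line means, Fourier modes and disc kernels are
  weighted integrals of translates over a box, and torus means are iterated line means. Translates
  commute with derivatives and respect periods, so these facts are proved once.\<close>

definition avg :: "'a::euclidean_space \<Rightarrow> 'a \<Rightarrow> ('a \<Rightarrow> complex) \<Rightarrow> ('a \<Rightarrow> complex^'n) \<Rightarrow>
    (complex^'n \<Rightarrow> complex) \<Rightarrow> complex^'n \<Rightarrow> complex" where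
  "avg a b c g f = (\<lambda>z. integral (cbox a b) (\<lambda>x. c x * f (z + g x)))"

lemma avg_has_derivative:
  assumes f: "smooth f" and c: "continuous_on (cbox a b) c" and g: "continuous_on (cbox a b) g"
  shows "(avg a b c g f has_derivative (\<lambda>v. avg a b c g (dir_deriv v f) z)) (at z)"
proof -
  \<comment> \<open>The Leibniz rule asks for the derivative as a continuous family of bounded
    linear maps; in finite dimension its continuity can be checked direction by direction.\<close>
  define F where "F w x = Blinfun (\<lambda>v. c x * dir_deriv v f (w + g x))" for w x
  have bl: "bounded_linear (\<lambda>v. c x * dir_deriv v f (w + g x))" for w x
    using has_derivative_bounded_linear[OF smooth_has_derivative[OF f]]
    by (intro bounded_linear_const_mult)
  have F: "blinfun_apply (F w x) v = c x * dir_deriv v f (w + g x)" for w x v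
    unfolding F_def by (simp add: bounded_linear_Blinfun_apply[OF bl])
  have cdv: "continuous_on (UNIV \<times> cbox a b) (\<lambda>(w, x). c x * dir_deriv v f (w + g x))" for v
    unfolding split_beta
    by (intro continuous_intros continuous_on_smooth[OF smooth_dir_deriv[OF f]]
        continuous_on_compose2[OF c] continuous_on_compose2[OF g]) auto
  have cF: "continuous_on (UNIV \<times> cbox a b) (\<lambda>(w, x). F w x)"
    using cdv by (intro continuous_on_blinfun_componentwise) (simp add: F split_beta)
  have "((\<lambda>w. integral (cbox a b) (\<lambda>x. c x * f (w + g x))) has_derivative
      integral (cbox a b) (F z)) (at z within UNIV)"
  proof (rule leibniz_rule)
    show "((\<lambda>w. c x * f (w + g x)) has_derivative blinfun_apply (F w x)) (at w within UNIV)" for w x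
      unfolding F
      by (intro has_derivative_mult_right has_derivative_compose[where f="\<lambda>w. w + g x" and g=f, of "\<lambda>v. v", simplified])
        (auto intro!: derivative_eq_intros smooth_has_derivative f)
    show "(\<lambda>x. c x * f (w + g x)) integrable_on cbox a b" for w
      by (intro integrable_continuous continuous_intros c
          continuous_on_smooth[OF f] g)
    show "continuous_on (UNIV \<times> cbox a b) (\<lambda>(w, x). F w x)" by (rule cF)
  qed auto
  moreover have "blinfun_apply (integral (cbox a b) (F z)) = (\<lambda>v. avg a b c g (dir_deriv v f) z)"
  proof
    fix v
    have "continuous_on (cbox a b) (F z)"
      by (rule continuous_on_compose2[OF cF, of "cbox a b" "\<lambda>x. (z, x)", simplified])
        (auto intro!: continuous_intros)
    then show "blinfun_apply (integral (cbox a b) (F z)) v = avg a b c g (dir_deriv v f) z"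
      unfolding avg_def
      by (subst blinfun_apply_integral) (auto simp: F intro: integrable_continuous)
  qed
  ultimately show ?thesis unfolding avg_def by simp
qed

lemma dir_deriv_avg:
  assumes "smooth f" "continuous_on (cbox a b) c" "continuous_on (cbox a b) g"
  shows "dir_deriv v (avg a b c g f) = avg a b c g (dir_deriv v f)"
  by (rule ext, rule dir_deriv_eqI, rule avg_has_derivative[OF assms])

lemma smooth_avg:
  assumes "smooth f" and c: "continuous_on (cbox a b) c" "continuous_on (cbox a b) g"
  shows "smooth (avg a b c g f)"
  using assms(1)
proof (coinduction arbitrary: f rule: smooth_coinduct)
  case (deriv f)
  show ?case
    by (intro exI[of _ "\<lambda>z v. avg a b c g (dir_deriv v f) z"] conjI allI avg_has_derivative c deriv)
      (use deriv smooth_dir_deriv in auto)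
qed

lemma iter_deriv_avg:
  assumes "smooth f" "continuous_on (cbox a b) c" "continuous_on (cbox a b) g"
  shows "iter_deriv vs (avg a b c g f) = avg a b c g (iter_deriv vs f)"
  using assms by (induction vs) (auto simp: dir_deriv_avg smooth_iter_deriv)

lemma avg_integrable:
  assumes "smooth f" "continuous_on (cbox a b) c" "continuous_on (cbox a b) g"
  shows "(\<lambda>x. c x * f (z + g x)) integrable_on cbox a b"
  by (intro integrable_continuous continuous_intros continuous_on_smooth[OF assms(1)] assms(2,3))

lemma avg_plus:
  assumes "smooth f" "smooth h" "continuous_on (cbox a b) c" "continuous_on (cbox a b) g"
  shows "avg a b c g (\<lambda>z. f z + h z) = (\<lambda>z. avg a b c g f z + avg a b c g h z)"
  unfolding avg_def using avg_integrable[OF assms(1,3,4)] avg_integrable[OF assms(2,3,4)]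
  by (simp add: distrib_left integral_add)

lemma avg_cmult: "avg a b c g (\<lambda>z. k * f z) = (\<lambda>z. k * avg a b c g f z)"
  unfolding avg_def by (simp add: mult.left_commute)

lemma avg_const: "avg a b c g (\<lambda>z. k) = (\<lambda>z. k * integral (cbox a b) c)"
  unfolding avg_def by (simp add: mult.commute)

lemma avg_periodic: "periodic \<Lambda> f \<Longrightarrow> periodic \<Lambda> (avg a b c g f)"
  unfolding periodic_def avg_def by (simp add: add.assoc add.commute[of _ "g _"])
    (simp add: add.assoc[symmetric])

text \<open>Fubini for a continuous integrand on a product of boxes, since the two translations
  commute. This is what later exchanges torus mean and disc mean.\<close>

lemma avg_commute:
  assumes f: "smooth f" and c: "continuous_on (cbox a b) c" "continuous_on (cbox a b) g"
    and c': "continuous_on (cbox a' b') c'" "continuous_on (cbox a' b') g'"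
  shows "avg a b c g (avg a' b' c' g' f) = avg a' b' c' g' (avg a b c g f)"
proof
  fix z
  have co: "continuous_on (cbox (a, a') (b, b')) (\<lambda>(x, y). c x * (c' y * f (z + g x + g' y)))"
    unfolding split_beta cbox_Pair_eq
    by (intro continuous_intros continuous_on_smooth[OF f]
        continuous_on_compose2[OF c(1)] continuous_on_compose2[OF c(2)]
        continuous_on_compose2[OF c'(1)] continuous_on_compose2[OF c'(2)]) auto
  have "avg a b c g (avg a' b' c' g' f) z =
      integral (cbox a b) (\<lambda>x. integral (cbox a' b') (\<lambda>y. c x * (c' y * f (z + g x + g' y))))"
    unfolding avg_def by simp
  also have "\<dots> = integral (cbox a' b') (\<lambda>y. integral (cbox a b) (\<lambda>x. c x * (c' y * f (z + g x + g' y))))"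
    by (rule integral_swap_continuous[OF co])
  also have "(\<lambda>x y. c x * (c' y * f (z + g x + g' y))) = (\<lambda>x y. c' y * (c x * f (z + g' y + g x)))"
    by (simp add: fun_eq_iff add_ac mult.left_commute)
  finally show "avg a b c g (avg a' b' c' g' f) z = avg a' b' c' g' (avg a b c g f) z"
    unfolding avg_def by simp
qed

subsection \<open>Symmetry of second derivatives\<close>

lemma has_vector_derivative_line:
  assumes "smooth f"
  shows "((\<lambda>s. f (z + s *\<^sub>R v)) has_vector_derivative dir_deriv v f (z + s *\<^sub>R v)) (at s within S)"
proof -
  have "((\<lambda>s. f (z + s *\<^sub>R v)) has_derivative (\<lambda>h. dir_deriv (h *\<^sub>R v) f (z + s *\<^sub>R v))) (at s within S)"
    by (rule has_derivative_compose[OF _ smooth_has_derivative[OF assms]])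
      (auto intro!: derivative_eq_intros)
  then show ?thesis by (simp add: has_vector_derivative_def dir_deriv_scaleR[OF assms])
qed

lemma avg_line_deriv:
  assumes "smooth f" and "0 \<le> r"
  shows "avg 0 r (\<lambda>s::real. 1) (\<lambda>s. s *\<^sub>R v) (dir_deriv v f) z = f (z + r *\<^sub>R v) - f z"
proof -
  have "((\<lambda>s. dir_deriv v f (z + s *\<^sub>R v)) has_integral f (z + r *\<^sub>R v) - f (z + 0 *\<^sub>R v)) {0..r}"
    by (rule fundamental_theorem_of_calculus[OF assms(2)])
      (rule has_vector_derivative_line[OF assms(1)])
  then show ?thesis unfolding avg_def by (simp add: integral_unique)
qed

text \<open>Integrating \<open>?g\<close> along \<open>w\<close> over parameters from 0 to r
  commutes with the derivative along \<open>v\<close> and, by the fundamental theorem, yields a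
  difference of values of \<open>dir_deriv v f\<close>. Differentiating both sides at r = 0 gives
  the symmetry.\<close>

lemma dir_deriv_commute:
  assumes f: "smooth f"
  shows "dir_deriv v (dir_deriv w f) = dir_deriv w (dir_deriv v f)"
proof
  fix z
  let ?g = "dir_deriv v (dir_deriv w f)"
  have g: "smooth ?g" using f by (intro smooth_dir_deriv)
  have eq: "integral {0..r} (\<lambda>s. ?g (z + s *\<^sub>R w)) = dir_deriv v f (z + r *\<^sub>R w) - dir_deriv v f z" if "0 \<le> r" for r
  proof -
    let ?A = "avg 0 r (\<lambda>s::real. 1) (\<lambda>s. s *\<^sub>R w)"
    have c: "continuous_on (cbox 0 r) (\<lambda>s::real. 1::complex)" "continuous_on (cbox 0 r) (\<lambda>s. s *\<^sub>R w)"
      by (intro continuous_intros)+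
    have "?A ?g z = dir_deriv v (?A (dir_deriv w f)) z"
      using dir_deriv_avg[OF smooth_dir_deriv[OF f] c] by simp
    also have "?A (dir_deriv w f) = (\<lambda>z. f (z + r *\<^sub>R w) - f z)"
      using avg_line_deriv[OF f that] by (rule ext)
    also have "dir_deriv v (\<lambda>z. f (z + r *\<^sub>R w) - f z) z = dir_deriv v f (z + r *\<^sub>R w) - dir_deriv v f z"
    proof (rule dir_deriv_eqI, intro has_derivative_diff smooth_has_derivative[OF f])
      show "((\<lambda>z. f (z + r *\<^sub>R w)) has_derivative (\<lambda>v. dir_deriv v f (z + r *\<^sub>R w))) (at z)"
        by (rule has_derivative_compose[OF _ smooth_has_derivative[OF f], where f="\<lambda>z. z + r *\<^sub>R w" and f'="\<lambda>v. v"])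
          (auto intro!: derivative_eq_intros)
    qed
    finally show ?thesis unfolding avg_def by simp
  qed
  have "((\<lambda>r. integral {0..r} (\<lambda>s. ?g (z + s *\<^sub>R w))) has_vector_derivative ?g (z + 0 *\<^sub>R w)) (at 0 within {0..1})"
    by (rule integral_has_vector_derivative)
      (intro continuous_on_smooth[OF g] continuous_intros, simp)
  then have 1: "((\<lambda>r. dir_deriv v f (z + r *\<^sub>R w) - dir_deriv v f z) has_vector_derivative ?g z) (at 0 within {0..1})"
    by (rule has_vector_derivative_transform[rotated 2, THEN has_vector_derivative_eq_rhs])
      (auto simp: eq)
  have 2: "((\<lambda>r. dir_deriv v f (z + r *\<^sub>R w) - dir_deriv v f z) has_vector_derivative
      dir_deriv w (dir_deriv v f) z - 0) (at 0 within {0..1})"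
    using has_vector_derivative_line[OF smooth_dir_deriv[OF f], of v z w 0]
    by (intro has_vector_derivative_diff has_vector_derivative_const) simp
  show "?g z = dir_deriv w (dir_deriv v f) z"
    using vector_derivative_unique_within[OF _ 1 2] by (simp add: trivial_limit_within islimpt_Icc)
qed

lemmas smooth_intros = smooth_plus smooth_diff smooth_minus smooth_cmult smooth_const smooth_cnj

subsection \<open>Wirtinger derivatives along a vector\<close>

text \<open>Coordinate-free Wirtinger derivatives: \<open>wirt\<close> is complex linear in
  \<open>v\<close> and \<open>wirtbar\<close> conjugate linear. They allow working in the frame
  \<open>e\<close>, \<open>u\<close> adapted to the lattice instead of the coordinate axes.\<close>

definition wirt :: "complex^'n \<Rightarrow> (complex^'n \<Rightarrow> complex) \<Rightarrow> complex^'n \<Rightarrow> complex" where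
  "wirt v f = (\<lambda>z. (dir_deriv v f z - \<i> * dir_deriv (\<i> *s v) f z) / 2)"

definition wirtbar :: "complex^'n \<Rightarrow> (complex^'n \<Rightarrow> complex) \<Rightarrow> complex^'n \<Rightarrow> complex" where
  "wirtbar v f = (\<lambda>z. (dir_deriv v f z + \<i> * dir_deriv (\<i> *s v) f z) / 2)"

lemma complex_smult_decomp: "c *s v = Re c *\<^sub>R v + Im c *\<^sub>R (\<i> *s (v :: complex^'n))"
  by (simp add: vec_eq_iff complex_eq_iff)

lemma i_smult_smult: "\<i> *s (c *s v) = Re c *\<^sub>R (\<i> *s v) - Im c *\<^sub>R (v :: complex^'n)"
  by (simp add: vec_eq_iff complex_eq_iff)

lemma axis_i: "axis k \<i> = \<i> *s (axis k 1 :: complex^'n)"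
  by (simp add: vec_eq_iff axis_def)

lemma dz_eq_wirt: "dz k = wirt (axis k 1)" and dzbar_eq_wirtbar: "dzbar k = wirtbar (axis k 1)"
  by (simp_all add: fun_eq_iff dz_def dzbar_def wirt_def wirtbar_def axis_i)

lemma dir_deriv_eq_wirt: "dir_deriv v f z = wirt v f z + wirtbar v f z"
  by (simp add: wirt_def wirtbar_def field_simps)

lemma dir_deriv_minus_vec: "smooth f \<Longrightarrow> dir_deriv (v - w) f z = dir_deriv v f z - dir_deriv w f z"
  using dir_deriv_add[of f v "-1 *\<^sub>R w" z] dir_deriv_scaleR[of f "-1" w z] by simp

lemma dir_deriv_zero: "smooth f \<Longrightarrow> dir_deriv 0 f z = 0"
  using dir_deriv_scaleR[of f 0 0 z] by simp

lemma wirt_smult: "smooth f \<Longrightarrow> wirt (c *s v) f z = c * wirt v f z"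
  and wirtbar_smult: "smooth f \<Longrightarrow> wirtbar (c *s v) f z = cnj c * wirtbar v f z"
proof -
  assume f: "smooth f"
  have 1: "dir_deriv (c *s v) f z = Re c *\<^sub>R dir_deriv v f z + Im c *\<^sub>R dir_deriv (\<i> *s v) f z"
    by (subst complex_smult_decomp) (simp only: dir_deriv_add[OF f] dir_deriv_scaleR[OF f])
  have 2: "dir_deriv (\<i> *s (c *s v)) f z = Re c *\<^sub>R dir_deriv (\<i> *s v) f z - Im c *\<^sub>R dir_deriv v f z"
    by (subst i_smult_smult) (simp only: dir_deriv_minus_vec[OF f] dir_deriv_scaleR[OF f])
  show "wirt (c *s v) f z = c * wirt v f z" "wirtbar (c *s v) f z = cnj c * wirtbar v f z"
    unfolding wirt_def wirtbar_def 1 2 by (auto simp: complex_eq_iff field_simps)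
qed

lemma wirt_add: "smooth f \<Longrightarrow> wirt (v + w) f z = wirt v f z + wirt w f z"
  and wirtbar_add: "smooth f \<Longrightarrow> wirtbar (v + w) f z = wirtbar v f z + wirtbar w f z"
  by (simp_all add: wirt_def wirtbar_def dir_deriv_add vector_add_ldistrib algebra_simps add_divide_distrib diff_divide_distrib)

lemma wirt_plus: "smooth f \<Longrightarrow> smooth g \<Longrightarrow> wirt v (\<lambda>z. f z + g z) = (\<lambda>z. wirt v f z + wirt v g z)"
  and wirtbar_plus: "smooth f \<Longrightarrow> smooth g \<Longrightarrow> wirtbar v (\<lambda>z. f z + g z) = (\<lambda>z. wirtbar v f z + wirtbar v g z)"
  by (simp_all add: wirt_def wirtbar_def dir_deriv_smooth_plus fun_eq_iff field_simps)

lemma wirt_diff: "smooth f \<Longrightarrow> smooth g \<Longrightarrow> wirt v (\<lambda>z. f z - g z) = (\<lambda>z. wirt v f z - wirt v g z)"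
  and wirtbar_diff: "smooth f \<Longrightarrow> smooth g \<Longrightarrow> wirtbar v (\<lambda>z. f z - g z) = (\<lambda>z. wirtbar v f z - wirtbar v g z)"
  by (simp_all add: wirt_def wirtbar_def dir_deriv_smooth_diff fun_eq_iff field_simps)

lemma wirt_cmult: "smooth f \<Longrightarrow> wirt v (\<lambda>z. c * f z) = (\<lambda>z. c * wirt v f z)"
  and wirtbar_cmult: "smooth f \<Longrightarrow> wirtbar v (\<lambda>z. c * f z) = (\<lambda>z. c * wirtbar v f z)"
  by (simp_all add: wirt_def wirtbar_def dir_deriv_smooth_cmult fun_eq_iff field_simps)

lemma wirt_minus: "smooth f \<Longrightarrow> wirt v (\<lambda>z. - f z) = (\<lambda>z. - wirt v f z)"
  and wirtbar_minus: "smooth f \<Longrightarrow> wirtbar v (\<lambda>z. - f z) = (\<lambda>z. - wirtbar v f z)"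
  by (simp_all add: wirt_def wirtbar_def dir_deriv_smooth_minus fun_eq_iff field_simps)

lemma wirt_const [simp]: "wirt v (\<lambda>z. c) = (\<lambda>z. 0)" and wirtbar_const [simp]: "wirtbar v (\<lambda>z. c) = (\<lambda>z. 0)"
  by (simp_all add: wirt_def wirtbar_def)

lemma wirt_cnj: "smooth f \<Longrightarrow> wirt v (\<lambda>z. cnj (f z)) = (\<lambda>z. cnj (wirtbar v f z))"
  and wirtbar_cnj: "smooth f \<Longrightarrow> wirtbar v (\<lambda>z. cnj (f z)) = (\<lambda>z. cnj (wirt v f z))"
  by (simp_all add: wirt_def wirtbar_def dir_deriv_cnj fun_eq_iff)

lemma wirt_def': "wirt v f = (\<lambda>z. (1/2) * dir_deriv v f z - (\<i>/2) * dir_deriv (\<i> *s v) f z)"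
  and wirtbar_def': "wirtbar v f = (\<lambda>z. (1/2) * dir_deriv v f z + (\<i>/2) * dir_deriv (\<i> *s v) f z)"
  by (simp_all add: wirt_def wirtbar_def fun_eq_iff field_simps)

lemma smooth_wirt: "smooth f \<Longrightarrow> smooth (wirt v f)" and smooth_wirtbar: "smooth f \<Longrightarrow> smooth (wirtbar v f)"
  unfolding wirt_def' wirtbar_def' by (intro smooth_intros smooth_dir_deriv; assumption)+

lemma wirt_commutes:
  assumes "smooth f"
  shows "wirt v (wirt w f) = wirt w (wirt v f)" "wirt v (wirtbar w f) = wirtbar w (wirt v f)"
    "wirtbar v (wirtbar w f) = wirtbar w (wirtbar v f)"
    "dir_deriv v (wirt w f) = wirt w (dir_deriv v f)" "dir_deriv v (wirtbar w f) = wirtbar w (dir_deriv v f)"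
proof -
  have dw: "dir_deriv v (wirt w f) = wirt w (dir_deriv v f)" "dir_deriv v (wirtbar w f) = wirtbar w (dir_deriv v f)" for v w
    unfolding wirt_def' wirtbar_def'
    by (simp_all only: dir_deriv_smooth_diff dir_deriv_smooth_plus dir_deriv_smooth_cmult
      smooth_cmult smooth_dir_deriv assms dir_deriv_commute[OF assms, of v w] dir_deriv_commute[OF assms, of v "\<i> *s w"])
  show "dir_deriv v (wirt w f) = wirt w (dir_deriv v f)" "dir_deriv v (wirtbar w f) = wirtbar w (dir_deriv v f)"
    by (fact dw)+
  note s = smooth_dir_deriv[OF assms] smooth_cmult[OF smooth_dir_deriv[OF assms]]
  show "wirt v (wirt w f) = wirt w (wirt v f)" "wirt v (wirtbar w f) = wirtbar w (wirt v f)"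
    "wirtbar v (wirtbar w f) = wirtbar w (wirtbar v f)"
    unfolding wirt_def'[of v] wirtbar_def'[of v] dw
    by (simp_all only: wirt_diff wirtbar_diff wirt_plus wirtbar_plus wirt_cmult wirtbar_cmult s)
qed

lemma wirt_avg:
  assumes "smooth f" "continuous_on (cbox a b) c" "continuous_on (cbox a b) g"
  shows "wirt v (avg a b c g f) = avg a b c g (wirt v f)"
    "wirtbar v (avg a b c g f) = avg a b c g (wirtbar v f)"
proof -
  note s = smooth_dir_deriv[OF assms(1)] smooth_cmult[OF smooth_dir_deriv[OF assms(1)]]
  have m: "(\<lambda>z. f z - c * g z) = (\<lambda>z. f z + (- c) * g z)" for f g :: "complex^'n \<Rightarrow> complex" and c
    by simp
  show "wirt v (avg a b c g f) = avg a b c g (wirt v f)"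
    "wirtbar v (avg a b c g f) = avg a b c g (wirtbar v f)"
    unfolding wirt_def' wirtbar_def' dir_deriv_avg[OF assms] m
    by (simp_all only: avg_plus[OF s(2) s(2) assms(2,3)] avg_cmult)
qed

lemma vec_sum_axis: "(v :: complex^'n) = (\<Sum>k\<in>UNIV. v $ k *s axis k 1)"
  by (simp add: vec_eq_iff axis_def if_distrib cong: if_cong)

lemma wirt_coords:
  assumes "smooth f"
  shows "wirt v f z = (\<Sum>k\<in>UNIV. v $ k * dz k f z)" "wirtbar v f z = (\<Sum>k\<in>UNIV. cnj (v $ k) * dzbar k f z)"
proof -
  have z: "wirt 0 f z = 0" "wirtbar 0 f z = 0"
    using wirt_smult[OF assms, of 0 0] wirtbar_smult[OF assms, of 0 0] by simp_all
  have "wirt (\<Sum>k\<in>K. v $ k *s axis k 1) f z = (\<Sum>k\<in>K. v $ k * dz k f z) \<and>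
    wirtbar (\<Sum>k\<in>K. v $ k *s axis k 1) f z = (\<Sum>k\<in>K. cnj (v $ k) * dzbar k f z)" if "finite K" for K
    using that by (induction K rule: finite_induct)
      (simp_all add: z wirt_add wirtbar_add assms wirt_smult wirtbar_smult dz_eq_wirt dzbar_eq_wirtbar)
  from this[of UNIV] show "wirt v f z = (\<Sum>k\<in>UNIV. v $ k * dz k f z)"
    "wirtbar v f z = (\<Sum>k\<in>UNIV. cnj (v $ k) * dzbar k f z)"
    by (simp_all flip: vec_sum_axis)
qed

lemma holomorphicI:
  fixes f :: "complex^'n \<Rightarrow> complex"
  assumes "smooth f" and "\<And>k z. dzbar k f z = 0"
  shows "holomorphic f"
  unfolding holomorphic_def
proof (intro allI exI conjI)
  fix z
  show "(f has_derivative (\<lambda>v. dir_deriv v f z)) (at z)" by (rule smooth_has_derivative[OF assms(1)])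
  show "dir_deriv (c *s v) f z = c * dir_deriv v f z" for c v
    by (simp add: dir_deriv_eq_wirt wirt_coords(2)[OF assms(1)] assms(2) wirt_smult[OF assms(1)])
qed

lemma has_derivative_translate:
  assumes "smooth f" shows "((\<lambda>z. f (z + a)) has_derivative (\<lambda>v. dir_deriv v f (z + a))) (at z)"
  by (rule has_derivative_compose[OF _ smooth_has_derivative[OF assms], where f="\<lambda>z. z + a" and f'="\<lambda>v. v"])
    (auto intro!: derivative_eq_intros)

subsection \<open>Smooth functions on the quotient\<close>

definition smooth_on :: "(complex^'n) set \<Rightarrow> (complex^'n \<Rightarrow> complex) set" where
  "smooth_on \<Lambda> = {f. smooth f \<and> periodic \<Lambda> f}"

lemma smooth_onD: "f \<in> smooth_on \<Lambda> \<Longrightarrow> smooth f" "f \<in> smooth_on \<Lambda> \<Longrightarrow> periodic \<Lambda> f"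
  by (auto simp: smooth_on_def)

lemma smooth_on_periodic: "f \<in> smooth_on \<Lambda> \<Longrightarrow> l \<in> \<Lambda> \<Longrightarrow> f (z + l) = f z"
  by (auto simp: smooth_on_def periodic_def)

lemma smooth_on_const: "(\<lambda>z. c) \<in> smooth_on \<Lambda>"
  by (simp add: smooth_on_def periodic_def)

lemma smooth_on_plus: "f \<in> smooth_on \<Lambda> \<Longrightarrow> g \<in> smooth_on \<Lambda> \<Longrightarrow> (\<lambda>z. f z + g z) \<in> smooth_on \<Lambda>"
  and smooth_on_diff: "f \<in> smooth_on \<Lambda> \<Longrightarrow> g \<in> smooth_on \<Lambda> \<Longrightarrow> (\<lambda>z. f z - g z) \<in> smooth_on \<Lambda>"
  and smooth_on_cmult: "f \<in> smooth_on \<Lambda> \<Longrightarrow> (\<lambda>z. c * f z) \<in> smooth_on \<Lambda>"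
  and smooth_on_minus: "f \<in> smooth_on \<Lambda> \<Longrightarrow> (\<lambda>z. - f z) \<in> smooth_on \<Lambda>"
  and smooth_on_cnj: "f \<in> smooth_on \<Lambda> \<Longrightarrow> (\<lambda>z. cnj (f z)) \<in> smooth_on \<Lambda>"
  by (simp_all add: smooth_on_def smooth_intros periodic_def)

lemma smooth_on_dir_deriv:
  assumes "f \<in> smooth_on \<Lambda>" shows "dir_deriv v f \<in> smooth_on \<Lambda>"
proof -
  have "dir_deriv v f (z + l) = dir_deriv v f z" if "l \<in> \<Lambda>" for l z
  proof -
    have "((\<lambda>z. f (z + l)) has_derivative (\<lambda>v. dir_deriv v f (z + l))) (at z)"
      by (rule has_derivative_translate[OF smooth_onD(1)[OF assms]])
    then have "(f has_derivative (\<lambda>v. dir_deriv v f (z + l))) (at z)"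
      by (simp add: smooth_on_periodic[OF assms that])
    then show ?thesis using dir_deriv_eqI[of f _ z v] by simp
  qed
  then show ?thesis using smooth_dir_deriv smooth_onD[OF assms] by (auto simp: smooth_on_def periodic_def)
qed

lemma smooth_on_iter_deriv: "f \<in> smooth_on \<Lambda> \<Longrightarrow> iter_deriv vs f \<in> smooth_on \<Lambda>"
  by (induction vs) (auto intro: smooth_on_dir_deriv)

lemma smooth_on_wirt: "f \<in> smooth_on \<Lambda> \<Longrightarrow> wirt v f \<in> smooth_on \<Lambda>"
  and smooth_on_wirtbar: "f \<in> smooth_on \<Lambda> \<Longrightarrow> wirtbar v f \<in> smooth_on \<Lambda>"
  unfolding wirt_def' wirtbar_def'
  by (intro smooth_on_diff smooth_on_plus smooth_on_cmult smooth_on_dir_deriv; assumption)+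

lemma smooth_on_avg:
  assumes "f \<in> smooth_on \<Lambda>" "continuous_on (cbox a b) c" "continuous_on (cbox a b) g"
  shows "avg a b c g f \<in> smooth_on \<Lambda>"
  using assms by (simp add: smooth_on_def smooth_avg avg_periodic)

lemmas smooth_on_intros = smooth_on_const smooth_on_plus smooth_on_diff smooth_on_cmult smooth_on_minus
  smooth_on_cnj smooth_on_wirt smooth_on_wirtbar smooth_on_dir_deriv smooth_on_iter_deriv

lemma toroidal_const:
  assumes "toroidal \<Lambda>" "f \<in> smooth_on \<Lambda>" "\<And>k z. dzbar k f z = 0"
  shows "\<exists>c. f = (\<lambda>z. c)"
proof -
  have "f constant_on UNIV"
    using assms holomorphicI[OF smooth_onD(1)[OF assms(2)]] smooth_onD(2)[OF assms(2)]
    unfolding toroidal_def by blast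
  then show ?thesis by (auto simp: constant_on_def)
qed

lemma toroidal_const':
  assumes "toroidal \<Lambda>" "f \<in> smooth_on \<Lambda>" "\<And>k z. dz k f z = 0"
  shows "\<exists>c. f = (\<lambda>z. c)"
proof -
  have "\<exists>c. (\<lambda>z. cnj (f z)) = (\<lambda>z. c)"
    using assms(3) by (intro toroidal_const[OF assms(1)] smooth_on_cnj assms(2))
      (simp add: dz_eq_wirt dzbar_eq_wirtbar wirtbar_cnj smooth_onD(1)[OF assms(2)])
  then obtain c where c: "cnj (f z) = c" for z by metis
  have "f z = cnj c" for z using c[of z] by auto
  then show ?thesis by blast
qed

lemma dir_deriv_zero_imp_eq:
  assumes "smooth f" "\<And>z. dir_deriv v f z = 0" shows "f (z + s *\<^sub>R v) = f z"
proof -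
  have "((\<lambda>s. f (z + s *\<^sub>R v)) has_derivative (\<lambda>h. 0)) (at s within UNIV)" for s
    using has_vector_derivative_line[OF assms(1), of z v s UNIV] assms(2) by (simp add: has_vector_derivative_def)
  then obtain c where "\<And>s. s \<in> UNIV \<Longrightarrow> f (z + s *\<^sub>R v) = c"
    using has_derivative_zero_constant[of UNIV "\<lambda>s. f (z + s *\<^sub>R v)"] by auto
  from this[of s] this[of 0] show ?thesis by simp
qed

subsection \<open>Discrete subgroups\<close>

locale subgroup_vec =
  fixes \<Lambda> :: "'a::euclidean_space set"
  assumes zero: "0 \<in> \<Lambda>" and diff: "x \<in> \<Lambda> \<Longrightarrow> y \<in> \<Lambda> \<Longrightarrow> x - y \<in> \<Lambda>"
begin

lemma uminus: "x \<in> \<Lambda> \<Longrightarrow> - x \<in> \<Lambda>"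
  using diff[OF zero] by simp

lemma add: "x \<in> \<Lambda> \<Longrightarrow> y \<in> \<Lambda> \<Longrightarrow> x + y \<in> \<Lambda>"
  using diff[OF _ uminus] by fastforce

lemma scale_int:
  assumes "x \<in> \<Lambda>" shows "of_int n *\<^sub>R x \<in> \<Lambda>"
proof -
  have nat: "of_nat m *\<^sub>R x \<in> \<Lambda>" for m
    by (induction m) (auto simp: zero algebra_simps intro: add assms)
  show ?thesis
  proof (cases "n \<ge> 0")
    case True then show ?thesis using nat[of "nat n"] by simp
  next
    case False then show ?thesis using uminus[OF nat[of "nat (- n)"]] by simp
  qed
qed

text \<open>Translation makes the isolation radius of 0 uniform, so the group is closed; its part in
  \<open>K\<close> is then compact and discrete.\<close>

lemma finite_Int_compact:
  assumes "discrete \<Lambda>" "compact K" shows "finite (\<Lambda> \<inter> K)"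
proof -
  obtain d where d: "d > 0" "\<And>y. y \<in> \<Lambda> \<Longrightarrow> dist 0 y < d \<Longrightarrow> y = 0"
    using discreteD[OF assms(1) zero] by (auto simp: isolated_in_dist_Ex_iff)
  have ud: "uniform_discrete \<Lambda>"
    unfolding uniform_discrete_def using d diff
    by (intro exI[of _ d]) (metis dist_norm dist_0_norm eq_iff_diff_eq_0)
  then have "compact (\<Lambda> \<inter> K)" using assms(2) uniform_discrete_imp_closed closed_Int_compact by blast
  moreover have "discrete (\<Lambda> \<inter> K)" using assms(1) discrete_subset by blast
  ultimately show ?thesis using discrete_compact_finite_iff by blast
qed

end

text \<open>The closed parallelepiped of the listed vectors, built one vector at a time so that it
  matches the iterated integral \<open>torus_mean\<close>.\<close>

primrec cell :: "'a::euclidean_space list \<Rightarrow> 'a set" where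
  "cell [] = {0}"
| "cell (l # ls) = {s *\<^sub>R l + v |s v. s \<in> {0..1} \<and> v \<in> cell ls}"

lemma compact_cell: "compact (cell ls)"
proof (induction ls)
  case (Cons l ls)
  have "cell (l # ls) = (\<lambda>(s, v). s *\<^sub>R l + v) ` ({0..1} \<times> cell ls)" by force
  moreover have "continuous_on ({0..1} \<times> cell ls) (\<lambda>(s, v). s *\<^sub>R l + v)"
    unfolding split_beta by (intro continuous_intros)
  ultimately show ?case using Cons by (auto intro!: compact_continuous_image compact_Times)
qed simp

text \<open>Rounding every coefficient down subtracts a lattice vector and leaves fractional
  parts.\<close>

lemma (in subgroup_vec) cell_cover:
  "set ls \<subseteq> \<Lambda> \<Longrightarrow> v \<in> span (set ls) \<Longrightarrow> \<exists>l\<in>\<Lambda>. v - l \<in> cell ls"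
proof (induction ls arbitrary: v)
  case Nil then show ?case using zero by auto
next
  case (Cons a ls)
  then obtain k where "v - k *\<^sub>R a \<in> span (set ls)" by (auto simp: span_breakdown_eq)
  with Cons obtain l where l: "l \<in> \<Lambda>" "v - k *\<^sub>R a - l \<in> cell ls" by auto
  show ?case
  proof (intro bexI)
    show "l + of_int \<lfloor>k\<rfloor> *\<^sub>R a \<in> \<Lambda>" using l Cons.prems by (auto intro: add scale_int)
    have "v - (l + of_int \<lfloor>k\<rfloor> *\<^sub>R a) = frac k *\<^sub>R a + (v - k *\<^sub>R a - l)"
      by (simp add: frac_def algebra_simps)
    then show "v - (l + of_int \<lfloor>k\<rfloor> *\<^sub>R a) \<in> cell (a # ls)"
      using l(2) frac_lt_1[of k] frac_ge_0[of k] unfolding cell.simps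
      by (intro CollectI exI[of _ "frac k"] exI[of _ "v - k *\<^sub>R a - l"]) simp
  qed
qed

lemma cell_subset_span: "cell ls \<subseteq> span (set ls)"
proof (induction ls)
  case (Cons a ls)
  have "span (set ls) \<subseteq> span (set (a # ls))" by (rule span_mono) auto
  with Cons have "v \<in> span (set (a # ls))" if "v \<in> cell ls" for v using that by blast
  moreover have "a \<in> span (set (a # ls))" by (rule span_base) simp
  ultimately show ?case by (auto simp del: set_simps intro!: span_add span_scale)
qed (simp add: span_0)

lemma ex_spanning_list:
  fixes \<Lambda> :: "'a::euclidean_space set"
  obtains ls where "set ls \<subseteq> \<Lambda>" "span (set ls) = span \<Lambda>"
proof -
  obtain B where B: "B \<subseteq> \<Lambda>" "independent B" "\<Lambda> \<subseteq> span B" by (meson basis_exists)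
  then obtain ls where "set ls = B" using finiteI_independent finite_list by blast
  with B that show ?thesis by (metis span_minimal span_mono subset_antisym subspace_span)
qed

text \<open>The quotient is the continuous image of a cell. Read contrapositively, noncompactness
  provides a nonzero vector orthogonal to the lattice.\<close>

lemma compact_quotient:
  fixes \<Lambda> :: "(complex^'n) set"
  assumes \<Lambda>: "discrete_subgroup \<Lambda>" and sp: "span \<Lambda> = UNIV"
  shows "compact_space (quotient_top \<Lambda>)"
proof -
  interpret subgroup_vec \<Lambda> using \<Lambda> by unfold_locales (auto simp: discrete_subgroup_def)
  define p where "p z = {w. w - z \<in> \<Lambda>}" for z
  have cos: "cosets \<Lambda> = range p" by (auto simp: cosets_def quotient_def p_def)
  have eq: "p z = p w" if "z - w \<in> \<Lambda>" for z w
  proof -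
    have "x - z \<in> \<Lambda> \<longleftrightarrow> x - w \<in> \<Lambda>" for x
      using add[OF that, of "x - z"] diff[OF _ that, of "x - w"] by auto
    then show ?thesis by (auto simp: p_def)
  qed
  have self: "z \<in> p z" for z using zero by (simp add: p_def)
  have "\<Union> (cosets \<Lambda>) = UNIV" using self by (auto simp: cos)
  then have top: "topspace (quotient_top \<Lambda>) = cosets \<Lambda>"
    unfolding topspace_def openin_quotient_top[OF \<Lambda>] by (auto intro!: exI[of _ "cosets \<Lambda>"])
  have cont: "continuous_map euclidean (quotient_top \<Lambda>) p"
    unfolding continuous_map_def top
  proof (intro conjI allI impI)
    show "p \<in> topspace euclidean \<rightarrow> cosets \<Lambda>" by (auto simp: cos)
    fix U assume U: "openin (quotient_top \<Lambda>) U"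
    have "{x \<in> topspace euclidean. p x \<in> U} = \<Union> U"
    proof (intro set_eqI iffI)
      fix x assume "x \<in> \<Union> U"
      then obtain y where y: "p y \<in> U" "x \<in> p y" using U by (auto simp: openin_quotient_top[OF \<Lambda>] cos)
      then show "x \<in> {x \<in> topspace euclidean. p x \<in> U}" using eq[of x y] by (simp add: p_def)
    qed (use self in auto)
    then show "openin euclidean {x \<in> topspace euclidean. p x \<in> U}"
      using U by (simp add: openin_quotient_top[OF \<Lambda>])
  qed
  obtain ls where ls: "set ls \<subseteq> \<Lambda>" "span (set ls) = UNIV" using sp by (metis ex_spanning_list)
  have "p ` cell ls = cosets \<Lambda>"
  proof -
    have "p z \<in> p ` cell ls" for z
    proof -
      obtain l where "l \<in> \<Lambda>" "z - l \<in> cell ls" using cell_cover[OF ls(1), of z] ls(2) by auto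
      then show ?thesis using eq[of z "z - l"] by auto
    qed
    then show ?thesis by (auto simp: cos)
  qed
  moreover have "compactin (quotient_top \<Lambda>) (p ` cell ls)"
    by (rule image_compactin[OF _ cont]) (simp add: compact_cell)
  ultimately show ?thesis by (simp add: compact_space_def top)
qed

text \<open>A positive element below \<open>e\<close> would have a multiple within \<open>e\<close>
  of \<open>x\<close>. Hence positive elements are at least \<open>e\<close>, their infimum is
  attained, and division with remainder shows that it generates.\<close>

lemma not_dense_imp_cyclic:
  fixes S :: "real set"
  assumes zero: "0 \<in> S" and diff: "\<And>x y. x \<in> S \<Longrightarrow> y \<in> S \<Longrightarrow> x - y \<in> S"
    and e: "e > 0" and nd: "\<And>s. s \<in> S \<Longrightarrow> \<bar>s - x\<bar> \<ge> e"
  shows "\<exists>c>0. \<forall>s\<in>S. \<exists>n::int. s = of_int n * c"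
proof -
  interpret subgroup_vec S using zero diff by unfold_locales
  have gap: "s \<ge> e" if "s \<in> S" "s > 0" for s
  proof (rule ccontr)
    assume "\<not> s \<ge> e"
    moreover have "of_int \<lfloor>x / s\<rfloor> * s \<in> S" using scale_int[OF that(1)] by simp
    moreover have "\<bar>of_int \<lfloor>x / s\<rfloor> * s - x\<bar> \<le> s"
    proof -
      have "of_int \<lfloor>x / s\<rfloor> * s \<le> x" using floor_divide_lower[OF that(2)] .
      moreover have "x < (of_int \<lfloor>x / s\<rfloor> + 1) * s" using floor_divide_upper[OF that(2)] .
      ultimately show ?thesis by (simp add: algebra_simps)
    qed
    ultimately show False using nd by fastforce
  qed
  define P where "P = {s \<in> S. s > 0}"
  show ?thesis
  proof (cases "P = {}")
    case True
    then have "s = 0" if "s \<in> S" for s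
      using that uminus[OF that] unfolding P_def
      by (metis (mono_tags, lifting) empty_iff linorder_less_linear mem_Collect_eq neg_0_less_iff_less)
    then show ?thesis by (intro exI[of _ 1]) (auto intro!: exI[of _ 0])
  next
    case False
    define c where "c = Inf P"
    have bdd: "bdd_below P" using gap unfolding P_def by (intro bdd_belowI[of _ e]) auto
    have ce: "c \<ge> e" unfolding c_def using False gap by (intro cInf_greatest) (auto simp: P_def)
    have "Inf P < c + e" using e by (simp add: c_def)
    then obtain s where s: "s \<in> P" "s < c + e" using False cInf_lessD by blast
    have cs: "c \<le> s" using cInf_lower[OF s(1) bdd] by (simp add: c_def)
    \<comment> \<open>Otherwise two elements of \<open>P\<close> between \<open>c\<close> and
      \<open>c + e\<close> would differ by a positive group element below \<open>e\<close>.\<close>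
    have cP: "c \<in> P"
    proof (rule ccontr)
      assume "c \<notin> P"
      with cs s(1) have "Inf P < s" by (cases "c = s") (auto simp: c_def)
      then obtain s' where s': "s' \<in> P" "s' < s" using False cInf_lessD by blast
      have "c \<le> s'" using cInf_lower[OF s'(1) bdd] by (simp add: c_def)
      moreover have "s - s' \<ge> e" using gap[of "s - s'"] s s' diff by (auto simp: P_def)
      ultimately show False using s by simp
    qed
    have "s = of_int \<lfloor>s / c\<rfloor> * c" if "s \<in> S" for s
    proof (rule ccontr)
      assume ne: "s \<noteq> of_int \<lfloor>s / c\<rfloor> * c"
      have c0: "c > 0" using ce e by simp
      have in_S: "s - of_int \<lfloor>s / c\<rfloor> * c \<in> S"
        using that scale_int[of c "\<lfloor>s / c\<rfloor>"] cP diff by (auto simp: P_def)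
      have "of_int \<lfloor>s / c\<rfloor> * c \<le> s" using floor_divide_lower[OF c0] .
      with ne in_S have "s - of_int \<lfloor>s / c\<rfloor> * c \<in> P" by (auto simp: P_def)
      then have "c \<le> s - of_int \<lfloor>s / c\<rfloor> * c" using cInf_lower[OF _ bdd] by (simp add: c_def)
      moreover have "s < (of_int \<lfloor>s / c\<rfloor> + 1) * c" using floor_divide_upper[OF c0] .
      ultimately show False by (simp add: algebra_simps)
    qed
    then show ?thesis using ce e by (intro exI[of _ c]) auto
  qed
qed

subsection \<open>Complex linear forms that are real on the lattice\<close>

text \<open>The factor \<open>\<i>\<close> moves the real inner product with \<open>a\<close> into
  the imaginary part. So the form is real exactly on the real hyperplane orthogonal to
  \<open>a\<close>.\<close>

definition clin :: "complex^'n \<Rightarrow> complex^'n \<Rightarrow> complex" where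
  "clin a z = \<i> * (\<Sum>k\<in>UNIV. cnj (a $ k) * z $ k)"

lemma clin_add: "clin a (z + w) = clin a z + clin a w"
  and clin_smult: "clin a (c *s z) = c * clin a z"
  and clin_scaleR: "clin a (r *\<^sub>R z) = r *\<^sub>R clin a z"
  and clin_add_left: "clin (a + b) z = clin a z + clin b z"
  and clin_scaleR_left: "clin (r *\<^sub>R a) z = r *\<^sub>R clin a z"
  by (simp_all add: clin_def algebra_simps sum.distrib sum_distrib_left scaleR_conv_of_real[where 'a=complex])

lemma bounded_linear_clin: "bounded_linear (clin a)"
  by (rule linear_conv_bounded_linear[THEN iffD1]) (auto intro!: linearI simp: clin_add clin_scaleR)

lemma Im_clin: "Im (clin a z) = a \<bullet> z"
  by (simp add: clin_def inner_vec_def inner_complex_def)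

lemma clin_self_neq_0: "a \<noteq> 0 \<Longrightarrow> clin a a \<noteq> 0"
  using Im_clin[of a a] by (metis inner_eq_zero_iff zero_complex.simps(2))

lemma clin_dense:
  assumes tor: "toroidal \<Lambda>" and a: "a \<noteq> 0" "\<And>l. l \<in> \<Lambda> \<Longrightarrow> a \<bullet> l = 0" and e: "e > 0"
  shows "\<exists>l\<in>\<Lambda>. \<bar>Re (clin a l) - x\<bar> < e"
proof (rule ccontr)
  assume "\<not> ?thesis"
  then have nd: "\<And>l. l \<in> \<Lambda> \<Longrightarrow> \<bar>Re (clin a l) - x\<bar> \<ge> e" by force
  interpret subgroup_vec \<Lambda>
    using tor by unfold_locales (auto simp: toroidal_def discrete_subgroup_def)
  have diff': "clin a x - clin a y = clin a (x - y)" for x y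
    using clin_add[of a "x - y" y] by simp
  have "\<exists>c>0. \<forall>s\<in>(\<lambda>l. Re (clin a l)) ` \<Lambda>. \<exists>n::int. s = of_int n * c"
  proof (rule not_dense_imp_cyclic[OF _ _ e])
    show "0 \<in> (\<lambda>l. Re (clin a l)) ` \<Lambda>" using zero by (force simp: clin_def)
    show "\<And>x y. x \<in> (\<lambda>l. Re (clin a l)) ` \<Lambda> \<Longrightarrow> y \<in> (\<lambda>l. Re (clin a l)) ` \<Lambda> \<Longrightarrow>
           x - y \<in> (\<lambda>l. Re (clin a l)) ` \<Lambda>"
      using diff diff' by (auto simp flip: minus_complex.simps intro!: imageI)
    show "\<And>s. s \<in> (\<lambda>l. Re (clin a l)) ` \<Lambda> \<Longrightarrow> e \<le> \<bar>s - x\<bar>" using nd by auto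
  qed
  then obtain c where c: "c > 0" "\<And>l. l \<in> \<Lambda> \<Longrightarrow> \<exists>n::int. Re (clin a l) = of_int n * c" by auto
  \<comment> \<open>When all values of the form on the lattice are integer multiples of
    \<open>c\<close>, every lattice vector is a period of this exponential.\<close>
  define f where "f z = exp (2 * pi * \<i> / c * clin a z)" for z
  have "holomorphic f"
    unfolding holomorphic_def
  proof (intro allI exI conjI)
    fix z
    have "((\<lambda>z. 2 * pi * \<i> / c * clin a z) has_derivative (\<lambda>v. 2 * pi * \<i> / c * clin a v)) (at z)"
      by (intro has_derivative_mult_right bounded_linear_imp_has_derivative bounded_linear_clin)
    from has_derivative_compose[OF this DERIV_exp[THEN has_field_derivative_imp_has_derivative]]
    show "(f has_derivative (\<lambda>v. f z * (2 * pi * \<i> / c * clin a v))) (at z)"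
      unfolding f_def .
    show "f z * (2 * pi * \<i> / c * clin a (d *s v)) = d * (f z * (2 * pi * \<i> / c * clin a v))" for d v
      by (simp add: clin_smult)
  qed
  moreover have "periodic \<Lambda> f"
    unfolding periodic_def
  proof (intro ballI allI)
    fix l z assume l: "l \<in> \<Lambda>"
    obtain n :: int where "Re (clin a l) = of_int n * c" using c(2)[OF l] by auto
    then have "clin a l = of_int n * of_real c" using a(2)[OF l] by (simp add: complex_eq_iff Im_clin)
    then have "2 * pi * \<i> / c * clin a l = 2 * pi * of_int n * \<i>" using c(1) by simp
    then have "exp (2 * pi * \<i> / c * clin a l) = 1" by (simp add: exp_eq_1)
    then show "f (z + l) = f z" by (simp add: f_def clin_add distrib_left exp_add)
  qed
  ultimately have "f constant_on UNIV" using tor by (auto simp: toroidal_def)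
  \<comment> \<open>At this point the exponent equals 1 and at the origin it equals 0, so a constant
    \<open>f\<close> would force exp 1 = 1.\<close>
  then have "f ((1 / (2 * pi * \<i> / c * clin a a)) *s a) = f 0" by (auto simp: constant_on_def)
  moreover have "2 * pi * \<i> / c * clin a a \<noteq> 0" using c(1) clin_self_neq_0[OF a(1)] by simp
  ultimately have "exp (1::complex) = 1"
    by (simp add: f_def clin_smult clin_def[of a 0])
  then have "exp (1::real) = 1" by (metis exp_of_real of_real_1 of_real_eq_iff)
  then show False by simp
qed

text \<open>A smaller span would have a second orthogonal direction \<open>b\<close>, hence a real
  plane of forms that are real on the lattice, and some nonzero form \<open>d\<close> in it kills a
  lattice vector \<open>l0\<close>. As the lattice spans at most two real dimensions, the values of
  \<open>d\<close> reduce modulo \<open>l0\<close> to finitely many in a segment, against their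
  density.\<close>

lemma span_lattice:
  fixes \<Lambda> :: "(complex^2) set"
  assumes tor: "toroidal \<Lambda>" and a: "a \<noteq> 0" "\<And>l. l \<in> \<Lambda> \<Longrightarrow> a \<bullet> l = 0"
  shows "span \<Lambda> = {z. a \<bullet> z = 0}"
proof (rule ccontr)
  assume ne: "span \<Lambda> \<noteq> {z. a \<bullet> z = 0}"
  interpret subgroup_vec \<Lambda>
    using tor by unfold_locales (auto simp: toroidal_def discrete_subgroup_def)
  have disc: "discrete \<Lambda>" using tor by (simp add: toroidal_def discrete_subgroup_def)
  have sub: "subspace {z. a \<bullet> z = 0}" by (rule subspace_hyperplane)
  have "span \<Lambda> \<subseteq> {z. a \<bullet> z = 0}" using a(2) by (intro span_minimal sub) auto
  then have "span \<Lambda> \<subset> span {z. a \<bullet> z = 0}"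
    using ne by (simp only: span_eq_iff[THEN iffD2, OF sub] psubset_eq not_False_eq_True simp_thms)
  then obtain b where "b \<noteq> 0" "b \<in> span {z. a \<bullet> z = 0}" "\<And>y. y \<in> span \<Lambda> \<Longrightarrow> orthogonal b y"
    by (rule orthogonal_to_subspace_exists_gen) blast
  then have b: "b \<noteq> 0" "a \<bullet> b = 0" "\<And>y. y \<in> span \<Lambda> \<Longrightarrow> b \<bullet> y = 0"
    by (simp_all only: span_eq_iff[THEN iffD2, OF sub] mem_Collect_eq orthogonal_def not_False_eq_True)
  have indep: "x *\<^sub>R a + y *\<^sub>R b \<noteq> 0" if "(x, y) \<noteq> (0, 0)" for x y
  proof
    assume *: "x *\<^sub>R a + y *\<^sub>R b = 0"
    have "(x *\<^sub>R a + y *\<^sub>R b) \<bullet> a = x * (a \<bullet> a)" "(x *\<^sub>R a + y *\<^sub>R b) \<bullet> b = y * (b \<bullet> b)"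
      using b(2) by (simp_all add: inner_add_left inner_commute[of b a])
    with * a(1) b(1) that show False by simp
  qed
  have orth: "(x *\<^sub>R a + y *\<^sub>R b) \<bullet> l = 0" if "l \<in> \<Lambda>" for x y l
    using a(2) b(3)[OF span_base] that by (simp add: inner_add_left)
  \<comment> \<open>Four real dimensions, less the two spanned by \<open>a\<close> and
    \<open>b\<close>.\<close>
  have dim: "dim \<Lambda> \<le> 2"
  proof -
    have "a \<noteq> b" using a(1) b(2) by auto
    moreover have "pairwise orthogonal {a, b}" using b(2) by (auto simp: pairwise_def orthogonal_def inner_commute)
    then have "independent {a, b}" using a(1) b(1) by (intro pairwise_orthogonal_independent) auto
    ultimately have "dim {a, b} = 2" by (simp add: dim_eq_card_independent)
    moreover have "dim (\<Lambda> \<union> {a, b}) = dim \<Lambda> + dim {a, b}"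
      using orth[of _ 1 0] orth[of _ 0 1] by (intro dim_orthogonal_sum) (auto simp: inner_commute)
    moreover have "dim (\<Lambda> \<union> {a, b}) \<le> DIM(complex^2)" by (rule dim_subset_UNIV)
    ultimately show ?thesis by simp
  qed
  obtain l0 where l0: "l0 \<in> \<Lambda>" "\<bar>Re (clin a l0) - 1\<bar> < 1" using clin_dense[OF tor a, of 1 1] by auto
  have l0n: "Re (clin a l0) \<noteq> 0" using l0(2) by auto
  \<comment> \<open>Both forms are real at \<open>l0\<close>, so this real combination annihilates
    it; it is nonzero because the coefficient of \<open>b\<close> is.\<close>
  define d where "d = Re (clin b l0) *\<^sub>R a + (- Re (clin a l0)) *\<^sub>R b"
  have d: "d \<noteq> 0" "\<And>l. l \<in> \<Lambda> \<Longrightarrow> d \<bullet> l = 0"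
    unfolding d_def using l0n by (intro indep orth; simp)+
  have dl0: "clin d l0 = 0"
  proof -
    have "clin d l0 = Re (clin b l0) *\<^sub>R clin a l0 + (- Re (clin a l0)) *\<^sub>R clin b l0"
      by (simp only: d_def clin_add_left clin_scaleR_left)
    moreover have "Im (clin a l0) = 0" "Im (clin b l0) = 0"
      using orth[OF l0(1), of 1 0] orth[OF l0(1), of 0 1] by (simp_all add: Im_clin)
    ultimately show ?thesis by (simp add: complex_eq_iff)
  qed
  obtain l1 where l1: "l1 \<in> \<Lambda>" "\<bar>Re (clin d l1) - 1\<bar> < 1" using clin_dense[OF tor d, of 1 1] by auto
  have l1n: "Re (clin d l1) \<noteq> 0" using l1(2) by auto
  have l0z: "l0 \<noteq> 0" using l0n by (auto simp: clin_def)
  have "l1 \<notin> span {l0}"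
    using l1n dl0 by (auto simp: span_singleton clin_scaleR)
  then have ind: "independent {l1, l0}" using l0z by (intro independent_insertI) (auto simp: independent_empty)
  have "l0 \<noteq> l1" using \<open>l1 \<notin> span {l0}\<close> span_base by blast
  then have "card {l1, l0} = 2" by simp
  then have sp: "\<Lambda> \<subseteq> span {l1, l0}"
    using card_ge_dim_independent[of "{l1, l0}" \<Lambda>] ind l0 l1 dim by auto
  let ?K = "cell [l1, l0]"
  \<comment> \<open>Subtracting multiples of \<open>l0\<close> leaves the value of
    \<open>clin d\<close> unchanged and moves the vector into a compact cell, so only finitely many
    values occur in the segment.\<close>
  have coord: "\<exists>k\<in>\<Lambda> \<inter> ?K. Re (clin d k) = Re (clin d l)"
    if l: "l \<in> \<Lambda>" "Re (clin d l) / Re (clin d l1) \<in> {0..1}" for l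
  proof -
    obtain y x where yx: "l - y *\<^sub>R l1 - x *\<^sub>R l0 = 0"
      using sp l(1) by (force simp: span_breakdown_eq)
    then have l_eq: "l = y *\<^sub>R l1 + x *\<^sub>R l0" by (simp add: algebra_simps)
    have "Re (clin d l) = y * Re (clin d l1)" by (simp add: l_eq clin_add clin_scaleR dl0)
    then have y: "y \<in> {0..1}" using l(2) l1n by simp
    let ?k = "l - of_int \<lfloor>x\<rfloor> *\<^sub>R l0"
    have "?k \<in> \<Lambda>" using diff scale_int l l0 by blast
    moreover have "?k = y *\<^sub>R l1 + (frac x *\<^sub>R l0 + 0)" by (simp add: l_eq frac_def algebra_simps)
    then have "?k \<in> ?K" using y frac_lt_1[of x] frac_ge_0[of x] unfolding cell.simps
      by (intro CollectI exI[of _ y] exI[of _ "frac x *\<^sub>R l0 + 0"] exI[of _ "frac x"] exI[of _ 0] conjI) (auto simp: less_imp_le)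
    moreover have "clin d l = clin d ?k + clin d (of_int \<lfloor>x\<rfloor> *\<^sub>R l0)" by (simp flip: clin_add)
    then have "Re (clin d ?k) = Re (clin d l)" by (simp add: clin_scaleR dl0)
    ultimately show ?thesis by blast
  qed
  have fin: "finite ((\<lambda>k. Re (clin d k)) ` (\<Lambda> \<inter> ?K))"
    by (intro finite_imageI finite_Int_compact disc compact_cell)
  let ?F = "(\<lambda>k. Re (clin d k)) ` (\<Lambda> \<inter> ?K)" and ?r = "Re (clin d l1)"
  have inf: "infinite {0<..<1::real}" by (rule infinite_Ioo) simp
  have "\<exists>x\<in>{0<..<1}. \<exists>e>0. \<forall>k\<in>?F. \<bar>k / ?r - x\<bar> \<ge> e"
  proof -
    obtain x where x: "x \<in> {0<..<1}" "x \<notin> (\<lambda>k. k / ?r) ` ?F"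
      using inf finite_imageI[OF fin, of "\<lambda>k. k / ?r"] by (meson finite_subset subsetI)
    have "closed ((\<lambda>k. k / ?r) ` ?F)" by (intro finite_imp_closed finite_imageI fin)
    then obtain e where e: "e > 0" "\<And>y. \<bar>y - x\<bar> < e \<Longrightarrow> y \<notin> (\<lambda>k. k / ?r) ` ?F"
      using x(2) by (metis Compl_iff closed_def dist_real_def open_dist)
    then show ?thesis using x(1) by (meson imageI not_le)
  qed
  then obtain x e where x: "x \<in> {0<..<1}" "e > 0" "\<And>k. k \<in> ?F \<Longrightarrow> \<bar>k / ?r - x\<bar> \<ge> e" by blast
  \<comment> \<open>Small enough that a ratio within \<open>e'\<close> of \<open>x\<close> stays in
    the unit interval, where \<open>coord\<close> applies.\<close>
  define e' where "e' = min e (min x (1 - x))"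
  have e': "e' > 0" "e' \<le> e" "e' \<le> x" "e' \<le> 1 - x" using x by (auto simp: e'_def)
  obtain l where l: "l \<in> \<Lambda>" "\<bar>Re (clin d l) - x * ?r\<bar> < e' * \<bar>?r\<bar>"
    using clin_dense[OF tor d, of "e' * \<bar>?r\<bar>" "x * ?r"] e' l1n by auto
  have "Re (clin d l) / ?r - x = (Re (clin d l) - x * ?r) / ?r" using l1n by (simp add: field_simps)
  then have lt: "\<bar>Re (clin d l) / ?r - x\<bar> < e'" using l(2) l1n by (simp add: abs_divide divide_less_eq)
  then have "Re (clin d l) / ?r \<in> {0..1}" using e' by auto
  then show False using coord[OF l(1)] x(3) lt e' by fastforce
qed

text \<open>The normalisation \<open>L u = 1\<close> makes the derivative along
  \<open>\<i> *s u\<close> the derivative in the height t = Im L, while \<open>u\<close> itself is a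
  period. The periods in \<open>ls\<close> have the hyperplane of height 0 as real span; torus means
  are taken over their cell.\<close>

locale toroidal_frame =
  fixes \<Lambda> :: "(complex^2) set" and L :: "complex^2 \<Rightarrow> complex" and e u :: "complex^2" and ls :: "(complex^2) list"
  assumes toroidal: "toroidal \<Lambda>"
    and L_add: "L (z + w) = L z + L w" and L_smult: "L (c *s z) = c * L z"
    and L_e: "L e = 0" and e_neq_0: "e \<noteq> 0" and L_u: "L u = 1" and u_in: "u \<in> \<Lambda>"
    and L_real: "l \<in> \<Lambda> \<Longrightarrow> Im (L l) = 0"
    and dense: "r > 0 \<Longrightarrow> \<exists>l\<in>\<Lambda>. \<bar>Re (L l) - x\<bar> < r"
    and ls_subset: "set ls \<subseteq> \<Lambda>" and span_ls: "span (set ls) = {z. Im (L z) = 0}"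

lemma ex_toroidal_frame:
  fixes \<Lambda> :: "(complex^2) set"
  assumes tor: "toroidal \<Lambda>" and nc: "\<not> compact_space (quotient_top \<Lambda>)"
  shows "\<exists>L e u ls. toroidal_frame \<Lambda> L e u ls"
proof -
  have "span \<Lambda> \<noteq> UNIV" using compact_quotient[of \<Lambda>] tor nc by (auto simp: toroidal_def)
  then obtain a where a: "a \<noteq> 0" "\<And>l. l \<in> span \<Lambda> \<Longrightarrow> a \<bullet> l = 0" using span_not_UNIV_orthogonal by blast
  then have a': "\<And>l. l \<in> \<Lambda> \<Longrightarrow> a \<bullet> l = 0" by (simp add: span_base)
  obtain u where u: "u \<in> \<Lambda>" "\<bar>Re (clin a u) - 1\<bar> < 1" using clin_dense[OF tor a(1) a', of 1 1] by auto
  define r where "r = Re (clin a u)"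
  have r: "r \<noteq> 0" using u(2) by (auto simp: r_def)
  define L where "L z = clin a z / r" for z
  \<comment> \<open>The coefficients of the form swapped with one sign: the kernel of a nonzero
    linear form in two variables.\<close>
  define e :: "complex^2" where "e = (\<chi> k. if k = 1 then cnj (a $ 2) else - cnj (a $ 1))"
  obtain ls where ls: "set ls \<subseteq> \<Lambda>" "span (set ls) = span \<Lambda>" by (metis ex_spanning_list)
  have "toroidal_frame \<Lambda> L e u ls"
  proof
    show "L (z + w) = L z + L w" for z w by (simp add: L_def clin_add add_divide_distrib)
    show "L (c *s z) = c * L z" for c z by (simp add: L_def clin_smult)
    show "L e = 0" by (simp add: L_def clin_def sum_2 e_def)
    show "e \<noteq> 0" using a(1) by (auto simp: vec_eq_iff e_def forall_2)
    show "L u = 1" using r a'[OF u(1)] by (simp add: L_def r_def complex_eq_iff Im_clin)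
    show "u \<in> \<Lambda>" "set ls \<subseteq> \<Lambda>" "toroidal \<Lambda>" by (fact u ls tor)+
    show "Im (L l) = 0" if "l \<in> \<Lambda>" for l using a'[OF that] by (simp add: L_def Im_clin)
    show "span (set ls) = {z. Im (L z) = 0}"
      using span_lattice[OF tor a(1) a'] ls(2) r by (simp add: L_def Im_clin)
    show "\<exists>l\<in>\<Lambda>. \<bar>Re (L l) - x\<bar> < s" if "s > 0" for x s
    proof -
      obtain l where l: "l \<in> \<Lambda>" "\<bar>Re (clin a l) - x * r\<bar> < s * \<bar>r\<bar>"
        using clin_dense[OF tor a(1) a', of "s * \<bar>r\<bar>" "x * r"] r \<open>s > 0\<close> by auto
      have "Re (L l) - x = (Re (clin a l) - x * r) / r" using r by (simp add: L_def field_simps)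
      then have "\<bar>Re (L l) - x\<bar> < s" using l(2) r by (simp add: abs_divide divide_less_eq)
      then show ?thesis using l(1) by blast
    qed
  qed
  then show ?thesis by blast
qed

subsection \<open>Means over a torus\<close>

definition line_mean :: "complex^'n \<Rightarrow> (complex^'n \<Rightarrow> complex) \<Rightarrow> complex^'n \<Rightarrow> complex" where
  "line_mean l = avg (0::real) 1 (\<lambda>s. 1) (\<lambda>s. s *\<^sub>R l)"

lemma line_kernel [intro, simp]: "continuous_on S (\<lambda>s::real. 1::complex)" "continuous_on S (\<lambda>s::real. s *\<^sub>R (l::'a::real_normed_vector))"
  by (intro continuous_intros)+

primrec torus_mean :: "(complex^'n) list \<Rightarrow> (complex^'n \<Rightarrow> complex) \<Rightarrow> complex^'n \<Rightarrow> complex" where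
  "torus_mean [] f = f"
| "torus_mean (l # ls) f = line_mean l (torus_mean ls f)"

text \<open>An average with a probability weight stays in every closed disc that contains the
  averaged values. The estimates for line, torus and disc means all rest on this.\<close>

lemma avg_near:
  fixes f :: "complex^'n \<Rightarrow> complex"
  assumes f: "smooth f" and w: "continuous_on (cbox a b) w" "continuous_on (cbox a b) g"
    and pos: "\<And>x. x \<in> cbox a b \<Longrightarrow> 0 \<le> w x" and one: "integral (cbox a b) w = 1"
    and near: "\<And>x. x \<in> cbox a b \<Longrightarrow> cmod (f (z + g x) - k) \<le> r"
  shows "cmod (avg a b (\<lambda>x. of_real (w x)) g f z - k) \<le> r"
proof -
  have w': "continuous_on (cbox a b) (\<lambda>x. complex_of_real (w x))" using w(1) by (intro continuous_intros)
  have "smooth (\<lambda>z. f z - k)" using f by (intro smooth_intros)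
  note int = avg_integrable[OF this w' w(2), of z]
  have "complex_of_real (integral (cbox a b) w) = integral (cbox a b) (\<lambda>x. complex_of_real (w x))"
    using integral_linear[OF integrable_continuous[OF w(1)] bounded_linear_of_real[where 'a=complex]]
    by (simp add: o_def)
  then have "avg a b (\<lambda>x. of_real (w x)) g (\<lambda>z. k) z = k" using one by (simp add: avg_const)
  then have "avg a b (\<lambda>x. of_real (w x)) g f z - k = avg a b (\<lambda>x. of_real (w x)) g (\<lambda>z. f z - k) z"
    using avg_plus[OF f smooth_const w' w(2), of "- k"] avg_cmult[of a b _ g "-1" "\<lambda>z. k"]
    by (simp add: fun_eq_iff)
  also have "cmod \<dots> \<le> integral (cbox a b) (\<lambda>x. w x * r)"
    unfolding avg_def
    by (rule integral_norm_bound_integral[OF int])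
      (use w pos near in \<open>auto intro!: integrable_continuous continuous_intros mult_left_mono simp: norm_mult\<close>)
  also have "\<dots> = r" by (simp add: one)
  finally show ?thesis .
qed

lemma line_mean_near:
  assumes "smooth f" "\<And>s. s \<in> {0..1} \<Longrightarrow> cmod (f (z + s *\<^sub>R l) - k) \<le> r"
  shows "cmod (line_mean l f z - k) \<le> r"
  using avg_near[OF assms(1), of "0::real" 1 "\<lambda>s. 1" "\<lambda>s. s *\<^sub>R l" z k r] assms(2)
  by (simp add: line_mean_def)

lemma smooth_torus_mean: "smooth f \<Longrightarrow> smooth (torus_mean ls f)"
  by (induction ls) (auto simp: line_mean_def intro!: smooth_avg)

lemma smooth_on_torus_mean: "f \<in> smooth_on \<Lambda> \<Longrightarrow> torus_mean ls f \<in> smooth_on \<Lambda>"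
  by (induction ls) (auto simp: line_mean_def intro!: smooth_on_avg)

lemma torus_mean_dir_deriv: "smooth f \<Longrightarrow> torus_mean ls (dir_deriv v f) = dir_deriv v (torus_mean ls f)"
  by (induction ls) (auto simp: line_mean_def dir_deriv_avg smooth_torus_mean)

lemma torus_mean_wirt: "smooth f \<Longrightarrow> torus_mean ls (wirt v f) = wirt v (torus_mean ls f)"
  and torus_mean_wirtbar: "smooth f \<Longrightarrow> torus_mean ls (wirtbar v f) = wirtbar v (torus_mean ls f)"
  by (induction ls) (auto simp: line_mean_def wirt_avg smooth_torus_mean)

lemma torus_mean_avg:
  "smooth f \<Longrightarrow> continuous_on (cbox a b) c \<Longrightarrow> continuous_on (cbox a b) g \<Longrightarrow>
    torus_mean ls (avg a b c g f) = avg a b c g (torus_mean ls f)"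
  by (induction ls) (auto simp: line_mean_def smooth_torus_mean intro!: avg_commute)

lemma torus_mean_plus:
  "smooth f \<Longrightarrow> smooth g \<Longrightarrow> torus_mean ls (\<lambda>z. f z + g z) = (\<lambda>z. torus_mean ls f z + torus_mean ls g z)"
  by (induction ls) (auto simp: line_mean_def smooth_torus_mean avg_plus)

lemma torus_mean_cmult: "torus_mean ls (\<lambda>z. k * f z) = (\<lambda>z. k * torus_mean ls f z)"
  by (induction ls) (auto simp: line_mean_def avg_cmult)

lemma torus_mean_diff:
  "smooth f \<Longrightarrow> smooth g \<Longrightarrow> torus_mean ls (\<lambda>z. f z - g z) = (\<lambda>z. torus_mean ls f z - torus_mean ls g z)"
  using torus_mean_plus[of f "\<lambda>z. -1 * g z" ls] by (simp add: smooth_minus torus_mean_cmult[of ls "-1", simplified])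

lemma torus_mean_near:
  assumes "smooth f" "\<And>v. v \<in> cell ls \<Longrightarrow> cmod (f (z + v) - k) \<le> r"
  shows "cmod (torus_mean ls f z - k) \<le> r"
  using assms(2)
proof (induction ls arbitrary: z)
  case (Cons l ls)
  have "cmod (torus_mean ls f (z + s *\<^sub>R l) - k) \<le> r" if "s \<in> {0..1}" for s
  proof (rule Cons.IH)
    fix v assume "v \<in> cell ls"
    then have "s *\<^sub>R l + v \<in> cell (l # ls)" using that by auto
    from Cons.prems[OF this] show "cmod (f (z + s *\<^sub>R l + v) - k) \<le> r" by (simp add: add.assoc)
  qed
  then show ?case by (simp del: atLeastAtMost_iff) (rule line_mean_near[OF smooth_torus_mean[OF assms(1)]])
qed simp

lemma torus_mean_invariant:
  assumes "smooth f" "\<And>v. v \<in> cell ls \<Longrightarrow> f (z + v) = f z"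
  shows "torus_mean ls f z = f z"
  using torus_mean_near[OF assms(1), of ls z "f z" 0] assms(2) by simp

text \<open>Averaging along \<open>l\<close> turns the derivative along \<open>l\<close> into a
  difference of values one period apart, which is 0; the other line means commute with the
  derivative.\<close>

lemma dir_deriv_torus_mean:
  assumes f: "f \<in> smooth_on \<Lambda>" and l: "l \<in> set ls" "set ls \<subseteq> \<Lambda>"
  shows "dir_deriv l (torus_mean ls f) z = 0"
  using l
proof (induction ls arbitrary: z)
  case (Cons a ls)
  have s: "torus_mean ls f \<in> smooth_on \<Lambda>" by (rule smooth_on_torus_mean[OF f])
  have *: "dir_deriv l (torus_mean (a # ls) f) z = line_mean a (dir_deriv l (torus_mean ls f)) z"
    by (simp add: line_mean_def dir_deriv_avg smooth_onD(1)[OF s])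
  show ?case
  proof (cases "l = a")
    case True
    then show ?thesis unfolding *
      using avg_line_deriv[OF smooth_onD(1)[OF s], of 1 a z] smooth_on_periodic[OF s, of a z] Cons.prems
      by (simp add: line_mean_def)
  next
    case False
    then have "dir_deriv l (torus_mean ls f) = (\<lambda>z. 0)" using Cons by (auto simp: fun_eq_iff)
    then show ?thesis unfolding * by (simp add: line_mean_def avg_const)
  qed
qed simp

lemma diff_le_dir_deriv:
  assumes "smooth f" "\<And>s. s \<in> {0..1} \<Longrightarrow> cmod (dir_deriv v f (z + s *\<^sub>R v)) \<le> B"
  shows "cmod (f (z + v) - f z) \<le> B"
proof -
  have "cmod (line_mean v (dir_deriv v f) z - 0) \<le> B"
    by (rule line_mean_near[OF smooth_dir_deriv[OF assms(1)]]) (use assms(2) in simp)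
  then show ?thesis using avg_line_deriv[OF assms(1), of 1 v z] by (simp add: line_mean_def)
qed

sublocale toroidal_frame \<subseteq> subgroup_vec \<Lambda>
  using toroidal by unfold_locales (auto simp: toroidal_def discrete_subgroup_def)

context toroidal_frame
begin

lemma scaleR_conv_smult: "r *\<^sub>R (z :: complex^2) = of_real r *s z"
  by (simp add: vec_eq_iff scaleR_conv_of_real[where 'a=complex])

lemma L_scaleR: "L (r *\<^sub>R z) = of_real r * L z"
  by (simp only: scaleR_conv_smult L_smult)

lemma bounded_linear_L: "bounded_linear L"
  by (rule linear_conv_bounded_linear[THEN iffD1])
    (auto intro!: linearI simp: L_add L_scaleR scaleR_conv_of_real[where 'a=complex])

lemma L_diff: "L (z - w) = L z - L w"
  by (simp add: linear_diff bounded_linear.linear[OF bounded_linear_L])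

lemma L_zero [simp]: "L 0 = 0"
  by (simp add: linear_0 bounded_linear.linear[OF bounded_linear_L])

lemma L_coords: "L z = z $ 1 * L (axis 1 1) + z $ 2 * L (axis 2 1)"
proof -
  have "L z = L (z $ 1 *s axis 1 1 + z $ 2 *s axis 2 1)"
    using vec_sum_axis[of z] by (simp add: sum_2)
  then show ?thesis by (simp add: L_add L_smult)
qed

lemma ker_L:
  assumes "L z = 0" shows "\<exists>w. z = w *s e"
proof -
  let ?a = "L (axis 1 1)" and ?b = "L (axis 2 1)"
  have z: "z $ 1 * ?a + z $ 2 * ?b = 0" and e: "e $ 1 * ?a + e $ 2 * ?b = 0"
    using assms L_e L_coords by metis+
  have ab: "?a \<noteq> 0 \<or> ?b \<noteq> 0" using L_coords[of u] L_u by auto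
  have en: "e $ 1 \<noteq> 0 \<or> e $ 2 \<noteq> 0" using e_neq_0 by (auto simp: vec_eq_iff forall_2)
  have det: "z $ 1 * e $ 2 = z $ 2 * e $ 1"
  proof -
    have "(z $ 1 * e $ 2 - z $ 2 * e $ 1) * ?a = 0" "(z $ 1 * e $ 2 - z $ 2 * e $ 1) * ?b = 0"
      using z e by algebra+
    with ab show ?thesis by auto
  qed
  show ?thesis
  proof (cases "e $ 1 = 0")
    case False
    then show ?thesis using det
      by (intro exI[of _ "z $ 1 / e $ 1"]) (auto simp: vec_eq_iff forall_2 field_simps)
  next
    case True
    then show ?thesis using det en
      by (intro exI[of _ "z $ 2 / e $ 2"]) (auto simp: vec_eq_iff forall_2 field_simps)
  qed
qed

text \<open>Removing the height along \<open>\<i> *s u\<close> leaves a point of the hyperplane,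
  which a cell covers modulo periods. Strips of bounded height are therefore compact modulo the
  lattice, and periodic functions are bounded on them.\<close>

lemma strip_cover:
  "\<exists>K. compact K \<and> (\<forall>z. \<bar>Im (L z)\<bar> \<le> T \<longrightarrow> (\<exists>l\<in>\<Lambda>. z - l \<in> K))"
proof -
  let ?K = "(\<lambda>(s, v). s *\<^sub>R (\<i> *s u) + v) ` ({-T..T} \<times> cell ls)"
  have "compact ?K"
    unfolding split_beta
    by (intro compact_continuous_image compact_Times compact_cell continuous_intros) auto
  moreover have "\<exists>l\<in>\<Lambda>. z - l \<in> ?K" if "\<bar>Im (L z)\<bar> \<le> T" for z
  proof -
    let ?v = "z - Im (L z) *\<^sub>R (\<i> *s u)"
    have "?v \<in> span (set ls)" by (simp add: span_ls L_diff L_scaleR L_smult L_u)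
    then obtain l where l: "l \<in> \<Lambda>" "?v - l \<in> cell ls" using cell_cover[OF ls_subset] by blast
    have "z - l = Im (L z) *\<^sub>R (\<i> *s u) + (?v - l)" by simp
    then have "z - l \<in> ?K" using l(2) that by (intro image_eqI[of _ _ "(Im (L z), ?v - l)"]) auto
    then show ?thesis using l(1) by blast
  qed
  ultimately show ?thesis by blast
qed

lemma strip_bound:
  assumes "f \<in> smooth_on \<Lambda>"
  obtains B where "B > 0" "\<And>z. \<bar>Im (L z)\<bar> \<le> T \<Longrightarrow> cmod (f z) \<le> B"
proof -
  obtain K where K: "compact K" "\<And>z. \<bar>Im (L z)\<bar> \<le> T \<Longrightarrow> \<exists>l\<in>\<Lambda>. z - l \<in> K" using strip_cover by metis
  have "compact (f ` K)" by (intro compact_continuous_image K smooth_continuous smooth_onD(1)[OF assms])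
  then obtain B where B: "B > 0" "\<And>x. x \<in> f ` K \<Longrightarrow> norm x \<le> B"
    using compact_imp_bounded bounded_pos by metis
  show ?thesis
  proof
    fix z assume "\<bar>Im (L z)\<bar> \<le> T"
    then obtain l where "l \<in> \<Lambda>" "z - l \<in> K" using K by blast
    then show "cmod (f z) \<le> B" using B(2) smooth_on_periodic[OF assms, of l "z - l"] by auto
  qed (fact B(1))
qed

abbreviation mean :: "(complex^2 \<Rightarrow> complex) \<Rightarrow> complex^2 \<Rightarrow> complex" where
  "mean \<equiv> torus_mean ls"

text \<open>The directions with vanishing derivative form a real subspace that contains
  \<open>ls\<close>, hence the whole hyperplane.\<close>

lemma dir_deriv_mean:
  assumes "f \<in> smooth_on \<Lambda>" "Im (L v) = 0" shows "dir_deriv v (mean f) z = 0"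
proof -
  have s: "smooth (mean f)" by (intro smooth_torus_mean smooth_onD(1)[OF assms(1)])
  have "subspace {v. dir_deriv v (mean f) z = 0}"
    by (auto simp: subspace_def dir_deriv_add[OF s] dir_deriv_scaleR[OF s] dir_deriv_zero[OF s])
  moreover have "set ls \<subseteq> {v. dir_deriv v (mean f) z = 0}"
    using dir_deriv_torus_mean[OF assms(1) _ ls_subset] by auto
  ultimately have "span (set ls) \<subseteq> {v. dir_deriv v (mean f) z = 0}" by (rule span_minimal[rotated])
  then show ?thesis using assms(2) span_ls by auto
qed

lemma mean_invariant:
  assumes "f \<in> smooth_on \<Lambda>" "Im (L v) = 0" shows "mean f (z + v) = mean f z"
  using dir_deriv_zero_imp_eq[of "mean f" v z 1] dir_deriv_mean[OF assms]
  by (simp add: smooth_torus_mean smooth_onD(1)[OF assms(1)])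

lemma invariant_mean:
  assumes "smooth f" "\<And>v z. Im (L v) = 0 \<Longrightarrow> f (z + v) = f z" shows "mean f = f"
  by (rule ext, rule torus_mean_invariant[OF assms(1)], rule assms(2))
    (use cell_subset_span[of ls] span_ls in auto)

lemma wirt_e_mean: "f \<in> smooth_on \<Lambda> \<Longrightarrow> wirt e (mean f) z = 0"
  and wirtbar_e_mean: "f \<in> smooth_on \<Lambda> \<Longrightarrow> wirtbar e (mean f) z = 0"
  by (simp_all add: wirt_def wirtbar_def dir_deriv_mean L_e L_smult)

text \<open>On a torus mean the derivative along \<open>u\<close> vanishes, so both Wirtinger
  derivatives are multiples of the height derivative. This is how the equations become ordinary
  ones.\<close>

lemma wirt_u_mean: "f \<in> smooth_on \<Lambda> \<Longrightarrow> wirt u (mean f) z = - (\<i> / 2) * dir_deriv (\<i> *s u) (mean f) z"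
  and wirtbar_u_mean: "f \<in> smooth_on \<Lambda> \<Longrightarrow> wirtbar u (mean f) z = \<i> / 2 * dir_deriv (\<i> *s u) (mean f) z"
  by (simp_all add: wirt_def wirtbar_def dir_deriv_mean L_u)

end

subsection \<open>Averages over discs in a complex direction\<close>

definition polar :: "complex^'n \<Rightarrow> real \<times> real \<Rightarrow> complex^'n" where
  "polar e x = (of_real (fst x) * cis (snd x)) *s e"

text \<open>Polar coordinates turn the disc into a box, as \<open>avg\<close> requires. The factor
  \<open>fst x\<close> is their Jacobian, and the weight has total mass 1.\<close>

definition disc_mean :: "complex^'n \<Rightarrow> real \<Rightarrow> (complex^'n \<Rightarrow> complex) \<Rightarrow> complex^'n \<Rightarrow> complex" where
  "disc_mean e R = avg (0, 0) (R, 2 * pi) (\<lambda>x. of_real (fst x / (pi * R\<^sup>2))) (polar e)"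

text \<open>With w the variable of the disc, the kernel with respect to area is w / (pi R^2) - 1 /
  (pi cnj w): a conjugated Cauchy kernel corrected by a linear term. It vanishes on the boundary
  circle, the Jacobian cancels its pole, and its w-derivative is the uniform density minus a point
  mass.\<close>

definition disc_pot :: "complex^'n \<Rightarrow> real \<Rightarrow> (complex^'n \<Rightarrow> complex) \<Rightarrow> complex^'n \<Rightarrow> complex" where
  "disc_pot e R = avg (0, 0) (R, 2 * pi)
     (\<lambda>x. of_real (((fst x)\<^sup>2 / R\<^sup>2 - 1) / pi) * cis (snd x)) (polar e)"

definition disc_potbar :: "complex^'n \<Rightarrow> real \<Rightarrow> (complex^'n \<Rightarrow> complex) \<Rightarrow> complex^'n \<Rightarrow> complex" where
  "disc_potbar e R = avg (0, 0) (R, 2 * pi)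
     (\<lambda>x. of_real (((fst x)\<^sup>2 / R\<^sup>2 - 1) / pi) * cis (- snd x)) (polar e)"

lemma bounded_linear_smult: "bounded_linear (\<lambda>c. c *s (e :: complex^'n))"
  by (rule linear_conv_bounded_linear[THEN iffD1])
    (auto intro!: linearI simp: vec_eq_iff algebra_simps)

lemma disc_kernels [intro, simp]:
  "continuous_on S (polar e)"
  "continuous_on S (\<lambda>x. complex_of_real (fst x / (pi * R\<^sup>2)))"
  "continuous_on S (\<lambda>x. complex_of_real (((fst x)\<^sup>2 / R\<^sup>2 - 1) / pi) * cis (snd x))"
  "continuous_on S (\<lambda>x. complex_of_real (((fst x)\<^sup>2 / R\<^sup>2 - 1) / pi) * cis (- snd x))"
  unfolding polar_def divide_inverse
  by (intro continuous_intros bounded_linear.continuous_on[OF bounded_linear_smult])+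

lemma dir_deriv_smult:
  "smooth f \<Longrightarrow> dir_deriv (c *s e) f z = c * wirt e f z + cnj c * wirtbar e f z"
  by (simp add: dir_deriv_eq_wirt wirt_smult wirtbar_smult)

lemma polar_deriv_radius:
  assumes "smooth f"
  shows "((\<lambda>r. f (z + polar e (r, t))) has_vector_derivative
    cis t * wirt e f (z + polar e (r, t)) + cis (- t) * wirtbar e f (z + polar e (r, t))) (at r within S)"
proof -
  have "polar e (r, t) = r *\<^sub>R (cis t *s e)" for r
    by (simp add: polar_def vec_eq_iff scaleR_conv_of_real[where 'a=complex])
  then show ?thesis
    using has_vector_derivative_line[OF assms, of z "cis t *s e" r S]
    by (simp add: dir_deriv_smult[OF assms] cis_cnj)
qed

lemma polar_deriv_angle:
  assumes "smooth f"
  shows "((\<lambda>t. f (z + polar e (r, t))) has_vector_derivative \<i> * of_real r *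
    (cis t * wirt e f (z + polar e (r, t)) - cis (- t) * wirtbar e f (z + polar e (r, t)))) (at t within S)"
proof -
  have "((\<lambda>t. z + polar e (r, t)) has_derivative (\<lambda>h. (h *\<^sub>R (\<i> * of_real r * cis t)) *s e)) (at t within S)"
  proof -
    have "((\<lambda>t. of_real r * cis t) has_derivative (\<lambda>h. h *\<^sub>R (\<i> * of_real r * cis t))) (at t within S)"
      by (auto intro!: derivative_eq_intros simp: fun_eq_iff scaleR_conv_of_real[where 'a=complex])
    from has_derivative_add[OF has_derivative_const[of z] bounded_linear.has_derivative[OF bounded_linear_smult this]]
    show ?thesis unfolding polar_def fst_conv snd_conv by simp
  qed
  from has_derivative_compose[OF this smooth_has_derivative[OF assms]]
  have "((\<lambda>t. f (z + polar e (r, t))) has_derivative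
      (\<lambda>h. dir_deriv ((h *\<^sub>R (\<i> * of_real r * cis t)) *s e) f (z + polar e (r, t)))) (at t within S)" .
  then show ?thesis unfolding has_vector_derivative_def
    by (rule has_derivative_eq_rhs)
      (simp add: dir_deriv_smult[OF assms] cis_cnj scaleR_conv_of_real[where 'a=complex] algebra_simps)
qed

lemma integral_box:
  fixes G :: "real \<times> real \<Rightarrow> complex"
  assumes "continuous_on (cbox (a, c) (b, d)) G"
  shows "integral (cbox (a, c) (b, d)) G = integral {a..b} (\<lambda>r. integral {c..d} (\<lambda>t. G (r, t)))"
    "integral (cbox (a, c) (b, d)) G = integral {c..d} (\<lambda>t. integral {a..b} (\<lambda>r. G (r, t)))"
  using integral_prod_continuous[OF assms] integral_swap_continuous[of a c b d "\<lambda>r t. G (r, t)"] assms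
  by simp_all

lemma continuous_on_polar: "smooth f \<Longrightarrow> continuous_on S (\<lambda>x. f (z + polar e x))"
  by (intro continuous_on_smooth[of f] continuous_intros disc_kernels)

lemma has_real_derivative_scaled_square:
  "((\<lambda>r::real. c * r\<^sup>2) has_real_derivative c * (2 * r)) (at r within S)"
  by (auto intro!: derivative_eq_intros)

text \<open>Integration by parts in polar coordinates. \<open>G1\<close> is the radial derivative of
  a F and is integrated first in the radius, where a is 1 at the centre and 0 on the circle;
  \<open>G2\<close> is a multiple of the angular derivative and is integrated first in the angle;
  \<open>G3\<close> is the disc mean.\<close>

lemma wirt_disc_pot:
  assumes f: "smooth f" and R: "R > 0"
  shows "wirt e (disc_pot e R f) z = f z - disc_mean e R f z"
proof -
  define F where "F x = f (z + polar e x)" for x :: "real \<times> real"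
  define W where "W x = wirt e f (z + polar e x)" for x :: "real \<times> real"
  define V where "V x = wirtbar e f (z + polar e x)" for x :: "real \<times> real"
  define a :: "real \<Rightarrow> real" where "a r = 1 - r\<^sup>2 / R\<^sup>2" for r
  let ?J = "cbox (0, 0) (R, 2 * pi)"
  have cont: "continuous_on S F" "continuous_on S W" "continuous_on S V" for S
    unfolding F_def W_def V_def using f smooth_wirt smooth_wirtbar continuous_on_polar by blast+
  have conta: "continuous_on S (\<lambda>x. complex_of_real (a (fst x)))" for S :: "(real \<times> real) set"
    unfolding a_def divide_inverse by (intro continuous_intros)
  define G1 where "G1 x = of_real (a (fst x)) * (cis (snd x) * W x + cis (- snd x) * V x)
    + of_real (- (2 * fst x / R\<^sup>2)) * F x" for x
  define G2 where "G2 x = of_real (a (fst x)) * (cis (snd x) * W x - cis (- snd x) * V x)" for x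
  define G3 where "G3 x = of_real (fst x / (pi * R\<^sup>2)) * F x" for x
  have c1: "continuous_on ?J G1" and c2: "continuous_on ?J G2" and c3: "continuous_on ?J G3"
    unfolding G1_def G2_def G3_def divide_inverse by (intro continuous_intros cont conta)+
  have i1: "integral ?J G1 = - (2 * pi * f z)"
  proof -
    have "integral {0..R} (\<lambda>r. G1 (r, t)) = - f z" for t
    proof -
      have da: "((\<lambda>r. complex_of_real (a r)) has_vector_derivative of_real (- (2 * r / R\<^sup>2))) (at r within S)" for r S
        using DERIV_diff[OF DERIV_const[of 1] has_real_derivative_scaled_square[of "1 / R\<^sup>2" r S]]
        unfolding a_def by (intro has_vector_derivative_of_real) simp
      have "((\<lambda>r. G1 (r, t)) has_integral of_real (a R) * F (R, t) - of_real (a 0) * F (0, t)) {0..R}"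
        unfolding G1_def fst_conv snd_conv F_def W_def V_def using R
        by (intro fundamental_theorem_of_calculus has_vector_derivative_mult da polar_deriv_radius f) auto
      moreover have "a R = 0" "a 0 = 1" "F (0, t) = f z" using R by (auto simp: a_def F_def polar_def)
      ultimately show ?thesis by (simp add: integral_unique)
    qed
    then show ?thesis by (simp add: integral_box(2)[OF c1] scaleR_conv_of_real)
  qed
  have i2: "integral ?J G2 = 0"
  proof -
    have "integral {0..2 * pi} (\<lambda>t. G2 (r, t)) = 0" if "r \<noteq> 0" for r
    proof -
      have "((\<lambda>t. \<i> * of_real r * (cis t * W (r, t) - cis (- t) * V (r, t)))
          has_integral F (r, 2 * pi) - F (r, 0)) {0..2 * pi}"
        unfolding F_def W_def V_def by (intro fundamental_theorem_of_calculus polar_deriv_angle f) auto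
      then have "((\<lambda>t. \<i> * of_real r * (cis t * W (r, t) - cis (- t) * V (r, t))) has_integral 0) {0..2 * pi}"
        by (simp add: F_def polar_def)
      from has_integral_mult_right[OF this, of "of_real (a r) / (\<i> * of_real r)"]
      have "((\<lambda>t. of_real (a r) / (\<i> * of_real r) * (\<i> * of_real r * (cis t * W (r, t) - cis (- t) * V (r, t))))
        has_integral 0) {0..2 * pi}" by simp
      moreover have "of_real (a r) / (\<i> * of_real r) * (\<i> * of_real r * (cis t * W (r, t) - cis (- t) * V (r, t))) = G2 (r, t)" for t
        using that by (simp add: G2_def)
      ultimately show ?thesis by (simp only: integral_unique)
    qed
    \<comment> \<open>The angular argument divides by the radius, so the point 0 is discarded as a
      null set.\<close>
    then have "integral {0..R} (\<lambda>r. integral {0..2 * pi} (\<lambda>t. G2 (r, t))) = integral {0..R} (\<lambda>r. 0)"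
      by (intro integral_spike[of "{0}"]) auto
    then show ?thesis by (simp add: integral_box(1)[OF c2])
  qed
  have "wirt e (disc_pot e R f) z = integral ?J (\<lambda>x. of_real (((fst x)\<^sup>2 / R\<^sup>2 - 1) / pi) * cis (snd x) * W x)"
    unfolding disc_pot_def wirt_avg(1)[OF f disc_kernels(3,1)] by (simp only: avg_def W_def)
  also have "\<dots> = integral ?J (\<lambda>x. - (1 / (2 * pi)) * (G1 x + G2 x) - G3 x)"
  proof (rule arg_cong[where f="integral ?J"], rule ext)
    fix x
    show "of_real (((fst x)\<^sup>2 / R\<^sup>2 - 1) / pi) * cis (snd x) * W x = - (1 / (2 * pi)) * (G1 x + G2 x) - G3 x"
      using R pi_gt_zero by (simp add: G1_def G2_def G3_def a_def field_simps)
  qed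
  also have "\<dots> = - (1 / (2 * pi)) * (integral ?J G1 + integral ?J G2) - integral ?J G3"
  proof -
    note int = integrable_continuous[OF c1] integrable_continuous[OF c2] integrable_continuous[OF c3]
    have "((\<lambda>x. - (1 / (2 * pi)) * (G1 x + G2 x) - G3 x) has_integral
      - (1 / (2 * pi)) * (integral ?J G1 + integral ?J G2) - integral ?J G3) ?J"
      by (intro has_integral_diff has_integral_mult_right has_integral_add integrable_integral int)
    then show ?thesis by (rule integral_unique)
  qed
  also have "\<dots> = f z - disc_mean e R f z"
  proof -
    have "integral ?J G3 = disc_mean e R f z" unfolding disc_mean_def avg_def G3_def F_def ..
    then show ?thesis using pi_gt_zero by (simp add: i1 i2)
  qed
  finally show ?thesis .
qed

text \<open>By Green's formula the derivative of a disc mean is an integral over the boundary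
  circle: its length 2 pi R, divided by twice the area pi R^2, gives the factor 1 / R. Means over
  large discs are thus almost constant along \<open>e\<close>.\<close>

lemma wirt_disc_mean_le:
  assumes f: "smooth f" and R: "R > 0" and B: "\<And>w. cmod (f (z + w *s e)) \<le> B"
  shows "cmod (wirt e (disc_mean e R f) z) \<le> B / R"
proof -
  define F where "F x = f (z + polar e x)" for x :: "real \<times> real"
  define W where "W x = wirt e f (z + polar e x)" for x :: "real \<times> real"
  define V where "V x = wirtbar e f (z + polar e x)" for x :: "real \<times> real"
  let ?J = "cbox (0, 0) (R, 2 * pi)"
  have cont: "continuous_on S F" "continuous_on S W" "continuous_on S V" for S
    unfolding F_def W_def V_def using f smooth_wirt smooth_wirtbar continuous_on_polar by blast+
  \<comment> \<open>\<open>G3\<close> is cis (-t) times the radial derivative of r F, and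
    \<open>G4\<close> is the angular derivative of -i cis (-t) F. The first leaves the boundary
    circle, the second integrates to 0 over a full turn.\<close>
  define G3 where "G3 x = cis (- snd x) * (of_real (fst x) * (cis (snd x) * W x + cis (- snd x) * V x) + 1 * F x)" for x
  define G4 where "G4 x = - \<i> * cis (- snd x) * (\<i> * of_real (fst x) * (cis (snd x) * W x - cis (- snd x) * V x))
    + (- cis (- snd x)) * F x" for x
  have c3: "continuous_on ?J G3" and c4: "continuous_on ?J G4"
    unfolding G3_def G4_def by (intro continuous_intros cont)+
  have i3: "integral {0..R} (\<lambda>r. G3 (r, t)) = cis (- t) * (R * F (R, t))" for t
  proof -
    have "((\<lambda>r. G3 (r, t)) has_integral cis (- t) * (of_real R * F (R, t) - of_real 0 * F (0, t))) {0..R}"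
      unfolding G3_def fst_conv snd_conv F_def W_def V_def of_real_1[symmetric, where ?'a=complex] using R
      by (intro has_integral_mult_right fundamental_theorem_of_calculus has_vector_derivative_mult
        has_vector_derivative_of_real polar_deriv_radius f DERIV_ident) auto
    then show ?thesis by (simp add: integral_unique)
  qed
  have i4: "integral {0..2 * pi} (\<lambda>t. G4 (r, t)) = 0" for r
  proof -
    have "((\<lambda>t. - \<i> * cis (- t)) has_vector_derivative - cis (- t)) (at t within S)" for t S
      unfolding has_vector_derivative_def
      by (auto intro!: derivative_eq_intros simp: fun_eq_iff complex_eq_iff)
    then have "((\<lambda>t. G4 (r, t)) has_integral - \<i> * cis (- (2 * pi)) * F (r, 2 * pi) - (- \<i> * cis (- 0) * F (r, 0))) {0..2 * pi}"
      unfolding G4_def fst_conv snd_conv F_def W_def V_def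
      by (intro fundamental_theorem_of_calculus has_vector_derivative_mult polar_deriv_angle f) auto
    moreover have "cis (- (2 * pi)) = 1" using cis_cnj[of "2 * pi"] by simp
    ultimately show ?thesis by (simp add: integral_unique F_def polar_def)
  qed
  have "wirt e (disc_mean e R f) z = integral ?J (\<lambda>x. of_real (fst x / (pi * R\<^sup>2)) * W x)"
    unfolding disc_mean_def wirt_avg(1)[OF f disc_kernels(2,1)] by (simp only: avg_def W_def)
  also have "\<dots> = integral ?J (\<lambda>x. (1 / (2 * pi * R\<^sup>2)) * (G3 x + G4 x))"
  proof (rule arg_cong[where f="integral ?J"], rule ext)
    fix x :: "real \<times> real"
    have c: "cis (- snd x) * cis (snd x) = 1" by (simp add: cis_mult)
    have "G3 x + G4 x = of_real (fst x) * 2 * (cis (- snd x) * cis (snd x)) * W x"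
    proof -
      have "- \<i> * c * (\<i> * r * q) = c * r * q" for c r q by (simp add: algebra_simps)
      then show ?thesis unfolding G3_def G4_def by (simp only:) (simp add: algebra_simps)
    qed
    then show "of_real (fst x / (pi * R\<^sup>2)) * W x = (1 / (2 * pi * R\<^sup>2)) * (G3 x + G4 x)"
      unfolding c by (simp add: field_simps)
  qed
  also have "\<dots> = (1 / (2 * pi * R\<^sup>2)) * (integral ?J G3 + integral ?J G4)"
    using integral_add[OF integrable_continuous[OF c3] integrable_continuous[OF c4]] by simp
  also have "integral ?J G4 = 0" by (simp add: integral_box(1)[OF c4] i4)
  also have "integral ?J G3 = integral {0..2 * pi} (\<lambda>t. cis (- t) * (R * F (R, t)))"
    by (simp add: integral_box(2)[OF c3] i3)
  finally have eq: "wirt e (disc_mean e R f) z =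
      (1 / (2 * pi * R\<^sup>2)) * (integral {0..2 * pi} (\<lambda>t. cis (- t) * (R * F (R, t))) + 0)" .
  have "cmod (integral {0..2 * pi} (\<lambda>t. cis (- t) * (R * F (R, t)))) \<le> R * B * (2 * pi - 0)"
  proof (rule integral_bound)
    show "continuous_on {0..2 * pi} (\<lambda>t. cis (- t) * (R * F (R, t)))"
      unfolding F_def by (intro continuous_intros continuous_on_smooth[OF f]
        continuous_on_compose2[OF disc_kernels(1)[of UNIV]]) auto
    show "cmod (cis (- t) * (R * F (R, t))) \<le> R * B" for t
      using B R by (simp add: norm_mult F_def polar_def)
  qed simp
  then show ?thesis unfolding eq using R by (simp add: norm_mult norm_divide field_simps power2_eq_square)
qed

lemma avg_cnj: "avg a b c g (\<lambda>z. cnj (f z)) = (\<lambda>z. cnj (avg a b (\<lambda>x. cnj (c x)) g f z))"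
  by (simp add: avg_def integral_cnj)

lemma disc_mean_cnj: "disc_mean e R (\<lambda>z. cnj (f z)) = (\<lambda>z. cnj (disc_mean e R f z))"
  by (simp add: disc_mean_def avg_cnj)

lemma disc_pot_cnj: "disc_pot e R (\<lambda>z. cnj (f z)) = (\<lambda>z. cnj (disc_potbar e R f z))"
  by (simp add: disc_pot_def disc_potbar_def avg_cnj cis_cnj)

lemma smooth_disc: "smooth f \<Longrightarrow> smooth (disc_mean e R f)" "smooth f \<Longrightarrow> smooth (disc_pot e R f)"
  "smooth f \<Longrightarrow> smooth (disc_potbar e R f)"
  unfolding disc_mean_def disc_pot_def disc_potbar_def by (intro smooth_avg disc_kernels; assumption)+

lemma smooth_on_disc: "f \<in> smooth_on \<Lambda> \<Longrightarrow> disc_mean e R f \<in> smooth_on \<Lambda>"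
  "f \<in> smooth_on \<Lambda> \<Longrightarrow> disc_pot e R f \<in> smooth_on \<Lambda>"
  "f \<in> smooth_on \<Lambda> \<Longrightarrow> disc_potbar e R f \<in> smooth_on \<Lambda>"
  unfolding disc_mean_def disc_pot_def disc_potbar_def by (intro smooth_on_avg disc_kernels; assumption)+

lemma wirtbar_disc_potbar:
  assumes f: "smooth f" and R: "R > 0"
  shows "wirtbar e (disc_potbar e R f) z = f z - disc_mean e R f z"
proof -
  have "wirt e (disc_pot e R (\<lambda>z. cnj (f z))) z = cnj (f z) - cnj (disc_mean e R f z)"
    using wirt_disc_pot[OF smooth_cnj[OF f] R] by (simp add: disc_mean_cnj)
  then have "cnj (wirtbar e (disc_potbar e R f) z) = cnj (f z - disc_mean e R f z)"
    by (simp add: disc_pot_cnj wirt_cnj smooth_disc f)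
  then show ?thesis by (simp only: complex_cnj_cancel_iff)
qed

lemma wirtbar_disc_mean_le:
  assumes f: "smooth f" and R: "R > 0" and B: "\<And>w. cmod (f (z + w *s e)) \<le> B"
  shows "cmod (wirtbar e (disc_mean e R f) z) \<le> B / R"
  using wirt_disc_mean_le[OF smooth_cnj[OF f] R, of z e B] B
  by (simp add: disc_mean_cnj wirt_cnj smooth_disc f)

lemma disc_mean_near:
  assumes f: "smooth f" and R: "R > 0" and near: "\<And>w. cmod (f (z + w *s e) - k) \<le> r"
  shows "cmod (disc_mean e R f z - k) \<le> r"
  unfolding disc_mean_def
proof (rule avg_near[OF f])
  show c: "continuous_on (cbox (0, 0) (R, 2 * pi)) (\<lambda>x. fst x / (pi * R\<^sup>2))"
    unfolding divide_inverse by (intro continuous_intros)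
  show "0 \<le> fst x / (pi * R\<^sup>2)" if "x \<in> cbox (0, 0) (R, 2 * pi)" for x
    using that by (auto simp: cbox_Pair_eq)
  have "integral (cbox (0, 0) (R, 2 * pi)) (\<lambda>x. fst x / (pi * R\<^sup>2)) =
      integral {0..R} (\<lambda>r. integral {0..2 * pi} (\<lambda>t. r / (pi * R\<^sup>2)))"
    using integral_prod_continuous[OF c] by simp
  also have "\<dots> = integral {0..R} (\<lambda>r. 2 * r / R\<^sup>2)"
    by (intro arg_cong[where f="integral {0..R}"]) (simp add: fun_eq_iff)
  also have "\<dots> = (1 / R\<^sup>2) * R\<^sup>2 - (1 / R\<^sup>2) * 0\<^sup>2"
    using R by (intro integral_unique fundamental_theorem_of_calculus)
      (use has_real_derivative_scaled_square[of "1 / R\<^sup>2"] in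
        \<open>auto simp flip: has_real_derivative_iff_has_vector_derivative\<close>)
  also have "\<dots> = 1" using R by simp
  finally show "integral (cbox (0, 0) (R, 2 * pi)) (\<lambda>x. fst x / (pi * R\<^sup>2)) = 1" .
  show "cmod (f (z + polar e x) - k) \<le> r" for x using near by (simp add: polar_def)
qed (rule disc_kernels)

context toroidal_frame
begin

lemma disc_mean_mean:
  assumes f: "f \<in> smooth_on \<Lambda>" and R: "R > 0"
  shows "disc_mean e R (mean f) = mean f"
proof
  fix z
  have "cmod (disc_mean e R (mean f) z - mean f z) \<le> 0"
    by (intro disc_mean_near smooth_torus_mean smooth_onD(1)[OF f] R)
      (simp add: mean_invariant[OF f] L_smult L_e)
  then show "disc_mean e R (mean f) z = mean f z" by simp
qed

lemma L_translate: "L (z + w *s e) = L z"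
  by (simp add: L_add L_smult L_e)

text \<open>Modulo periods each vector of the cell is a bounded multiple of \<open>e\<close> plus a
  short multiple of \<open>u\<close>. A large disc mean varies little along the first by the 1 / R
  estimate, and along the second by the bound on \<open>dir_deriv u f\<close>. So it is close to its
  own torus mean, which is that of \<open>f\<close> because the two averages commute.\<close>

theorem disc_mean_tendsto:
  assumes f: "f \<in> smooth_on \<Lambda>" and r: "r > 0"
  shows "\<exists>R0>0. \<forall>R\<ge>R0. \<forall>z. \<bar>Im (L z)\<bar> \<le> T \<longrightarrow> cmod (disc_mean e R f z - mean f z) \<le> r"
proof -
  obtain B where B: "B > 0" "\<And>z. \<bar>Im (L z)\<bar> \<le> T \<Longrightarrow> cmod (f z) \<le> B"
    using strip_bound[OF f] by metis
  obtain C where C: "C > 0" "\<And>z. \<bar>Im (L z)\<bar> \<le> T \<Longrightarrow> cmod (dir_deriv u f z) \<le> C"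
    using strip_bound[OF smooth_on_dir_deriv[OF f]] by metis
  \<comment> \<open>The variation along \<open>u\<close> may then use up
    \<open>r / 2\<close>.\<close>
  define d where "d = r / (2 * C)"
  have d: "d > 0" using r C by (simp add: d_def)
  have sf: "smooth f" by (rule smooth_onD(1)[OF f])
  have "\<exists>W>0. \<forall>v\<in>cell ls. \<exists>l\<in>\<Lambda>. \<exists>w. \<exists>x. v - l = w *s e + x *\<^sub>R u \<and> \<bar>x\<bar> \<le> d \<and> cmod w \<le> W"
  proof -
    obtain M where M: "M > 0" "\<And>v. v \<in> cell ls \<Longrightarrow> norm v \<le> M"
      using compact_imp_bounded[OF compact_cell] bounded_pos by metis
    \<comment> \<open>Lattice vectors whose \<open>L\<close>-values follow a grid of step
      \<open>d / 2\<close>: finitely many of them serve the whole compact cell, which makes the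
      bound \<open>W\<close> uniform.\<close>
    have "\<forall>j::int. \<exists>l\<in>\<Lambda>. \<bar>Re (L l) - j * (d / 2)\<bar> < d / 2" by (intro allI dense) (use d in simp)
    then obtain l where l: "\<And>j::int. l j \<in> \<Lambda>" "\<And>j::int. \<bar>Re (L (l j)) - j * (d / 2)\<bar> < d / 2" by metis
    obtain K where K: "K > 0" "\<And>z. norm (L z) \<le> norm z * K"
      using bounded_linear.pos_bounded[OF bounded_linear_L] by blast
    define J where "J = \<lceil>M * K / (d / 2)\<rceil> + 1"
    have "finite (l ` {-J..J})" by simp
    then obtain N where N: "\<And>j. j \<in> {-J..J} \<Longrightarrow> norm (l j) \<le> N"
      using finite_imp_bounded[of "l ` {-J..J}"] unfolding bounded_iff by (metis imageI)
    define W where "W = \<bar>M + N + d * norm u\<bar> / norm e + 1"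
    have "\<exists>l\<in>\<Lambda>. \<exists>w. \<exists>x. v - l = w *s e + x *\<^sub>R u \<and> \<bar>x\<bar> \<le> d \<and> cmod w \<le> W" if v: "v \<in> cell ls" for v
    proof -
      define y where "y = Re (L v)"
      define j where "j = \<lfloor>y / (d / 2)\<rfloor>"
      have Lv: "L v = of_real y"
        using v cell_subset_span[of ls] span_ls by (auto simp: y_def complex_eq_iff)
      have ly: "\<bar>y\<bar> \<le> M * K"
        using order_trans[OF K(2)[of v] mult_right_mono[OF M(2)[OF v]]] K(1) by (simp add: Lv)
      have "\<bar>y / (d / 2)\<bar> \<le> M * K / (d / 2)" using ly d by (simp add: abs_divide divide_right_mono)
      then have "j \<le> J" "- J \<le> j" unfolding j_def J_def by linarith+
      then have j: "j \<in> {-J..J}" by simp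
      have "of_int j * (d / 2) \<le> y" "y < (of_int j + 1) * (d / 2)"
        unfolding j_def using floor_divide_lower[of "d / 2" y] floor_divide_upper[of "d / 2" y] d by auto
      then have "\<bar>y - Re (L (l j))\<bar> \<le> d" using l(2)[of j] unfolding distrib_right by linarith
      moreover define x where "x = y - Re (L (l j))"
      ultimately have x: "\<bar>x\<bar> \<le> d" by simp
      have "L (v - l j - x *\<^sub>R u) = 0"
        using L_real[OF l(1)] by (simp add: L_diff L_scaleR L_u Lv x_def complex_eq_iff)
      then obtain w where w: "v - l j - x *\<^sub>R u = w *s e" using ker_L by blast
      have "norm (w *s e) = cmod w * norm e"
        by (simp add: norm_vec_def L2_set_def norm_mult power_mult_distrib sum_distrib_left[symmetric] real_sqrt_mult)
      moreover have "norm (v - l j - x *\<^sub>R u) \<le> M + N + d * norm u"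
      proof -
        have "norm (v - l j - x *\<^sub>R u) \<le> norm v + norm (l j) + norm (x *\<^sub>R u)"
          using norm_triangle_ineq4[of "v - l j" "x *\<^sub>R u"] norm_triangle_ineq4[of v "l j"] by linarith
        moreover have "norm (x *\<^sub>R u) \<le> d * norm u" using x by (simp add: mult_right_mono)
        ultimately show ?thesis using M(2)[OF v] N[OF j] by linarith
      qed
      ultimately have "cmod w * norm e \<le> \<bar>M + N + d * norm u\<bar>" using w by simp
      then have "cmod w \<le> W" using e_neq_0 unfolding W_def by (simp add: pos_le_divide_eq add_increasing2)
      moreover have "v - l j = w *s e + x *\<^sub>R u" using w by (simp add: algebra_simps)
      ultimately show ?thesis using l(1) x by blast
    qed
    moreover have "W > 0" by (simp add: W_def add_nonneg_pos)
    ultimately show ?thesis by blast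
  qed
  then obtain W where W: "W > 0"
    "\<And>v. v \<in> cell ls \<Longrightarrow> \<exists>l\<in>\<Lambda>. \<exists>w. \<exists>x. v - l = w *s e + x *\<^sub>R u \<and> \<bar>x\<bar> \<le> d \<and> cmod w \<le> W" by blast
  \<comment> \<open>From this radius on the variation \<open>2 * W * B / R\<close> along
    \<open>e\<close> is at most \<open>r / 2\<close>.\<close>
  define R0 where "R0 = 4 * W * B / r"
  have R0: "R0 > 0" using W B r by (simp add: R0_def)
  have "cmod (disc_mean e R f z - mean f z) \<le> r" if R: "R \<ge> R0" and z: "\<bar>Im (L z)\<bar> \<le> T" for R z
  proof -
    have R': "R > 0" using R R0 by simp
    define g where "g = disc_mean e R f"
    have g: "g \<in> smooth_on \<Lambda>" "smooth g" unfolding g_def using f sf by (auto intro: smooth_on_disc smooth_disc)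
    have near: "cmod (g (z + v) - g z) \<le> r" if v: "v \<in> cell ls" for v
    proof -
      obtain l w x where lw: "l \<in> \<Lambda>" "v - l = w *s e + x *\<^sub>R u" "\<bar>x\<bar> \<le> d" "cmod w \<le> W"
        using W(2)[OF v] by blast
      have "g (z + v) = g (z + v - l + l)" by simp
      also have "\<dots> = g (z + v - l)" by (rule smooth_on_periodic[OF g(1) lw(1)])
      also have "z + v - l = z + w *s e + x *\<^sub>R u" using lw(2) by (simp add: algebra_simps)
      finally have eq: "g (z + v) = g (z + w *s e + x *\<^sub>R u)" .
      have 1: "cmod (g (z + w *s e) - g z) \<le> 2 * W * B / R"
      proof (rule diff_le_dir_deriv[OF g(2)])
        fix s :: real
        let ?p = "z + s *\<^sub>R (w *s e)"
        have b: "cmod (f (?p + w' *s e)) \<le> B" for w'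
          using z by (intro B(2)) (simp add: L_add L_scaleR L_smult L_e)
        have "cmod (dir_deriv (w *s e) g ?p) \<le> cmod w * cmod (wirt e g ?p) + cmod w * cmod (wirtbar e g ?p)"
          unfolding dir_deriv_smult[OF g(2)] by (rule order_trans[OF norm_triangle_ineq]) (simp add: norm_mult)
        also have "\<dots> \<le> W * (B / R) + W * (B / R)"
          unfolding g_def using lw(4) W(1) B(1) R'
          by (intro add_mono mult_mono wirt_disc_mean_le[OF sf R' b] wirtbar_disc_mean_le[OF sf R' b]) auto
        finally show "cmod (dir_deriv (w *s e) g ?p) \<le> 2 * W * B / R" by (simp add: mult.commute mult.left_commute)
      qed
      have 2: "cmod (g (z + w *s e + x *\<^sub>R u) - g (z + w *s e)) \<le> d * C"
      proof (rule diff_le_dir_deriv[OF g(2)])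
        fix s :: real
        let ?p = "z + w *s e + s *\<^sub>R (x *\<^sub>R u)"
        have "dir_deriv (x *\<^sub>R u) g ?p = x *\<^sub>R disc_mean e R (dir_deriv u f) ?p"
          unfolding dir_deriv_scaleR[OF g(2)] unfolding g_def disc_mean_def dir_deriv_avg[OF sf disc_kernels(2,1)] ..
        moreover have "cmod (disc_mean e R (dir_deriv u f) ?p - 0) \<le> C"
          using z by (intro disc_mean_near smooth_dir_deriv sf R')
            (auto intro!: C(2) simp: L_add L_scaleR L_smult L_e L_u)
        ultimately show "cmod (dir_deriv (x *\<^sub>R u) g ?p) \<le> d * C"
          using lw(3) C(1) d by (auto intro!: mult_mono)
      qed
      have "2 * W * B / R \<le> r / 2"
        using R R0 r R' unfolding R0_def by (simp add: field_simps)
      moreover have "d * C = r / 2" using C(1) by (simp add: d_def)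
      ultimately show ?thesis
        using 1 2 norm_triangle_ineq[of "g (z + w *s e + x *\<^sub>R u) - g (z + w *s e)" "g (z + w *s e) - g z"]
        by (simp add: eq)
    qed
    have "cmod (mean g z - g z) \<le> r" by (rule torus_mean_near[OF g(2) near])
    moreover have "mean g = mean f"
    proof -
      have "mean g = disc_mean e R (mean f)"
        unfolding g_def disc_mean_def by (rule torus_mean_avg[OF sf disc_kernels(2,1)])
      then show ?thesis using disc_mean_mean[OF f R'] by simp
    qed
    ultimately show ?thesis by (simp add: g_def norm_minus_commute)
  qed
  then show ?thesis using R0 by blast
qed

end

subsection \<open>Pointwise convergence of Fourier series\<close>

definition fcoeff :: "(real \<Rightarrow> complex) \<Rightarrow> int \<Rightarrow> complex" where
  "fcoeff h k = integral {0..1} (\<lambda>s. cis (- (2 * pi * of_int k * s)) * h s)"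

lemma has_vector_derivative_cis_linear:
  "((\<lambda>s. cis (a * s)) has_vector_derivative \<i> * of_real a * cis (a * s)) (at s within S)"
  unfolding has_vector_derivative_def
  by (auto intro!: derivative_eq_intros simp: fun_eq_iff complex_eq_iff)

lemma fcoeff_integrable:
  "continuous_on {0..1} h \<Longrightarrow> (\<lambda>s. cis (- (2 * pi * of_int k * s)) * h s) integrable_on {0..1}"
  by (intro integrable_continuous_interval continuous_intros)

text \<open>For a polynomial one integration by parts bounds the coefficient by a constant over the
  frequency; uniform approximation carries the decay over to continuous functions.\<close>

lemma riemann_lebesgue:
  assumes g: "continuous_on {0..1} g" and r: "r > 0"
  shows "\<exists>N::int. \<forall>k. \<bar>k\<bar> \<ge> N \<longrightarrow> cmod (fcoeff g k) \<le> r"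
proof -
  obtain p where p: "polynomial_function p" "\<And>x. x \<in> {0..1} \<Longrightarrow> cmod (g x - p x) < r / 2"
    using Stone_Weierstrass_polynomial_function[OF compact_Icc g, of "r / 2"] r by auto
  obtain p' where p': "polynomial_function p'" "\<And>x. (p has_vector_derivative p' x) (at x)"
    using has_vector_derivative_polynomial_function[OF p(1)] by blast
  have cp: "continuous_on S p" "continuous_on S p'" for S
    using p(1) p'(1) by (auto intro: continuous_on_polymonial_function)
  have "compact (p' ` {0..1})" by (intro compact_continuous_image cp compact_Icc)
  then obtain M where M: "M > 0" "\<And>x. x \<in> {0..1} \<Longrightarrow> cmod (p' x) \<le> M"
    using compact_imp_bounded bounded_pos by (metis imageI)
  define C where "C = cmod (p 1) + cmod (p 0) + M"
  have C: "C > 0" using M by (simp add: C_def add_nonneg_pos)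
  obtain N :: nat where N: "real N > C / r" using reals_Archimedean2 by blast
  then have N1: "N > 0" using C r by (metis divide_pos_pos gr0I less_asym' of_nat_0)
  have "cmod (fcoeff g k) \<le> r" if k: "\<bar>k\<bar> \<ge> int N" for k
  proof -
    define a where "a = - (2 * pi * of_int k)"
    have ka: "\<bar>a\<bar> \<ge> 2 * N" 
    proof -
      have "real_of_int \<bar>k\<bar> \<ge> real N" using k by linarith
      moreover have "\<bar>a\<bar> = 2 * pi * real_of_int \<bar>k\<bar>" by (simp add: a_def abs_mult)
      moreover have "2 * pi * real_of_int \<bar>k\<bar> \<ge> 2 * 1 * real_of_int \<bar>k\<bar>"
        using pi_ge_two by (intro mult_right_mono) auto
      ultimately show ?thesis by simp
    qed
    then have a0: "a \<noteq> 0" using N1 by auto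
    have "((\<lambda>s. cis (a * s) * p' s + \<i> * of_real a * cis (a * s) * p s) has_integral
        cis (a * 1) * p 1 - cis (a * 0) * p 0) {0..1}"
      by (intro fundamental_theorem_of_calculus has_vector_derivative_mult has_vector_derivative_cis_linear
        has_vector_derivative_at_within[OF p'(2)]) auto
    moreover have i1: "(\<lambda>s. cis (a * s) * p' s) integrable_on {0..1}" "(\<lambda>s. cis (a * s) * p s) integrable_on {0..1}"
      by (intro integrable_continuous_interval continuous_intros cp)+
    then have "((\<lambda>s. cis (a * s) * p' s + \<i> * of_real a * (cis (a * s) * p s)) has_integral
        integral {0..1} (\<lambda>s. cis (a * s) * p' s) + \<i> * of_real a * integral {0..1} (\<lambda>s. cis (a * s) * p s)) {0..1}"
      by (intro has_integral_add has_integral_mult_right integrable_integral)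
    ultimately have "integral {0..1} (\<lambda>s. cis (a * s) * p' s) + \<i> * of_real a * integral {0..1} (\<lambda>s. cis (a * s) * p s)
        = cis a * p 1 - p 0"
      by (simp add: has_integral_unique mult.assoc)
    then have eq: "\<i> * of_real a * integral {0..1} (\<lambda>s. cis (a * s) * p s) =
        cis a * p 1 - p 0 - integral {0..1} (\<lambda>s. cis (a * s) * p' s)"
      by (simp add: algebra_simps)
    have "cmod (integral {0..1} (\<lambda>s. cis (a * s) * p' s)) \<le> M * (1 - 0)"
      by (rule integral_bound) (auto intro!: continuous_intros cp M simp: norm_mult)
    then have "cmod (\<i> * of_real a * integral {0..1} (\<lambda>s. cis (a * s) * p s)) \<le> C"
      unfolding eq C_def using norm_triangle_ineq4[of "cis a * p 1 - p 0" "integral {0..1} (\<lambda>s. cis (a * s) * p' s)"]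
        norm_triangle_ineq4[of "cis a * p 1" "p 0"] by (simp add: norm_mult)
    then have "\<bar>a\<bar> * cmod (integral {0..1} (\<lambda>s. cis (a * s) * p s)) \<le> C" by (simp add: norm_mult)
    then have "cmod (integral {0..1} (\<lambda>s. cis (a * s) * p s)) \<le> C / \<bar>a\<bar>" using a0 by (simp add: field_simps)
    also have "\<dots> \<le> C / (2 * N)" using ka N1 C by (intro divide_left_mono) auto
    also have "\<dots> \<le> r / 2" using N N1 r by (simp add: field_simps)
    finally have b1: "cmod (integral {0..1} (\<lambda>s. cis (a * s) * p s)) \<le> r / 2" .
    have "cmod (integral {0..1} (\<lambda>s. cis (a * s) * (g s - p s))) \<le> (r / 2) * (1 - 0)"
      by (rule integral_bound) (use less_imp_le[OF p(2)] in \<open>auto intro!: continuous_intros cp g simp: norm_mult\<close>)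
    moreover have "fcoeff g k = integral {0..1} (\<lambda>s. cis (a * s) * (g s - p s)) + integral {0..1} (\<lambda>s. cis (a * s) * p s)"
    proof -
      have "(\<lambda>s. cis (a * s) * (g s - p s)) integrable_on {0..1}"
        by (intro integrable_continuous_interval continuous_intros cp g)
      from integral_add[OF this i1(2)] show ?thesis
        unfolding fcoeff_def a_def by (simp add: algebra_simps)
    qed
    ultimately show ?thesis using b1 norm_triangle_ineq[of "integral {0..1} (\<lambda>s. cis (a * s) * (g s - p s))" "integral {0..1} (\<lambda>s. cis (a * s) * p s)"]
      by simp
  qed
  then show ?thesis by blast
qed

lemma vector_derivative_quotient:
  fixes f :: "real \<Rightarrow> complex"
  assumes "(f has_vector_derivative D) (at a within S)"
  shows "((\<lambda>x. (f x - f a) / of_real (x - a)) \<longlongrightarrow> D) (at a within S)"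
proof -
  have "((\<lambda>x. norm ((f x - f a) - (x - a) *\<^sub>R D) / norm (x - a)) \<longlongrightarrow> 0) (at a within S)"
    using assms unfolding has_vector_derivative_def has_derivative_iff_norm by blast
  moreover have "norm ((f x - f a) - (x - a) *\<^sub>R D) / norm (x - a) = norm ((f x - f a) / of_real (x - a) - D)"
    if "x \<noteq> a" for x
  proof -
    have "(f x - f a) / of_real (x - a) - D = ((f x - f a) - (x - a) *\<^sub>R D) / of_real (x - a)"
      using that by (simp add: scaleR_conv_of_real field_simps del: of_real_diff)
    then show ?thesis by (simp add: norm_divide del: of_real_diff)
  qed
  ultimately have "((\<lambda>x. norm ((f x - f a) / of_real (x - a) - D)) \<longlongrightarrow> 0) (at a within S)"
    by (auto elim!: Lim_transform_eventually simp: eventually_at_filter)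
  then show ?thesis by (simp only: tendsto_norm_zero_iff LIM_zero_iff)
qed

lemma cis_eq_1: "cis (2 * pi * x) = 1 \<Longrightarrow> x \<in> \<int>"
proof -
  assume "cis (2 * pi * x) = 1"
  then obtain n :: int where "2 * pi * x = of_int (2 * n) * pi"
    unfolding cis_conv_exp exp_eq_1 by auto
  then have "x = of_int n" by simp
  then show "x \<in> \<int>" by simp
qed

text \<open>Division by \<open>cis (2 * pi * x) - 1\<close> is what will make the partial Fourier
  sums telescope. On the unit interval the divisor vanishes only at 0 and 1, to first order, where
  the derivative of \<open>h\<close> supplies the value of the quotient.\<close>

lemma ex_continuous_quotient:
  assumes h: "\<And>x. (h has_vector_derivative h' x) (at x)" and per: "h 1 = h 0"
  shows "\<exists>g. continuous_on {0..1} g \<and> (\<forall>x\<in>{0..1}. h x - h 0 = (cis (2 * pi * x) - 1) * g x)"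
proof -
  define E where "E x = cis (2 * pi * x) - 1" for x
  define g where "g x = (if x \<in> {0, 1} then h' x / (2 * pi * \<i>) else (h x - h 0) / E x)" for x :: real
  have E: "E x \<noteq> 0" if "x \<in> {0<..<1}" for x
    using cis_eq_1[of x] that by (auto simp: E_def Ints_def)
  have dE: "(E has_vector_derivative 2 * pi * \<i> * cis (2 * pi * x)) (at x within S)" for x S
    using has_vector_derivative_diff[OF has_vector_derivative_cis_linear[of "2 * pi" x S] has_vector_derivative_const[of 1]]
    by (simp add: E_def[abs_def] mult_ac)
  have "(g \<longlongrightarrow> g a) (at a within {0..1})" if a: "a \<in> {0..1}" for a
  proof (cases "a \<in> {0, 1}")
    case True
    have "((\<lambda>x. ((h x - h a) / of_real (x - a)) / ((E x - E a) / of_real (x - a))) \<longlongrightarrow>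
        h' a / (2 * pi * \<i> * cis (2 * pi * a))) (at a within {0..1})"
      by (intro tendsto_divide vector_derivative_quotient dE has_vector_derivative_at_within[OF h]) simp
    moreover have "h' a / (2 * pi * \<i> * cis (2 * pi * a)) = g a" "h a = h 0" "E a = 0"
      using True per by (auto simp: g_def E_def)
    ultimately have "((\<lambda>x. ((h x - h 0) / of_real (x - a)) / (E x / of_real (x - a))) \<longlongrightarrow> g a) (at a within {0..1})"
      by simp
    then show ?thesis
    proof (rule Lim_transform_within[where d=1])
      fix x assume x: "x \<in> {0..1}" "0 < dist x a" "dist x a < 1"
      then have "x \<notin> {0, 1}" "x - a \<noteq> 0" using True by (auto simp: dist_real_def)
      then show "((h x - h 0) / of_real (x - a)) / (E x / of_real (x - a)) = g x"
        by (simp add: g_def del: of_real_diff)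
    qed simp
  next
    case False
    have "isCont (\<lambda>x. (h x - h 0) / E x) a"
      using E[of a] a False has_vector_derivative_continuous[OF h] has_vector_derivative_continuous[OF dE]
      by (intro continuous_intros) auto
    then have "((\<lambda>x. (h x - h 0) / E x) \<longlongrightarrow> g a) (at a)"
      using False by (simp add: isCont_def g_def)
    then have "(g \<longlongrightarrow> g a) (at a)"
      by (rule Lim_transform_within_open[of _ _ _ _ "{0<..<1}"]) (use a False in \<open>auto simp: g_def\<close>)
    then show ?thesis by (rule tendsto_within_subset) simp
  qed
  then have "continuous_on {0..1} g" by (simp add: continuous_on_def)
  moreover have "h x - h 0 = E x * g x" if "x \<in> {0..1}" for x
    using that E[of x] per by (auto simp: g_def E_def)
  ultimately show ?thesis unfolding E_def by blast
qed

lemma fcoeff_const: "fcoeff (\<lambda>s. c) k = (if k = 0 then c else 0)"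
proof (cases "k = 0")
  case False
  define a where "a = - (2 * pi * of_int k)"
  have "((\<lambda>s. \<i> * of_real a * cis (a * s)) has_integral cis (a * 1) - cis (a * 0)) {0..1}"
    by (intro fundamental_theorem_of_calculus has_vector_derivative_cis_linear) simp
  moreover have "cis (a * 1) = 1"
    using cis_multiple_2pi[of "- of_int k"] by (simp add: a_def mult_ac)
  ultimately have "((\<lambda>s. \<i> * of_real a * cis (a * s)) has_integral 0) {0..1}" by simp
  from has_integral_mult_right[OF this, of "c / (\<i> * of_real a)"]
  have "((\<lambda>s. cis (a * s) * c) has_integral 0) {0..1}" using False by (simp add: a_def mult.commute)
  from integral_unique[OF this] show ?thesis
    using False unfolding fcoeff_def a_def by (simp only: mult_minus_left if_False)
qed (simp add: fcoeff_def)

text \<open>Multiplication by \<open>cis (2 * pi * x)\<close> shifts the index of the coefficients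
  by one, so a difference of neighbouring coefficients appears.\<close>

lemma fcoeff_quotient:
  assumes g: "continuous_on {0..1} g" and h: "\<And>x. x \<in> {0..1} \<Longrightarrow> h x = c + (cis (2 * pi * x) - 1) * g x"
  shows "fcoeff h k = fcoeff g (k - 1) - fcoeff g k + (if k = 0 then c else 0)"
proof -
  have "fcoeff h k = integral {0..1} (\<lambda>s. cis (- (2 * pi * of_int (k - 1) * s)) * g s -
      cis (- (2 * pi * of_int k * s)) * g s + cis (- (2 * pi * of_int k * s)) * c)"
    unfolding fcoeff_def
  proof (rule integral_cong)
    fix x :: real assume x: "x \<in> {0..1}"
    have "cis (- (2 * pi * of_int (k - 1) * x)) = cis (- (2 * pi * of_int k * x)) * cis (2 * pi * x)"
      unfolding cis_mult by (simp add: algebra_simps)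
    then show "cis (- (2 * pi * of_int k * x)) * h x = cis (- (2 * pi * of_int (k - 1) * x)) * g x -
        cis (- (2 * pi * of_int k * x)) * g x + cis (- (2 * pi * of_int k * x)) * c"
      unfolding h[OF x] by (simp add: algebra_simps)
  qed
  also have "\<dots> = fcoeff g (k - 1) - fcoeff g k + fcoeff (\<lambda>s. c) k"
    unfolding fcoeff_def
    by (rule integral_unique) (intro has_integral_add has_integral_diff integrable_integral fcoeff_integrable g continuous_on_const)
  finally show ?thesis by (simp only: fcoeff_const)
qed

text \<open>The symmetric partial sums collapse to \<open>h 0\<close> and two coefficients of the
  continuous quotient, which tend to 0 by the Riemann-Lebesgue lemma. The value at 0 is enough,
  since the theorem is applied to \<open>\<lambda>s. f (z + s *\<^sub>R u)\<close> for every
  \<open>z\<close>.\<close>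

theorem fourier_series_sums:
  assumes h: "\<And>x. (h has_vector_derivative h' x) (at x)" and per: "h 1 = h 0"
  shows "(\<lambda>n::nat. if n = 0 then fcoeff h 0 else fcoeff h (int n) + fcoeff h (- int n)) sums h 0"
proof -
  obtain g where g: "continuous_on {0..1} g" "\<And>x. x \<in> {0..1} \<Longrightarrow> h x - h 0 = (cis (2 * pi * x) - 1) * g x"
    using ex_continuous_quotient[OF h per] by blast
  have q: "fcoeff h k = fcoeff g (k - 1) - fcoeff g k + (if k = 0 then h 0 else 0)" for k
    by (rule fcoeff_quotient[OF g(1)]) (use g(2) in \<open>simp add: algebra_simps\<close>)
  have part: "(\<Sum>n\<le>N. if n = 0 then fcoeff h 0 else fcoeff h (int n) + fcoeff h (- int n)) =
      fcoeff g (- 1 - int N) - fcoeff g (int N) + h 0" for N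
    by (induction N) (simp_all add: q algebra_simps)
  have z: "(\<lambda>n. fcoeff g (s n)) \<longlonglongrightarrow> 0" if s: "\<And>n. \<bar>s n\<bar> \<ge> int n" for s
  proof (rule LIMSEQ_I)
    fix r :: real assume "r > 0"
    then obtain N :: int where N: "\<And>k. \<bar>k\<bar> \<ge> N \<Longrightarrow> cmod (fcoeff g k) \<le> r / 2"
      using riemann_lebesgue[OF g(1), of "r / 2"] by auto
    have "norm (fcoeff g (s n) - 0) < r" if "n \<ge> nat N" for n
      using N[of "s n"] s[of n] that \<open>r > 0\<close> by (simp add: nat_le_iff)
    then show "\<exists>no. \<forall>n\<ge>no. norm (fcoeff g (s n) - 0) < r" by blast
  qed
  have "(\<lambda>N. fcoeff g (- 1 - int N) - fcoeff g (int N) + h 0) \<longlonglongrightarrow> 0 - 0 + h 0"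
    by (intro tendsto_add tendsto_diff tendsto_const z) auto
  then show ?thesis unfolding sums_def_le part by simp
qed

subsection \<open>Smooth sums of series\<close>

text \<open>Termwise differentiation when the majorants hold only on balls and only from some index
  on. Majorants for single directions suffice, because a linear map is controlled by its values on a
  basis.\<close>

lemma smooth_series_derivative:
  fixes w :: "nat \<Rightarrow> complex^'n \<Rightarrow> complex"
  assumes D: "\<And>n z. (w n has_derivative D n z) (at z)"
    and M: "\<And>r. \<exists>M. summable M \<and> (\<forall>\<^sub>F n in sequentially. \<forall>z\<in>ball 0 r. cmod (w n z) \<le> M n)"
    and MD: "\<And>r v. \<exists>M. summable M \<and> (\<forall>\<^sub>F n in sequentially. \<forall>z\<in>ball 0 r. cmod (D n z v) \<le> M n)"
  shows "((\<lambda>z. \<Sum>n. w n z) has_derivative (\<lambda>v. \<Sum>n. D n z v)) (at z)" and "summable (\<lambda>n. w n z)"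
proof -
  have sumD: "summable (\<lambda>n. D n z v)" for z v
  proof -
    obtain M where "summable M" "\<forall>\<^sub>F n in sequentially. \<forall>x\<in>ball 0 (norm z + 1). cmod (D n x v) \<le> M n"
      using MD by blast
    then show ?thesis
      by (auto intro!: summable_comparison_test_ev[of "\<lambda>n. D n z v" M] elim!: eventually_mono)
  qed
  show sumw: "summable (\<lambda>n. w n z)" for z
  proof -
    obtain M where "summable M" "\<forall>\<^sub>F n in sequentially. \<forall>x\<in>ball 0 (norm z + 1). cmod (w n x) \<le> M n"
      using M by blast
    then show ?thesis
      by (auto intro!: summable_comparison_test_ev[of "\<lambda>n. w n z" M] elim!: eventually_mono)
  qed
  have lin: "D n x h = (\<Sum>b\<in>Basis. (h \<bullet> b) *\<^sub>R D n x b)" for n x h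
  proof -
    interpret linear "D n x" using has_derivative_linear[OF D] .
    have "D n x h = D n x (\<Sum>b\<in>Basis. (h \<bullet> b) *\<^sub>R b)" by (simp add: euclidean_representation)
    then show ?thesis by (simp add: sum scale)
  qed
  let ?S = "ball (0 :: complex^'n) (norm z + 1)"
  have "\<exists>g. \<forall>x\<in>?S. (\<lambda>n. w n x) sums (g x) \<and> (g has_derivative (\<lambda>v. \<Sum>n. D n x v)) (at x within ?S)"
  proof (rule has_derivative_series)
    show "convex ?S" "z \<in> ?S" by simp_all
    show "(w n has_derivative D n x) (at x within ?S)" for n x by (rule has_derivative_at_withinI[OF D])
    show "(\<lambda>n. w n z) sums (\<Sum>n. w n z)" using sumw by (rule summable_sums)
    fix r :: real assume r: "r > 0"
    \<comment> \<open>The basis directions share the permitted error \<open>r\<close>.\<close>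
    define r' where "r' = r / DIM(complex^'n)"
    have r': "r' > 0" using r DIM_positive[where 'a="complex^'n"] by (simp add: r'_def)
    have "\<forall>\<^sub>F n in sequentially. \<forall>x\<in>?S. cmod ((\<Sum>i<n. D i x b) - (\<Sum>i. D i x b)) < r'" for b
    proof -
      obtain M where M: "summable M" "\<forall>\<^sub>F n in sequentially. \<forall>x\<in>?S. cmod (D n x b) \<le> M n"
        using MD by blast
      from uniform_limitD[OF Weierstrass_m_test_ev[OF M(2,1)] r'] show ?thesis by (simp add: dist_norm)
    qed
    then have "\<forall>\<^sub>F n in sequentially. \<forall>b\<in>Basis. \<forall>x\<in>?S. cmod ((\<Sum>i<n. D i x b) - (\<Sum>i. D i x b)) < r'"
      by (intro eventually_ball_finite) auto
    then show "\<forall>\<^sub>F n in sequentially. \<forall>x\<in>?S. \<forall>h. norm ((\<Sum>i<n. D i x h) - (\<Sum>i. D i x h)) \<le> r * norm h"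
    proof (rule eventually_mono, intro ballI allI)
      fix n x h assume *: "\<forall>b\<in>Basis. \<forall>x\<in>?S. cmod ((\<Sum>i<n. D i x b) - (\<Sum>i. D i x b)) < r'" and x: "x \<in> ?S"
      have "(\<Sum>i<n. D i x h) = (\<Sum>b\<in>Basis. (h \<bullet> b) *\<^sub>R (\<Sum>i<n. D i x b))"
        by (subst lin) (simp add: scaleR_sum_right sum.swap[of _ Basis])
      moreover have "(\<Sum>i. D i x h) = (\<Sum>b\<in>Basis. (h \<bullet> b) *\<^sub>R (\<Sum>i. D i x b))"
        by (subst lin, subst suminf_sum) (auto intro!: sum.cong summable_scaleR_right sumD suminf_scaleR_right[symmetric])
      ultimately have "norm ((\<Sum>i<n. D i x h) - (\<Sum>i. D i x h)) =
          norm (\<Sum>b\<in>Basis. (h \<bullet> b) *\<^sub>R ((\<Sum>i<n. D i x b) - (\<Sum>i. D i x b)))"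
        by (simp add: scaleR_diff_right sum_subtractf)
      also have "\<dots> \<le> (\<Sum>b\<in>(Basis :: (complex^'n) set). norm h * r')"
      proof (rule sum_norm_le)
        fix b :: "complex^'n" assume b: "b \<in> Basis"
        show "norm ((h \<bullet> b) *\<^sub>R ((\<Sum>i<n. D i x b) - (\<Sum>i. D i x b))) \<le> norm h * r'"
          using * b x Basis_le_norm[OF b, of h] unfolding norm_scaleR
          by (intro mult_mono) (auto intro: less_imp_le)
      qed
      also have "\<dots> = r * norm h" by (simp add: r'_def)
      finally show "norm ((\<Sum>i<n. D i x h) - (\<Sum>i. D i x h)) \<le> r * norm h" .
    qed
  qed
  then obtain g where g: "\<And>x. x \<in> ?S \<Longrightarrow> (\<lambda>n. w n x) sums (g x)"
    "\<And>x. x \<in> ?S \<Longrightarrow> (g has_derivative (\<lambda>v. \<Sum>n. D n x v)) (at x within ?S)" by blast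
  have "((\<lambda>z. \<Sum>n. w n z) has_derivative (\<lambda>v. \<Sum>n. D n z v)) (at z within ?S)"
    by (rule has_derivative_transform[OF _ _ g(2)]) (use sums_unique[OF g(1)] in auto)
  then show "((\<lambda>z. \<Sum>n. w n z) has_derivative (\<lambda>v. \<Sum>n. D n z v)) (at z)"
    by (simp add: at_within_open[of z ?S])
qed

text \<open>\<open>P\<close> is a class of sequences closed under termwise differentiation and
  locally summable. The sums of its members then form a class to which coinduction applies.\<close>

lemma smooth_series:
  fixes w :: "nat \<Rightarrow> complex^'n \<Rightarrow> complex"
  assumes P: "P w"
    and D: "\<And>w. P w \<Longrightarrow> \<exists>D. (\<forall>n z. (w n has_derivative D n z) (at z)) \<and> (\<forall>v. P (\<lambda>n z. D n z v))"
    and M: "\<And>w r. P w \<Longrightarrow> \<exists>M. summable M \<and> (\<forall>\<^sub>F n in sequentially. \<forall>z\<in>ball 0 r. cmod (w n z) \<le> M n)"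
  shows "smooth (\<lambda>z. \<Sum>n. w n z)" and "dir_deriv v (\<lambda>z. \<Sum>n. w n z) z = (\<Sum>n. dir_deriv v (w n) z)"
    and "summable (\<lambda>n. dir_deriv v (w n) z)"
proof -
  have D': "((\<lambda>z. \<Sum>n. w n z) has_derivative (\<lambda>v. \<Sum>n. dir_deriv v (w n) z)) (at z)"
    "P (\<lambda>n z. dir_deriv v (w n) z)" if Pw: "P w" for w z v
  proof -
    obtain D where D: "\<And>n z. (w n has_derivative D n z) (at z)" "\<And>v. P (\<lambda>n z. D n z v)"
      using D[OF Pw] by blast
    have eq: "D n z = (\<lambda>v. dir_deriv v (w n) z)" for n z
      using dir_deriv_eqI[OF D(1)] by (simp add: fun_eq_iff)
    show "((\<lambda>z. \<Sum>n. w n z) has_derivative (\<lambda>v. \<Sum>n. dir_deriv v (w n) z)) (at z)"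
      using smooth_series_derivative(1)[OF D(1) M[OF Pw] M[OF D(2)], of z] by (simp only: eq)
    show "P (\<lambda>n z. dir_deriv v (w n) z)" using D(2)[of v] by (simp only: eq)
  qed
  show "smooth (\<lambda>z. \<Sum>n. w n z)"
  proof (rule smooth_coinduct[where P="\<lambda>f. \<exists>w. P w \<and> f = (\<lambda>z. \<Sum>n. w n z)"])
    fix f assume "\<exists>w. P w \<and> f = (\<lambda>z. \<Sum>n. w n z)"
    then obtain w where w: "P w" "f = (\<lambda>z. \<Sum>n. w n z)" by blast
    show "\<exists>D. (\<forall>z. (f has_derivative D z) (at z)) \<and>
        (\<forall>v. \<exists>w. P w \<and> (\<lambda>z. D z v) = (\<lambda>z. \<Sum>n. w n z))"
      unfolding w(2)
      by (intro exI[of _ "\<lambda>z v. \<Sum>n. dir_deriv v (w n) z"] conjI allI D'(1)[OF w(1)])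
        (auto intro!: exI[of _ "\<lambda>n. dir_deriv _ (w n)"] D'(2)[OF w(1)])
  qed (use P in blast)
  show "dir_deriv v (\<lambda>z. \<Sum>n. w n z) z = (\<Sum>n. dir_deriv v (w n) z)"
    by (rule dir_deriv_eqI[OF D'(1)[OF P]])
  have Pd: "P (\<lambda>n z. dir_deriv v (w n) z)" by (rule D'(2)[OF P])
  obtain D2 where D2: "\<And>n z. (dir_deriv v (w n) has_derivative D2 n z) (at z)" "\<And>v. P (\<lambda>n z. D2 n z v)"
    using D[OF Pd] by auto
  show "summable (\<lambda>n. dir_deriv v (w n) z)"
    by (rule smooth_series_derivative(2)[OF D2(1) M[OF Pd] M[OF D2(2)]])
qed

text \<open>A diagonal choice: \<open>T n\<close> is the largest \<open>N\<close> up to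
  \<open>n\<close> such that \<open>B j N\<close> is at most \<open>n\<close> for all
  \<open>j\<close> up to \<open>N\<close>. Each fixed \<open>N\<close> is admissible for large
  \<open>n\<close>, so \<open>T\<close> tends to infinity, and each \<open>j\<close> is eventually
  among the controlled indices.\<close>

lemma slow_growth:
  fixes B :: "nat \<Rightarrow> nat \<Rightarrow> real"
  shows "\<exists>T :: nat \<Rightarrow> nat. filterlim T at_top sequentially \<and> (\<forall>n. T n \<le> n) \<and>
    (\<forall>j. \<forall>\<^sub>F n in sequentially. B j (T n) \<le> real n)"
proof -
  define S where "S n = {N. N \<le> n \<and> (\<forall>j\<le>N. B j N \<le> real n)}" for n
  \<comment> \<open>The inserted 0 is the default when no \<open>N\<close> is admissible.\<close>
  define T where "T n = Max (insert 0 (S n))" for n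
  have fin: "finite (S n)" for n by (rule finite_subset[of _ "{..n}"]) (auto simp: S_def)
  have T_in: "T n \<in> insert 0 (S n)" for n unfolding T_def using fin by (intro Max_in) auto
  have T_le: "T n \<le> n" for n using T_in[of n] by (auto simp: S_def)
  have T_ge: "\<forall>\<^sub>F n in sequentially. N \<le> T n" for N
  proof -
    have "\<forall>\<^sub>F n in sequentially. \<forall>j\<in>{..N}. B j N \<le> real n"
      by (intro eventually_ball_finite ballI)
        (auto intro: filterlim_at_top[THEN iffD1, OF filterlim_real_sequentially, rule_format])
    moreover have "\<forall>\<^sub>F n in sequentially. N \<le> n" by (rule eventually_ge_at_top)
    ultimately show ?thesis
    proof eventually_elim
      case (elim n)
      then have "N \<in> S n" by (auto simp: S_def)
      then show "N \<le> T n" unfolding T_def using fin by (intro Max_ge) auto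
    qed
  qed
  have "\<forall>\<^sub>F n in sequentially. B j (T n) \<le> real n" for j
    using T_ge[of "Suc j"]
  proof eventually_elim
    case (elim n)
    then have "T n \<in> S n" using T_in[of n] by auto
    then show ?case using elim by (auto simp: S_def)
  qed
  then show ?thesis using T_ge T_le unfolding filterlim_at_top by blast
qed

context toroidal_frame
begin

subsection \<open>An inhomogeneous equation on a Fourier mode\<close>

text \<open>Variation of constants for w' + \<kappa> w = -2 i h in the height t, with w = 0 at
  height \<open>b\<close>: the integral of exp (-\<kappa> (t - s)) h(s) from \<open>b\<close> to t,
  rescaled by s = t - y (t - b). The fixed interval for y permits differentiation in
  \<open>z\<close> under the integral.\<close>

definition solv :: "real \<Rightarrow> real \<Rightarrow> (complex^2 \<Rightarrow> complex) \<Rightarrow> complex^2 \<Rightarrow> complex" where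
  "solv \<kappa> b h z = - (2 * \<i>) * integral {0..1} (\<lambda>y.
     of_real ((Im (L z) - b) * exp (- (\<kappa> * y * (Im (L z) - b)))) *
     h (z - (y * (Im (L z) - b)) *\<^sub>R (\<i> *s u)))"

lemma L_iu: "L (\<i> *s u) = \<i>"
  by (simp add: L_smult L_u)

lemma bounded_linear_ImL: "bounded_linear (\<lambda>z. Im (L z))"
  by (rule bounded_linear_compose[OF bounded_linear_Im bounded_linear_L])

lemma solv_integrable:
  assumes "smooth h"
  shows "(\<lambda>y. of_real ((Im (L z) - b) * exp (- (\<kappa> * y * (Im (L z) - b)))) *
     h (z - (y * (Im (L z) - b)) *\<^sub>R (\<i> *s u))) integrable_on {0..1}"
  by (intro integrable_continuous_interval continuous_intros continuous_on_smooth[OF assms])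

lemma solv_plus:
  assumes "smooth h" "smooth k"
  shows "solv \<kappa> b (\<lambda>z. h z + k z) z = solv \<kappa> b h z + solv \<kappa> b k z"
  using integral_add[OF solv_integrable[OF assms(1)] solv_integrable[OF assms(2)], of z b \<kappa> z b \<kappa>]
  by (simp add: solv_def algebra_simps)

lemma solv_cmult: "solv \<kappa> b (\<lambda>z. c * h z) z = c * solv \<kappa> b h z"
  by (simp add: solv_def mult.left_commute[of _ c])

text \<open>Directions of height 0 pass under the integral, and the height direction contributes the
  differential equation itself. A derivative is thus again made of \<open>solv\<close> terms and a
  multiple of \<open>h\<close>, which keeps the terms of the later series in one class.\<close>

lemma solv_has_derivative:
  assumes h: "smooth h"
  shows "(solv \<kappa> b h has_derivative (\<lambda>v. solv \<kappa> b (dir_deriv (v - Im (L v) *\<^sub>R (\<i> *s u)) h) z +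
    of_real (Im (L v)) * (- of_real \<kappa> * solv \<kappa> b h z - 2 * \<i> * h z))) (at z)"
proof -
  define nu where "nu = \<i> *s u"
  define tau where "tau z = Im (L z) - b" for z
  define p where "p z y = z - (y * tau z) *\<^sub>R nu" for z and y :: real
  define q where "q z y = tau z * exp (- (\<kappa> * y * tau z))" for z and y :: real
  define K where "K z y = of_real (q z y) * h (p z y)" for z y
  define KD where "KD z y v = of_real (q z y) * dir_deriv (v - (y * Im (L v)) *\<^sub>R nu) h (p z y) +
    of_real (Im (L v) * exp (- (\<kappa> * y * tau z)) + tau z * (exp (- (\<kappa> * y * tau z)) * (- (\<kappa> * y * Im (L v))))) * h (p z y)" for z y v
  have dt: "(tau has_derivative (\<lambda>v. Im (L v))) (at z)" for z
    unfolding tau_def using has_derivative_diff[OF bounded_linear_imp_has_derivative[OF bounded_linear_ImL] has_derivative_const[of b]]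
    by simp
  have dp: "((\<lambda>z. p z y) has_derivative (\<lambda>v. v - (y * Im (L v)) *\<^sub>R nu)) (at z)" for y z
    unfolding p_def by (intro has_derivative_diff has_derivative_ident has_derivative_scaleR_left has_derivative_mult_right dt)
  have dq: "((\<lambda>z. q z y) has_derivative (\<lambda>v. Im (L v) * exp (- (\<kappa> * y * tau z)) + tau z * (exp (- (\<kappa> * y * tau z)) * (- (\<kappa> * y * Im (L v)))))) (at z)" for y z
    unfolding q_def by (auto intro!: derivative_eq_intros dt simp: fun_eq_iff)
  have dK: "((\<lambda>z. K z y) has_derivative KD z y) (at z)" for y z
  proof -
    have "((\<lambda>z. h (p z y)) has_derivative (\<lambda>v. dir_deriv (v - (y * Im (L v)) *\<^sub>R nu) h (p z y))) (at z)"
      by (rule has_derivative_compose[OF dp smooth_has_derivative[OF h]])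
    from has_derivative_mult[OF has_derivative_of_real[OF dq] this]
    show ?thesis unfolding K_def KD_def[abs_def] .
  qed
  have ct: "continuous_on S (\<lambda>x. tau (fst x))" for S :: "((complex^2) \<times> real) set"
    unfolding tau_def by (intro continuous_intros bounded_linear.continuous_on[OF bounded_linear_ImL])
  have cq: "continuous_on S (\<lambda>x. q (fst x) (snd x))" and cp: "continuous_on S (\<lambda>x. p (fst x) (snd x))"
    for S :: "((complex^2) \<times> real) set"
    unfolding q_def p_def by (intro continuous_intros ct)+
  have dirlin: "dir_deriv (v - (y * t) *\<^sub>R nu) h x = dir_deriv v h x - of_real (y * t) * dir_deriv nu h x" for v y t x
    by (simp only: dir_deriv_minus_vec[OF h] dir_deriv_scaleR[OF h] scaleR_conv_of_real[where 'a=complex])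
  have cKD: "continuous_on S (\<lambda>x. KD (fst x) (snd x) v)" for S v
    unfolding KD_def dirlin
    by (intro continuous_intros ct cq continuous_on_smooth[OF h] continuous_on_smooth[OF smooth_dir_deriv[OF h]] cp)
  have lin: "bounded_linear (KD z y)" for z y by (rule has_derivative_bounded_linear[OF dK])
  have cy: "continuous_on S (\<lambda>y. (z, y))" for S and z :: "complex^2" by (intro continuous_intros)
  have cK1: "continuous_on S (K z)" for S z
    unfolding K_def[abs_def] using continuous_on_compose2[OF cq[of UNIV] cy[of S z] subset_UNIV] continuous_on_compose2[OF cp[of UNIV] cy[of S z] subset_UNIV]
    by (intro continuous_intros continuous_on_smooth[OF h]) auto
  have cKD1: "continuous_on S (\<lambda>y. KD z y v)" for S z v
    using continuous_on_compose2[OF cKD[of UNIV v] cy[of S z] subset_UNIV] by simp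
  have "((\<lambda>z. integral (cbox 0 1) (K z)) has_derivative
      blinfun_apply (integral (cbox 0 1) (\<lambda>y. Blinfun (KD z y)))) (at z within UNIV)"
  proof (rule leibniz_rule)
    show "((\<lambda>z. K z y) has_derivative blinfun_apply (Blinfun (KD z y))) (at z within UNIV)" for z y
      using dK by (simp add: bounded_linear_Blinfun_apply[OF lin])
    show "K z integrable_on cbox 0 1" for z by (intro integrable_continuous cK1)
    show "continuous_on (UNIV \<times> cbox 0 1) (\<lambda>(z, y). Blinfun (KD z y))"
      by (intro continuous_on_blinfun_componentwise)
        (simp add: split_beta bounded_linear_Blinfun_apply[OF lin] cKD)
  qed auto
  moreover have "blinfun_apply (integral (cbox 0 1) (\<lambda>y. Blinfun (KD z y))) = (\<lambda>v. integral {0..1} (\<lambda>y. KD z y v))"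
  proof
    fix v
    have "continuous_on (cbox 0 1) (\<lambda>y. Blinfun (KD z y))"
      by (intro continuous_on_blinfun_componentwise) (simp add: bounded_linear_Blinfun_apply[OF lin] cKD1)
    then show "blinfun_apply (integral (cbox 0 1) (\<lambda>y. Blinfun (KD z y))) v = integral {0..1} (\<lambda>y. KD z y v)"
      using integrable_continuous[of 0 1 "\<lambda>y. Blinfun (KD z y)"]
      by (subst blinfun_apply_integral) (auto simp: bounded_linear_Blinfun_apply[OF lin])
  qed
  ultimately have dI: "((\<lambda>z. - (2 * \<i>) * integral {0..1} (K z)) has_derivative (\<lambda>v. - (2 * \<i>) * integral {0..1} (\<lambda>y. KD z y v))) (at z)"
    by (intro has_derivative_mult_right) simp
  have eqK: "solv \<kappa> b h z = - (2 * \<i>) * integral {0..1} (K z)" for z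
    unfolding solv_def K_def[abs_def] q_def p_def tau_def nu_def ..
  have st: "- (2 * \<i>) * integral {0..1} (\<lambda>y. KD z y v) =
    solv \<kappa> b (dir_deriv (v - Im (L v) *\<^sub>R nu) h) z + of_real (Im (L v)) * (- of_real \<kappa> * solv \<kappa> b h z - 2 * \<i> * h z)" for v
  proof -
    define t where "t = Im (L v)"
    define E where "E y = of_real (exp (- (\<kappa> * y * tau z))) * h (p z y)" for y
    define E' where "E' y = of_real (exp (- (\<kappa> * y * tau z)) * (- (\<kappa> * tau z))) * h (p z y)
      + of_real (exp (- (\<kappa> * y * tau z))) * dir_deriv (- tau z *\<^sub>R nu) h (p z y)" for y
    define K1 where "K1 y = of_real (q z y) * dir_deriv (v - t *\<^sub>R nu) h (p z y)" for y
    have dE: "(E has_vector_derivative E' y) (at y within S)" for y S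
    proof -
      have "((\<lambda>y. p z y) has_derivative (\<lambda>k. k *\<^sub>R (- tau z *\<^sub>R nu))) (at y within S)"
        unfolding p_def by (auto intro!: derivative_eq_intros simp: fun_eq_iff)
      from has_derivative_compose[OF this smooth_has_derivative[OF h]]
      have "((\<lambda>y. h (p z y)) has_vector_derivative dir_deriv (- tau z *\<^sub>R nu) h (p z y)) (at y within S)"
        unfolding has_vector_derivative_def by (simp only: dir_deriv_scaleR[OF h])
      moreover have "((\<lambda>y. complex_of_real (exp (- (\<kappa> * y * tau z)))) has_vector_derivative
          of_real (exp (- (\<kappa> * y * tau z)) * (- (\<kappa> * tau z)))) (at y within S)"
        by (intro has_vector_derivative_of_real) (auto intro!: derivative_eq_intros)
      ultimately show ?thesis
        unfolding E_def[abs_def] E'_def by (subst add.commute) (rule has_vector_derivative_mult)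
    qed
    \<comment> \<open>The integrand is the derivative of (y - 1) E(y), which vanishes at 1 and
      equals \<open>- h z\<close> at 0.\<close>
    have "((\<lambda>y. of_real (y - 1) * E' y + 1 * E y) has_integral of_real (1 - 1) * E 1 - of_real (0 - 1) * E 0) {0..1}"
      unfolding of_real_1[symmetric, where ?'a=complex]
      by (intro fundamental_theorem_of_calculus has_vector_derivative_mult has_vector_derivative_of_real dE)
        (auto intro!: derivative_eq_intros)
    moreover have "E 0 = h z" by (simp add: E_def p_def)
    ultimately have 1: "((\<lambda>y. of_real (y - 1) * E' y + E y) has_integral h z) {0..1}" by simp
    have 2: "(K z has_integral integral {0..1} (K z)) {0..1}"
      using cK1 by (intro integrable_integral integrable_continuous_interval)
    have 3: "(K1 has_integral integral {0..1} K1) {0..1}"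
      unfolding K1_def[abs_def] using continuous_on_compose2[OF cq[of UNIV] cy[of "{0..1}" z] subset_UNIV] continuous_on_compose2[OF cp[of UNIV] cy[of "{0..1}" z] subset_UNIV]
      by (intro integrable_integral integrable_continuous_interval continuous_intros continuous_on_smooth[OF smooth_dir_deriv[OF h]]) auto
    have "KD z y v = K1 y + of_real t * ((of_real (y - 1) * E' y + E y) - of_real \<kappa> * K z y)" for y
    proof -
      have d1: "dir_deriv (- tau z *\<^sub>R nu) h x = - of_real (tau z) * dir_deriv nu h x" for x
        by (simp only: dir_deriv_scaleR[OF h] scaleR_conv_of_real[where 'a=complex] of_real_minus)
      have d2: "dir_deriv (v - t *\<^sub>R nu) h x = dir_deriv v h x - of_real t * dir_deriv nu h x" for x
        using dirlin[of v 1 t x] by simp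
      show ?thesis
        unfolding KD_def K1_def E_def E'_def K_def q_def t_def[symmetric] dirlin d1 d2
        by (simp add: algebra_simps)
    qed
    then have "((\<lambda>y. KD z y v) has_integral integral {0..1} K1 + of_real t * (h z - of_real \<kappa> * integral {0..1} (K z))) {0..1}"
      by (simp only:) (intro has_integral_add has_integral_mult_right has_integral_diff 1 2 3)
    then have i: "integral {0..1} (\<lambda>y. KD z y v) = integral {0..1} K1 + of_real t * (h z - of_real \<kappa> * integral {0..1} (K z))"
      by (rule integral_unique)
    have s: "solv \<kappa> b (dir_deriv (v - t *\<^sub>R nu) h) z = - (2 * \<i>) * integral {0..1} K1"
      unfolding solv_def K1_def[abs_def] q_def p_def tau_def nu_def ..
    show ?thesis unfolding eqK t_def[symmetric] i s by (simp add: algebra_simps)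
  qed
  have "solv \<kappa> b h = (\<lambda>z. - (2 * \<i>) * integral {0..1} (K z))" using eqK by (rule ext)
  from dI[folded this] show ?thesis unfolding st unfolding nu_def .
qed

text \<open>The base point lies on the side from which the exponential decays, so that factor is at
  most 1 for every size of \<open>\<kappa>\<close>. The path has length at most \<open>2 * T\<close>
  and stays in the strip; the prefactor gives another 2.\<close>

lemma solv_bound:
  assumes h: "smooth h" and z: "\<bar>Im (L z)\<bar> \<le> T" and b: "b = - T \<and> \<kappa> \<ge> 0 \<or> b = T \<and> \<kappa> \<le> 0"
    and B: "\<And>z. \<bar>Im (L z)\<bar> \<le> T \<Longrightarrow> cmod (h z) \<le> B"
  shows "cmod (solv \<kappa> b h z) \<le> 4 * T * B"
proof -
  define t where "t = Im (L z) - b"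
  have t: "\<bar>t\<bar> \<le> 2 * T" "\<kappa> * t \<ge> 0" using z b unfolding t_def by (auto simp: mult_nonneg_nonneg mult_nonpos_nonpos)
  have B0: "B \<ge> 0" using order_trans[OF norm_ge_zero B[OF z]] .
  have i: "cmod (integral {0..1} (\<lambda>y. of_real (t * exp (- (\<kappa> * y * t))) * h (z - (y * t) *\<^sub>R (\<i> *s u)))) \<le> (2 * T * B) * (1 - 0)"
  proof (rule integral_bound)
    show "continuous_on {0..1} (\<lambda>y. of_real (t * exp (- (\<kappa> * y * t))) * h (z - (y * t) *\<^sub>R (\<i> *s u)))"
      by (intro continuous_intros continuous_on_smooth[OF h])
    fix y :: real assume y: "y \<in> {0..1}"
    have "exp (- (\<kappa> * y * t)) \<le> 1" using mult_nonneg_nonneg[OF t(2), of y] y by (simp add: mult_ac)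
    then have 1: "\<bar>t * exp (- (\<kappa> * y * t))\<bar> \<le> 2 * T"
      using t(1) mult_mono[of "\<bar>t\<bar>" "2 * T" "exp (- (\<kappa> * y * t))" 1] by (simp add: abs_mult)
    have "\<bar>Im (L z) - y * t\<bar> \<le> T"
    proof -
      have "Im (L z) - y * t = (1 - y) * Im (L z) + y * b" by (simp add: t_def algebra_simps)
      moreover have "\<bar>(1 - y) * Im (L z)\<bar> \<le> (1 - y) * T" "\<bar>y * b\<bar> \<le> y * T"
        using y z b unfolding abs_mult by (auto intro!: mult_mono)
      ultimately show ?thesis by (simp add: algebra_simps)
    qed
    then have 2: "cmod (h (z - (y * t) *\<^sub>R (\<i> *s u))) \<le> B" by (intro B) (simp add: L_diff L_scaleR L_iu)
    show "cmod (of_real (t * exp (- (\<kappa> * y * t))) * h (z - (y * t) *\<^sub>R (\<i> *s u))) \<le> 2 * T * B"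
      unfolding norm_mult norm_of_real using 1 2 B0 z by (intro mult_mono) auto
  qed simp
  have c: "cmod (solv \<kappa> b h z) = cmod (- (2 * \<i>)) *
      cmod (integral {0..1} (\<lambda>y. of_real (t * exp (- (\<kappa> * y * t))) * h (z - (y * t) *\<^sub>R (\<i> *s u))))"
    unfolding solv_def t_def by (simp only: norm_mult)
  have "cmod (- (2 * \<i>)) = 2" by (simp add: norm_mult)
  then have "cmod (solv \<kappa> b h z) \<le> 2 * (2 * T * B * (1 - 0))"
    unfolding c by (simp only:) (rule mult_left_mono[OF i], simp)
  then show ?thesis by simp
qed

end

lemma iter_deriv_plus:
  "smooth f \<Longrightarrow> smooth g \<Longrightarrow> iter_deriv vs (\<lambda>z. f z + g z) = (\<lambda>z. iter_deriv vs f z + iter_deriv vs g z)"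
  by (induction vs) (simp_all add: dir_deriv_smooth_plus smooth_iter_deriv)

lemma iter_deriv_cmult: "smooth f \<Longrightarrow> iter_deriv vs (\<lambda>z. c * f z) = (\<lambda>z. c * iter_deriv vs f z)"
  by (induction vs) (simp_all add: dir_deriv_smooth_cmult smooth_iter_deriv)

context toroidal_frame
begin

subsection \<open>Surjectivity of the Cauchy-Riemann operator transversal to the complex line\<close>

text \<open>Fourier components along the circle of \<open>u\<close> alone. They are still functions
  of \<open>z\<close> on the quotient, and eigenfunctions of \<open>dir_deriv u\<close>.\<close>

definition fmode :: "int \<Rightarrow> (complex^2 \<Rightarrow> complex) \<Rightarrow> complex^2 \<Rightarrow> complex" where
  "fmode k = avg (0::real) 1 (\<lambda>s. cis (- (2 * pi * of_int k * s))) (\<lambda>s. s *\<^sub>R u)"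

lemma fmode_kernel: "continuous_on S (\<lambda>s. cis (- (2 * pi * of_int k * s)))" "continuous_on S (\<lambda>s::real. s *\<^sub>R u)"
  by (intro continuous_intros)+

lemma fmode_fcoeff: "fmode k f z = fcoeff (\<lambda>s. f (z + s *\<^sub>R u)) k"
  by (simp add: fmode_def avg_def fcoeff_def)

lemma fmode_sums:
  assumes "f \<in> smooth_on \<Lambda>"
  shows "(\<lambda>n::nat. if n = 0 then fmode 0 f z else fmode (int n) f z + fmode (- int n) f z) sums f z"
  using fourier_series_sums[of "\<lambda>s. f (z + s *\<^sub>R u)" "\<lambda>s. dir_deriv u f (z + s *\<^sub>R u)"]
    has_vector_derivative_line[OF smooth_onD(1)[OF assms], of z u _ UNIV] smooth_on_periodic[OF assms u_in, of z]
  unfolding fmode_fcoeff by simp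

lemma fmode_smooth_on: "f \<in> smooth_on \<Lambda> \<Longrightarrow> fmode k f \<in> smooth_on \<Lambda>"
  unfolding fmode_def by (intro smooth_on_avg fmode_kernel)

lemma fmode_dir_deriv:
  assumes "f \<in> smooth_on \<Lambda>"
  shows "fmode k (dir_deriv u f) z = 2 * pi * \<i> * of_int k * fmode k f z"
proof -
  define a where "a = - (2 * pi * of_int k)"
  note sf = smooth_onD(1)[OF assms]
  have k: "- (2 * pi * of_int k * s) = a * s" for s by (simp add: a_def)
  have int: "(\<lambda>s. cis (a * s) * g (z + s *\<^sub>R u)) integrable_on {0..1}" if "smooth g" for g
    by (intro integrable_continuous_interval continuous_intros continuous_on_smooth[OF that])
  have "((\<lambda>s. cis (a * s) * dir_deriv u f (z + s *\<^sub>R u) + \<i> * of_real a * cis (a * s) * f (z + s *\<^sub>R u)) has_integral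
      cis (a * 1) * f (z + 1 *\<^sub>R u) - cis (a * 0) * f (z + 0 *\<^sub>R u)) {0..1}"
    by (intro fundamental_theorem_of_calculus has_vector_derivative_mult has_vector_derivative_cis_linear
      has_vector_derivative_line sf) simp
  moreover have "cis (a * 1) = 1"
    using cis_multiple_2pi[of "- of_int k"] by (simp add: a_def mult_ac)
  ultimately have "((\<lambda>s. cis (a * s) * dir_deriv u f (z + s *\<^sub>R u) + \<i> * of_real a * (cis (a * s) * f (z + s *\<^sub>R u))) has_integral 0) {0..1}"
    by (simp add: smooth_on_periodic[OF assms u_in] mult.assoc)
  moreover have "((\<lambda>s. cis (a * s) * dir_deriv u f (z + s *\<^sub>R u) + \<i> * of_real a * (cis (a * s) * f (z + s *\<^sub>R u))) has_integral
      fmode k (dir_deriv u f) z + \<i> * of_real a * fmode k f z) {0..1}"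
    unfolding fmode_fcoeff fcoeff_def k
    by (intro has_integral_add has_integral_mult_right integrable_integral int sf smooth_dir_deriv)
  ultimately have "fmode k (dir_deriv u f) z + \<i> * of_real a * fmode k f z = 0" by (rule has_integral_unique[rotated])
  then show ?thesis by (simp add: a_def algebra_simps)
qed

lemma dir_deriv_fmode:
  assumes "f \<in> smooth_on \<Lambda>"
  shows "dir_deriv u (fmode k f) z = 2 * pi * \<i> * of_int k * fmode k f z"
  using fmode_dir_deriv[OF assms]
  unfolding fmode_def dir_deriv_avg[OF smooth_onD(1)[OF assms] fmode_kernel] .

lemma smooth_on_dir_deriv_pow: "f \<in> smooth_on \<Lambda> \<Longrightarrow> (dir_deriv u ^^ p) f \<in> smooth_on \<Lambda>"
  by (induction p) (auto intro: smooth_on_dir_deriv)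

lemma fmode_pow:
  assumes "f \<in> smooth_on \<Lambda>"
  shows "fmode k ((dir_deriv u ^^ p) f) z = (2 * pi * \<i> * of_int k) ^ p * fmode k f z"
  by (induction p) (simp_all add: fmode_dir_deriv smooth_on_dir_deriv_pow assms)

lemma fmode_bound:
  assumes "f \<in> smooth_on \<Lambda>" and "\<bar>Im (L z)\<bar> \<le> T" and "\<And>z. \<bar>Im (L z)\<bar> \<le> T \<Longrightarrow> cmod (f z) \<le> B"
  shows "cmod (fmode k f z) \<le> B"
proof -
  have "cmod (integral {0..1} (\<lambda>s. cis (- (2 * pi * of_int k * s)) * f (z + s *\<^sub>R u))) \<le> B * (1 - 0)"
    by (rule integral_bound)
      (auto intro!: continuous_intros continuous_on_smooth[OF smooth_onD(1)[OF assms(1)]] assms(3)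
        simp: norm_mult L_add L_scaleR L_u assms(2))
  then show ?thesis by (simp add: fmode_fcoeff fcoeff_def)
qed

text \<open>Decay faster than any power of \<open>n\<close>, for all derivatives, on strips whose
  height \<open>T n\<close> may grow with \<open>n\<close>. Directions are basis vectors, so that
  only countably many conditions occur and one diagonal choice of \<open>T\<close> can meet them
  all.\<close>

definition rapid :: "(nat \<Rightarrow> nat) \<Rightarrow> (nat \<Rightarrow> complex^2 \<Rightarrow> complex) \<Rightarrow> bool" where
  "rapid T h \<longleftrightarrow> (\<forall>n. smooth (h n)) \<and> (\<forall>p vs. set vs \<subseteq> Basis \<longrightarrow>
     (\<forall>\<^sub>F n in sequentially. \<forall>z. \<bar>Im (L z)\<bar> \<le> real (T n) \<longrightarrow> real n ^ p * cmod (iter_deriv vs (h n) z) \<le> 1))"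

lemma rapidD:
  assumes "rapid T h"
  shows "smooth (h n)" "set vs \<subseteq> Basis \<Longrightarrow>
    \<forall>\<^sub>F n in sequentially. \<forall>z. \<bar>Im (L z)\<bar> \<le> real (T n) \<longrightarrow> real n ^ p * cmod (iter_deriv vs (h n) z) \<le> 1"
  using assms by (auto simp: rapid_def)

lemma rapid_plus:
  assumes h: "rapid T h" and g: "rapid T g" shows "rapid T (\<lambda>n z. h n z + g n z)"
  unfolding rapid_def
proof (intro conjI allI impI smooth_plus rapidD(1)[OF h] rapidD(1)[OF g])
  fix p :: nat and vs :: "(complex^2) list" assume vs: "set vs \<subseteq> Basis"
  show "\<forall>\<^sub>F n in sequentially. \<forall>z. \<bar>Im (L z)\<bar> \<le> real (T n) \<longrightarrow>
      real n ^ p * cmod (iter_deriv vs (\<lambda>z. h n z + g n z) z) \<le> 1"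
    \<comment> \<open>The additional power of \<open>n\<close> absorbs the factor 2 as soon as
      \<open>n\<close> is at least 2.\<close>
    using rapidD(2)[OF h vs, of "Suc p"] rapidD(2)[OF g vs, of "Suc p"] eventually_ge_at_top[of 2]
  proof eventually_elim
    case (elim n)
    show ?case
    proof (intro allI impI)
      fix z assume z: "\<bar>Im (L z)\<bar> \<le> real (T n)"
      let ?a = "real n ^ p * cmod (iter_deriv vs (h n) z)" and ?b = "real n ^ p * cmod (iter_deriv vs (g n) z)"
      have "real n * ?a \<le> 1" "real n * ?b \<le> 1" using elim z by (simp_all add: mult.assoc)
      moreover have "2 * ?a \<le> real n * ?a" "2 * ?b \<le> real n * ?b" using elim(3) by (intro mult_right_mono; simp)+
      ultimately have "?a + ?b \<le> 1" by linarith
      moreover have "real n ^ p * cmod (iter_deriv vs (h n) z + iter_deriv vs (g n) z) \<le> ?a + ?b"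
        unfolding distrib_left[symmetric] by (intro mult_left_mono norm_triangle_ineq) simp
      ultimately show "real n ^ p * cmod (iter_deriv vs (\<lambda>z. h n z + g n z) z) \<le> 1"
        by (simp add: iter_deriv_plus rapidD(1)[OF h] rapidD(1)[OF g])
    qed
  qed
qed

lemma rapid_scale:
  assumes h: "rapid T h" and c: "\<forall>\<^sub>F n in sequentially. cmod (c n) \<le> real n ^ m"
  shows "rapid T (\<lambda>n z. c n * h n z)"
  unfolding rapid_def
proof (intro conjI allI impI smooth_cmult rapidD(1)[OF h])
  fix p :: nat and vs :: "(complex^2) list" assume vs: "set vs \<subseteq> Basis"
  show "\<forall>\<^sub>F n in sequentially. \<forall>z. \<bar>Im (L z)\<bar> \<le> real (T n) \<longrightarrow>
      real n ^ p * cmod (iter_deriv vs (\<lambda>z. c n * h n z) z) \<le> 1"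
    using rapidD(2)[OF h vs, of "p + m"] c
  proof eventually_elim
    case (elim n)
    show ?case
    proof (intro allI impI)
      fix z assume z: "\<bar>Im (L z)\<bar> \<le> real (T n)"
      have "real n ^ p * (cmod (c n) * cmod (iter_deriv vs (h n) z)) \<le> real n ^ p * (real n ^ m * cmod (iter_deriv vs (h n) z))"
        using elim(2) by (intro mult_left_mono mult_right_mono) auto
      also have "\<dots> \<le> 1" using elim(1) z by (simp add: power_add mult.assoc)
      finally show "real n ^ p * cmod (iter_deriv vs (\<lambda>z. c n * h n z) z) \<le> 1"
        by (simp add: iter_deriv_cmult rapidD(1)[OF h] norm_mult)
    qed
  qed
qed

lemma rapid_cmult:
  assumes "rapid T h" shows "rapid T (\<lambda>n z. c * h n z)"
proof (rule rapid_scale[OF assms, where m=1])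
  obtain N where "cmod c \<le> real N" using real_arch_simple by blast
  then show "\<forall>\<^sub>F n in sequentially. cmod c \<le> real n ^ 1"
    by (intro eventually_sequentiallyI[of N]) (simp add: order_trans)
qed

lemma rapid_0: "rapid T (\<lambda>n z. 0)"
proof -
  have "iter_deriv vs (\<lambda>z. 0) = (\<lambda>z. 0)" for vs :: "(complex^2) list"
    by (induction vs) auto
  then show ?thesis by (simp add: rapid_def smooth_const)
qed

lemma rapid_dir_deriv:
  assumes h: "rapid T h" shows "rapid T (\<lambda>n. dir_deriv v (h n))"
proof -
  have b: "rapid T (\<lambda>n. dir_deriv b (h n))" if "b \<in> Basis" for b
    unfolding rapid_def
  proof (intro conjI allI impI smooth_dir_deriv rapidD(1)[OF h])
    fix p :: nat and vs :: "(complex^2) list" assume "set vs \<subseteq> Basis"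
    then show "\<forall>\<^sub>F n in sequentially. \<forall>z. \<bar>Im (L z)\<bar> \<le> real (T n) \<longrightarrow>
      real n ^ p * cmod (iter_deriv vs (dir_deriv b (h n)) z) \<le> 1"
      using rapidD(2)[OF h, of "vs @ [b]" p] that by (simp add: iter_deriv_append)
  qed
  have "rapid T (\<lambda>n z. \<Sum>b\<in>B. of_real (v \<bullet> b) * dir_deriv b (h n) z)" if "finite B" "B \<subseteq> Basis" for B
    using that by (induction B rule: finite_induct) (auto intro!: rapid_0 rapid_plus rapid_cmult b)
  from this[of Basis] have "rapid T (\<lambda>n z. \<Sum>b\<in>Basis. of_real (v \<bullet> b) * dir_deriv b (h n) z)" by simp
  moreover have "dir_deriv v (h n) = (\<lambda>z. \<Sum>b\<in>Basis. of_real (v \<bullet> b) * dir_deriv b (h n) z)" for n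
    by (rule ext, subst dir_deriv_Basis[OF rapidD(1)[OF h]]) (simp only: scaleR_conv_of_real[where 'a=complex])
  ultimately show ?thesis by (simp only:)
qed

text \<open>The class is \<open>solv\<close> of a rapid sequence plus a rapid sequence; it is closed
  under derivatives because the factors \<open>\<kappa> n\<close> grow polynomially. A fixed ball
  lies in the strip for large \<open>n\<close>, and there cubic decay of \<open>h\<close> against
  the factor 4 T(n), with T(n) at most n, leaves a multiple of n^-2.\<close>

lemma rapid_solv_series:
  assumes h: "rapid T h" and T: "filterlim T at_top sequentially" "\<And>n. T n \<le> n"
    and \<kappa>: "\<And>n. \<bar>\<kappa> n\<bar> \<le> 7 * real n"
    and b: "\<And>n. b n = - real (T n) \<and> \<kappa> n \<ge> 0 \<or> b n = real (T n) \<and> \<kappa> n \<le> 0"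
  defines "w \<equiv> (\<lambda>n. solv (\<kappa> n) (b n) (h n))"
  shows "smooth (\<lambda>z. \<Sum>n. w n z)" "dir_deriv v (\<lambda>z. \<Sum>n. w n z) z = (\<Sum>n. dir_deriv v (w n) z)"
    "summable (\<lambda>n. dir_deriv v (w n) z)"
proof -
  let ?P = "\<lambda>w. \<exists>h g. rapid T h \<and> rapid T g \<and> w = (\<lambda>n z. solv (\<kappa> n) (b n) (h n) z + g n z)"
  have P: "?P w" unfolding w_def by (intro exI[of _ h] exI[of _ "\<lambda>n z. 0"]) (simp add: h rapid_0)
  have \<kappa>': "\<forall>\<^sub>F n in sequentially. cmod (of_real (\<kappa> n)) \<le> real n ^ 2"
    using eventually_ge_at_top[of 7]
  proof eventually_elim
    case (elim n)
    have "7 * real n \<le> real n * real n" using elim by (intro mult_right_mono) auto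
    then show ?case using \<kappa>[of n] by (simp add: power2_eq_square)
  qed
  have D: "\<exists>D. (\<forall>n z. (w n has_derivative D n z) (at z)) \<and> (\<forall>v. ?P (\<lambda>n z. D n z v))" if Pw: "?P w" for w
  proof -
    obtain h g where h: "rapid T h" and g: "rapid T g" and w: "w = (\<lambda>n z. solv (\<kappa> n) (b n) (h n) z + g n z)"
      using Pw by blast
    note sh = rapidD(1)[OF h] and sg = rapidD(1)[OF g]
    let ?v = "\<lambda>v. v - Im (L v) *\<^sub>R (\<i> *s u)"
    define D where "D n z v = (solv (\<kappa> n) (b n) (dir_deriv (?v v) (h n)) z +
      of_real (Im (L v)) * (- of_real (\<kappa> n) * solv (\<kappa> n) (b n) (h n) z - 2 * \<i> * h n z)) + dir_deriv v (g n) z" for n z v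
    have "(w n has_derivative D n z) (at z)" for n z
      unfolding w D_def[abs_def] by (intro has_derivative_add solv_has_derivative smooth_has_derivative sh sg)
    moreover have "?P (\<lambda>n z. D n z v)" for v
    proof (intro exI conjI)
      let ?h = "\<lambda>n z. dir_deriv (?v v) (h n) z + (- of_real (Im (L v))) * (of_real (\<kappa> n) * h n z)"
      let ?g = "\<lambda>n z. (- (2 * \<i> * of_real (Im (L v)))) * h n z + dir_deriv v (g n) z"
      show "rapid T ?h" by (intro rapid_plus rapid_dir_deriv rapid_cmult rapid_scale[OF _ \<kappa>'] h)
      show "rapid T ?g" by (intro rapid_plus rapid_dir_deriv rapid_cmult h g)
      have "solv (\<kappa> n) (b n) (?h n) z = solv (\<kappa> n) (b n) (dir_deriv (?v v) (h n)) z +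
          (- of_real (Im (L v))) * (of_real (\<kappa> n) * solv (\<kappa> n) (b n) (h n) z)" for n z
        by (simp only: solv_plus[OF smooth_dir_deriv[OF sh] smooth_cmult[OF smooth_cmult[OF sh]]] solv_cmult)
      then show "(\<lambda>n z. D n z v) = (\<lambda>n z. solv (\<kappa> n) (b n) (?h n) z + ?g n z)"
        by (simp add: fun_eq_iff D_def algebra_simps)
    qed
    ultimately show ?thesis by blast
  qed
  have M: "\<exists>M. summable M \<and> (\<forall>\<^sub>F n in sequentially. \<forall>z\<in>ball 0 r. cmod (w n z) \<le> M n)" if Pw: "?P w" for w r
  proof -
    obtain h g where h: "rapid T h" and g: "rapid T g" and w: "w = (\<lambda>n z. solv (\<kappa> n) (b n) (h n) z + g n z)"
      using Pw by blast
    obtain K where K: "K > 0" "\<And>z. norm (L z) \<le> norm z * K"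
      using bounded_linear.pos_bounded[OF bounded_linear_L] by blast
    obtain N :: nat where N: "\<bar>r\<bar> * K \<le> real N" using real_arch_simple by blast
    have TN: "\<forall>\<^sub>F n in sequentially. N \<le> T n" using T(1) unfolding filterlim_at_top by blast
    have eh: "\<forall>\<^sub>F n in sequentially. \<forall>z. \<bar>Im (L z)\<bar> \<le> real (T n) \<longrightarrow> real n ^ 3 * cmod (iter_deriv [] (h n) z) \<le> 1"
      by (rule rapidD(2)[OF h]) simp
    have eg: "\<forall>\<^sub>F n in sequentially. \<forall>z. \<bar>Im (L z)\<bar> \<le> real (T n) \<longrightarrow> real n ^ 2 * cmod (iter_deriv [] (g n) z) \<le> 1"
      by (rule rapidD(2)[OF g]) simp
    have "\<forall>\<^sub>F n in sequentially. \<forall>z\<in>ball 0 r. cmod (w n z) \<le> 5 * inverse (real n ^ 2)"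
      using TN eventually_ge_at_top[of 1] eh eg
    proof eventually_elim
      case (elim n)
      show ?case
      proof
        fix z :: "complex^2" assume "z \<in> ball 0 r"
        then have "norm z \<le> \<bar>r\<bar>" by simp
        then have "norm z * K \<le> \<bar>r\<bar> * K" using K(1) by (intro mult_right_mono) auto
        then have z: "\<bar>Im (L z)\<bar> \<le> real (T n)"
          using K(2)[of z] abs_Im_le_cmod[of "L z"] N elim(1) by linarith
        have n: "real n > 0" using elim(2) by simp
        have "cmod (h n x) \<le> inverse (real n ^ 3)" if "\<bar>Im (L x)\<bar> \<le> real (T n)" for x
          using elim(3) that n by (simp add: field_simps)
        then have "cmod (solv (\<kappa> n) (b n) (h n) z) \<le> 4 * real (T n) * inverse (real n ^ 3)"
          by (rule solv_bound[OF rapidD(1)[OF h] z b])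
        also have "\<dots> \<le> 4 * real n * inverse (real n ^ 3)"
          using T(2)[of n] by (intro mult_right_mono) auto
        also have "\<dots> = 4 * inverse (real n ^ 2)" using n by (simp add: field_simps power3_eq_cube power2_eq_square)
        finally have "cmod (solv (\<kappa> n) (b n) (h n) z) \<le> 4 * inverse (real n ^ 2)" .
        moreover have "cmod (g n z) \<le> inverse (real n ^ 2)" using elim(4) z n by (simp add: field_simps)
        ultimately show "cmod (w n z) \<le> 5 * inverse (real n ^ 2)"
          unfolding w using norm_triangle_ineq[of "solv (\<kappa> n) (b n) (h n) z" "g n z"] by linarith
      qed
    qed
    moreover have "summable (\<lambda>n. 5 * inverse (real n ^ 2))"
      by (intro summable_mult inverse_power_summable) simp
    ultimately show ?thesis by blast
  qed
  show "smooth (\<lambda>z. \<Sum>n. w n z)" "dir_deriv v (\<lambda>z. \<Sum>n. w n z) z = (\<Sum>n. dir_deriv v (w n) z)"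
    "summable (\<lambda>n. dir_deriv v (w n) z)"
    by (rule smooth_series[where P="?P", OF P D M]; assumption)+
qed

text \<open>Differentiating \<open>Suc p\<close> times along \<open>u\<close> multiplies a mode by a
  factor of modulus \<open>(2 * pi * n) ^ Suc p\<close>, so modes decay relative to the suprema of
  derivatives of \<open>f\<close> on the strip. These suprema may grow arbitrarily with the strip;
  \<open>T\<close> is so slow that each is eventually at most \<open>n\<close>, which uses up the
  extra power.\<close>

lemma ex_rapid_modes:
  assumes f: "f \<in> smooth_on \<Lambda>"
  shows "\<exists>T. filterlim T at_top sequentially \<and> (\<forall>n. T n \<le> n) \<and>
    rapid T (\<lambda>n. fmode (int n) f) \<and> rapid T (\<lambda>n. fmode (- int n) f)"
proof -
  define A where "A = lists (Basis :: (complex^2) set) \<times> (UNIV :: nat set)"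
  have A: "countable A"
    unfolding A_def by (intro countable_SIGMA countable_lists countableI_type countable_finite finite_Basis)
  define G where "G j = (case from_nat_into A j of (vs, p) \<Rightarrow> iter_deriv vs ((dir_deriv u ^^ p) f))" for j
  have "\<exists>B. \<forall>z. \<bar>Im (L z)\<bar> \<le> real N \<longrightarrow> cmod (G j z) \<le> B" for j N
  proof -
    have "G j \<in> smooth_on \<Lambda>"
      by (auto simp: G_def split: prod.splits intro!: smooth_on_iter_deriv smooth_on_dir_deriv_pow f)
    then show ?thesis using strip_bound[of "G j" "real N"] by metis
  qed
  then have ex: "\<And>j N. \<exists>B. \<forall>z. \<bar>Im (L z)\<bar> \<le> real N \<longrightarrow> cmod (G j z) \<le> B" by blast
  define B where "B j N = (SOME B. \<forall>z. \<bar>Im (L z)\<bar> \<le> real N \<longrightarrow> cmod (G j z) \<le> B)" for j N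
  have B: "cmod (G j z) \<le> B j N" if "\<bar>Im (L z)\<bar> \<le> real N" for j N z
  proof -
    have "\<forall>z. \<bar>Im (L z)\<bar> \<le> real N \<longrightarrow> cmod (G j z) \<le> B j N" unfolding B_def by (rule someI_ex[OF ex])
    then show ?thesis using that by blast
  qed
  obtain T where T: "filterlim T at_top sequentially" "\<And>n. T n \<le> n" "\<And>j. \<forall>\<^sub>F n in sequentially. B j (T n) \<le> real n"
    using slow_growth[of B] by blast
  have "rapid T (\<lambda>n. fmode (s * int n) f)" if s: "\<bar>s\<bar> = 1" for s :: int
    unfolding rapid_def
  proof (intro conjI allI impI)
    fix p :: nat and vs :: "(complex^2) list" assume vs: "set vs \<subseteq> Basis"
    have "(vs, Suc p) \<in> A" using vs by (auto simp: A_def lists_eq_set)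
    then obtain j where j: "from_nat_into A j = (vs, Suc p)" using from_nat_into_surj[OF A] by blast
    show "\<forall>\<^sub>F n in sequentially. \<forall>z. \<bar>Im (L z)\<bar> \<le> real (T n) \<longrightarrow>
        real n ^ p * cmod (iter_deriv vs (fmode (s * int n) f) z) \<le> 1"
      using T(3)[of j] eventually_ge_at_top[of 1]
    proof eventually_elim
      case (elim n)
      show ?case
      proof (intro allI impI)
        fix z assume z: "\<bar>Im (L z)\<bar> \<le> real (T n)"
        let ?k = "s * int n" and ?g = "(dir_deriv u ^^ Suc p) f"
        have g: "?g \<in> smooth_on \<Lambda>" by (rule smooth_on_dir_deriv_pow[OF f])
        have "fmode ?k (iter_deriv vs ?g) = iter_deriv vs (fmode ?k ?g)"
          unfolding fmode_def by (rule iter_deriv_avg[OF smooth_onD(1)[OF g] fmode_kernel, symmetric])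
        also have "fmode ?k ?g = (\<lambda>z. (2 * pi * \<i> * of_int ?k) ^ Suc p * fmode ?k f z)"
          by (rule ext) (rule fmode_pow[OF f])
        also have "iter_deriv vs \<dots> = (\<lambda>z. (2 * pi * \<i> * of_int ?k) ^ Suc p * iter_deriv vs (fmode ?k f) z)"
          by (rule iter_deriv_cmult[OF smooth_onD(1)[OF fmode_smooth_on[OF f]]])
        finally have "cmod ((2 * pi * \<i> * of_int ?k) ^ Suc p * iter_deriv vs (fmode ?k f) z) = cmod (fmode ?k (iter_deriv vs ?g) z)"
          by simp
        also have "\<dots> \<le> B j (T n)"
          using B[of _ "T n" j] j by (intro fmode_bound[OF smooth_on_iter_deriv[OF g] z]) (simp add: G_def)
        also have "\<dots> \<le> real n" by (rule elim(1))
        finally have a1: "cmod (2 * pi * \<i> * of_int ?k) ^ Suc p * cmod (iter_deriv vs (fmode ?k f) z) \<le> real n"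
          by (simp only: norm_mult norm_power)
        have a2: "cmod (2 * pi * \<i> * of_int ?k) = 2 * pi * real n"
        proof -
          have "\<bar>real_of_int s\<bar> = 1" using s by linarith
          then show ?thesis by (simp add: norm_mult)
        qed
        have a3: "real n ^ Suc p \<le> (2 * pi * real n) ^ Suc p"
          using pi_ge_two by (intro power_mono) (auto intro: mult_right_mono[of 1 "2 * pi" "real n", simplified])
        have "real n ^ Suc p * cmod (iter_deriv vs (fmode ?k f) z) \<le> (2 * pi * real n) ^ Suc p * cmod (iter_deriv vs (fmode ?k f) z)"
          by (rule mult_right_mono[OF a3 norm_ge_zero])
        also have "\<dots> \<le> real n" using a1 unfolding a2 .
        finally have "real n ^ Suc p * cmod (iter_deriv vs (fmode ?k f) z) \<le> real n" .
        then have "real n * (real n ^ p * cmod (iter_deriv vs (fmode ?k f) z)) \<le> real n * 1" by (simp add: mult.assoc)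
        then show "real n ^ p * cmod (iter_deriv vs (fmode ?k f) z) \<le> 1"
          using elim(2) by (simp only: mult_le_cancel_left_pos of_nat_0_less_iff)
      qed
    qed
  qed (rule smooth_onD(1)[OF fmode_smooth_on[OF f]])
  from this[of 1] this[of "-1"] T show ?thesis by auto
qed

lemma periodic_solv:
  assumes "h \<in> smooth_on \<Lambda>" shows "periodic \<Lambda> (solv \<kappa> b h)"
  unfolding periodic_def
proof (intro ballI allI)
  fix l z assume l: "l \<in> \<Lambda>"
  have "h (z + l - x) = h (z - x)" for x
    using smooth_on_periodic[OF assms l, of "z - x"] by (simp add: algebra_simps)
  then show "solv \<kappa> b h (z + l) = solv \<kappa> b h z"
    by (simp add: solv_def L_add L_real[OF l])
qed

text \<open>On a mode the derivative along \<open>u\<close> is multiplication by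
  \<open>\<i> * \<kappa>\<close>, which turns the Cauchy-Riemann equation into the ordinary one
  behind \<open>solv\<close>.\<close>

lemma wirtbar_solv:
  assumes h: "smooth h" and hu: "\<And>z. dir_deriv u h z = \<i> * of_real \<kappa> * h z"
  shows "(dir_deriv u (solv \<kappa> b h) z + \<i> * dir_deriv (\<i> *s u) (solv \<kappa> b h) z) / 2 = h z"
proof -
  have "dir_deriv u (solv \<kappa> b h) z = solv \<kappa> b (dir_deriv u h) z"
    by (subst dir_deriv_eqI[OF solv_has_derivative[OF h]]) (simp add: L_u)
  also have "dir_deriv u h = (\<lambda>z. \<i> * of_real \<kappa> * h z)" using hu by (rule ext)
  also have "solv \<kappa> b \<dots> z = \<i> * of_real \<kappa> * solv \<kappa> b h z" by (rule solv_cmult)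
  finally have 1: "dir_deriv u (solv \<kappa> b h) z = \<i> * of_real \<kappa> * solv \<kappa> b h z" .
  have "dir_deriv 0 h = (\<lambda>z. 0 * h z)" using dir_deriv_zero[OF h] by (simp add: fun_eq_iff)
  then have "solv \<kappa> b (dir_deriv 0 h) z = 0" by (simp only: solv_cmult) simp
  then have 2: "dir_deriv (\<i> *s u) (solv \<kappa> b h) z = - of_real \<kappa> * solv \<kappa> b h z - 2 * \<i> * h z"
    by (subst dir_deriv_eqI[OF solv_has_derivative[OF h]]) (simp add: L_iu)
  show ?thesis unfolding 1 2 by (simp add: algebra_simps)
qed

theorem wirtbar_surj:
  assumes f: "f \<in> smooth_on \<Lambda>"
  shows "\<exists>g\<in>smooth_on \<Lambda>. wirtbar u g = f"
proof -
  obtain T where T: "filterlim T at_top sequentially" "\<And>n. T n \<le> n"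
    "rapid T (\<lambda>n. fmode (int n) f)" "rapid T (\<lambda>n. fmode (- int n) f)"
    using ex_rapid_modes[OF f] by blast
  \<comment> \<open>Nonnegative frequencies for \<open>s = True\<close>, negative ones otherwise;
    the factor 0 at n = 0 prevents mode 0 from being counted twice.\<close>
  define h where "h s n = (if s then fmode (int n) f else (\<lambda>z. of_nat (if n = 0 then 0 else 1) * fmode (- int n) f z))" for s n
  define \<kappa> where "\<kappa> s n = (if s then 2 * pi * real n else - (2 * pi * real n))" for s n
  \<comment> \<open>Lower or upper edge of the strip according to the sign of the frequency, as
    \<open>solv_bound\<close> demands.\<close>
  define b where "b s n = (if s then - real (T n) else real (T n))" for s n
  define w where "w s n = solv (\<kappa> s n) (b s n) (h s n)" for s n
  have hs: "h s n \<in> smooth_on \<Lambda>" for s n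
    unfolding h_def by (cases s) (auto intro!: smooth_on_cmult fmode_smooth_on f simp: if_distrib smooth_on_const)
  have hr: "rapid T (h s)" for s
  proof (cases s)
    case True then show ?thesis using T(3) by (simp add: h_def[abs_def])
  next
    case False
    have "rapid T (\<lambda>n z. of_nat (if n = 0 then 0 else 1) * fmode (- int n) f z)"
      by (rule rapid_scale[OF T(4), of _ 0]) (auto intro!: always_eventually)
    then show ?thesis using False by (simp add: h_def[abs_def])
  qed
  have pi7: "2 * pi \<le> 7" using pi_less_4 pi_approx by simp
  have \<kappa>7: "\<bar>\<kappa> s n\<bar> \<le> 7 * real n" for s n
    using mult_right_mono[OF pi7, of "real n"] by (auto simp: \<kappa>_def abs_mult)
  have bk: "b s n = - real (T n) \<and> \<kappa> s n \<ge> 0 \<or> b s n = real (T n) \<and> \<kappa> s n \<le> 0" for s n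
    by (auto simp: b_def \<kappa>_def)
  have ser: "smooth (\<lambda>z. \<Sum>n. w s n z)" "dir_deriv v (\<lambda>z. \<Sum>n. w s n z) z = (\<Sum>n. dir_deriv v (w s n) z)"
    "summable (\<lambda>n. dir_deriv v (w s n) z)" for s v z
    using rapid_solv_series[of T "h s" "\<kappa> s" "b s", OF hr T(1,2) \<kappa>7 bk] unfolding w_def by blast+
  have hu: "dir_deriv u (h s n) z = \<i> * of_real (\<kappa> s n) * h s n z" for s n z
    by (cases s) (simp_all add: h_def \<kappa>_def dir_deriv_fmode f dir_deriv_smooth_cmult smooth_onD(1)[OF fmode_smooth_on[OF f]] smooth_const)
  have ww: "(dir_deriv u (w s n) z + \<i> * dir_deriv (\<i> *s u) (w s n) z) / 2 = h s n z" for s n z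
    unfolding w_def by (rule wirtbar_solv[OF smooth_onD(1)[OF hs] hu])
  define W where "W s = (\<lambda>z. \<Sum>n. w s n z)" for s
  have W: "W s \<in> smooth_on \<Lambda>" for s
  proof -
    have "smooth (W s)" unfolding W_def by (rule ser(1))
    then show ?thesis using periodic_solv[OF hs] by (simp add: smooth_on_def periodic_def W_def w_def)
  qed
  have hsum: "(\<lambda>n. h s n z) sums wirtbar u (W s) z" for s z
  proof -
    have "(\<lambda>n. (1/2) * dir_deriv u (w s n) z + (\<i>/2) * dir_deriv (\<i> *s u) (w s n) z) sums
        ((1/2) * (\<Sum>n. dir_deriv u (w s n) z) + (\<i>/2) * (\<Sum>n. dir_deriv (\<i> *s u) (w s n) z))"
      by (intro sums_add sums_mult summable_sums ser(3))
    moreover have "(1/2) * dir_deriv u (w s n) z + (\<i>/2) * dir_deriv (\<i> *s u) (w s n) z = h s n z" for n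
      using ww[of s n z] by (simp add: field_simps)
    ultimately show ?thesis unfolding wirtbar_def' W_def by (simp only: ser(2))
  qed
  have "wirtbar u (\<lambda>z. W True z + W False z) z = f z" for z
  proof -
    have "(\<lambda>n. h True n z + h False n z) sums (wirtbar u (W True) z + wirtbar u (W False) z)"
      by (intro sums_add hsum)
    moreover have "h True n z + h False n z =
        (if n = 0 then fmode 0 f z else fmode (int n) f z + fmode (- int n) f z)" for n
      by (simp add: h_def)
    ultimately have "wirtbar u (W True) z + wirtbar u (W False) z = f z"
      using fmode_sums[OF f, of z] by (simp only: sums_unique2)
    then show ?thesis by (simp add: wirtbar_plus smooth_onD(1)[OF W])
  qed
  then show ?thesis using W by (intro bexI[of _ "\<lambda>z. W True z + W False z"] smooth_on_plus) auto
qed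

corollary wirt_surj:
  assumes f: "f \<in> smooth_on \<Lambda>"
  shows "\<exists>g\<in>smooth_on \<Lambda>. wirt u g = f"
proof -
  obtain g where g: "g \<in> smooth_on \<Lambda>" "wirtbar u g = (\<lambda>z. cnj (f z))"
    using wirtbar_surj[OF smooth_on_cnj[OF f]] by blast
  then show ?thesis
    by (intro bexI[of _ "\<lambda>z. cnj (g z)"] smooth_on_cnj) (simp_all add: wirt_cnj smooth_onD(1) fun_eq_iff)
qed

end

section \<open>Disc operators, means and iterated derivatives\<close>

lemmas wirt_simps = wirt_plus wirtbar_plus wirt_diff wirtbar_diff wirt_cmult wirtbar_cmult
  wirt_minus wirtbar_minus smooth_intros smooth_wirt smooth_wirtbar

lemma iter_deriv_diff:
  "smooth f \<Longrightarrow> smooth g \<Longrightarrow> iter_deriv vs (\<lambda>z. f z - g z) = (\<lambda>z. iter_deriv vs f z - iter_deriv vs g z)"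
  by (induction vs) (simp_all add: dir_deriv_smooth_diff smooth_iter_deriv)

lemma torus_mean_iter_deriv: "smooth f \<Longrightarrow> torus_mean ls (iter_deriv vs f) = iter_deriv vs (torus_mean ls f)"
  by (induction vs) (simp_all add: torus_mean_dir_deriv smooth_iter_deriv)

lemma disc_mean_iter_deriv: "smooth f \<Longrightarrow> disc_mean e R (iter_deriv vs f) = iter_deriv vs (disc_mean e R f)"
  unfolding disc_mean_def by (rule iter_deriv_avg[OF _ disc_kernels(2,1), symmetric])

lemma wirt_disc_comm:
  assumes "smooth f"
  shows "wirt v (disc_pot e R f) = disc_pot e R (wirt v f)" "wirtbar v (disc_pot e R f) = disc_pot e R (wirtbar v f)"
    "wirt v (disc_potbar e R f) = disc_potbar e R (wirt v f)" "wirtbar v (disc_potbar e R f) = disc_potbar e R (wirtbar v f)"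
    "wirt v (disc_mean e R f) = disc_mean e R (wirt v f)" "wirtbar v (disc_mean e R f) = disc_mean e R (wirtbar v f)"
  unfolding disc_pot_def disc_potbar_def disc_mean_def
  by (rule wirt_avg[OF assms disc_kernels(3,1)] wirt_avg[OF assms disc_kernels(4,1)] wirt_avg[OF assms disc_kernels(2,1)])+

lemma disc_plus:
  assumes "smooth f" "smooth g"
  shows "disc_pot e R (\<lambda>z. f z + g z) = (\<lambda>z. disc_pot e R f z + disc_pot e R g z)"
    "disc_potbar e R (\<lambda>z. f z + g z) = (\<lambda>z. disc_potbar e R f z + disc_potbar e R g z)"
    "disc_mean e R (\<lambda>z. f z + g z) = (\<lambda>z. disc_mean e R f z + disc_mean e R g z)"
  unfolding disc_pot_def disc_potbar_def disc_mean_def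
  by (rule avg_plus[OF assms disc_kernels(3,1)] avg_plus[OF assms disc_kernels(4,1)] avg_plus[OF assms disc_kernels(2,1)])+

lemma disc_cmult:
  "disc_pot e R (\<lambda>z. c * f z) = (\<lambda>z. c * disc_pot e R f z)"
  "disc_potbar e R (\<lambda>z. c * f z) = (\<lambda>z. c * disc_potbar e R f z)"
  "disc_mean e R (\<lambda>z. c * f z) = (\<lambda>z. c * disc_mean e R f z)"
  unfolding disc_pot_def disc_potbar_def disc_mean_def by (rule avg_cmult)+

lemma disc_diff:
  assumes "smooth f" "smooth g"
  shows "disc_pot e R (\<lambda>z. f z - g z) = (\<lambda>z. disc_pot e R f z - disc_pot e R g z)"
    "disc_potbar e R (\<lambda>z. f z - g z) = (\<lambda>z. disc_potbar e R f z - disc_potbar e R g z)"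
    "disc_mean e R (\<lambda>z. f z - g z) = (\<lambda>z. disc_mean e R f z - disc_mean e R g z)"
  using disc_plus[OF assms(1) smooth_cmult[OF assms(2), of "-1"], of e R] unfolding disc_cmult by simp_all

text \<open>For (1,1)-forms the product of \<open>wirt e\<close> and \<open>wirtbar e\<close> has to
  be inverted, which takes one potential for each.\<close>

definition disc_pot2 :: "complex^'n \<Rightarrow> real \<Rightarrow> (complex^'n \<Rightarrow> complex) \<Rightarrow> complex^'n \<Rightarrow> complex" where
  "disc_pot2 e R f = disc_pot e R (disc_potbar e R f)"

text \<open>Each potential contributes a factor 1 - A, where A is the disc mean; the result is (1 -
  A)^2 applied to \<open>f\<close>.\<close>

lemma disc_pot2_wirt:
  assumes f: "smooth f" and R: "R > 0"
  shows "disc_pot2 e R (wirt e (wirtbar e f)) =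
    (\<lambda>z. f z - 2 * disc_mean e R f z + disc_mean e R (disc_mean e R f) z)"
proof -
  have "disc_potbar e R (wirt e (wirtbar e f)) = wirt e (wirtbar e (disc_potbar e R f))"
    by (simp add: wirt_disc_comm[symmetric] f smooth_wirtbar)
  also have "wirtbar e (disc_potbar e R f) = (\<lambda>z. f z - disc_mean e R f z)"
    by (rule ext) (rule wirtbar_disc_potbar[OF f R])
  finally have "disc_pot2 e R (wirt e (wirtbar e f)) = wirt e (disc_pot e R (\<lambda>z. f z - disc_mean e R f z))"
    unfolding disc_pot2_def by (simp add: wirt_disc_comm(1) f smooth_diff smooth_disc)
  also have "\<dots> = (\<lambda>z. f z - disc_mean e R f z - disc_mean e R (\<lambda>z. f z - disc_mean e R f z) z)"
    by (rule ext) (rule wirt_disc_pot[OF smooth_diff[OF f smooth_disc(1)[OF f]] R])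
  finally show ?thesis unfolding disc_diff(3)[OF f smooth_disc(1)[OF f]] by (simp add: fun_eq_iff)
qed

lemma disc_pot2_simps:
  "smooth f \<Longrightarrow> smooth (disc_pot2 e R f)"
  "f \<in> smooth_on \<Lambda> \<Longrightarrow> disc_pot2 e R f \<in> smooth_on \<Lambda>"
  "smooth f \<Longrightarrow> wirt v (disc_pot2 e R f) = disc_pot2 e R (wirt v f)"
  "smooth f \<Longrightarrow> wirtbar v (disc_pot2 e R f) = disc_pot2 e R (wirtbar v f)"
  "smooth f \<Longrightarrow> smooth g \<Longrightarrow> disc_pot2 e R (\<lambda>z. f z + g z) = (\<lambda>z. disc_pot2 e R f z + disc_pot2 e R g z)"
  "smooth f \<Longrightarrow> smooth g \<Longrightarrow> disc_pot2 e R (\<lambda>z. f z - g z) = (\<lambda>z. disc_pot2 e R f z - disc_pot2 e R g z)"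
  unfolding disc_pot2_def
  by (simp_all add: smooth_disc smooth_on_disc wirt_disc_comm disc_plus disc_diff)

lemma ex_const_if_dir_deriv_0:
  assumes "smooth f" "\<And>v z. dir_deriv v f z = 0" shows "\<exists>c. f = (\<lambda>z. c)"
proof -
  have "f z = f 0" for z using dir_deriv_zero_imp_eq[OF assms, of 0 1 z] by simp
  then show ?thesis by blast
qed

context toroidal_frame
begin

subsection \<open>The frame and its dual\<close>

text \<open>\<open>p\<close> and \<open>q\<close> are the coefficients of the linear forms dual to
  the frame \<open>e\<close>, \<open>u\<close>; those in \<open>q\<close> belong to \<open>L\<close>
  itself.\<close>

definition q :: "2 \<Rightarrow> complex" where "q k = L (axis k 1)"

definition p :: "2 \<Rightarrow> complex" where "p k = (SOME w. axis k 1 - q k *s u = w *s e)"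

lemma frame_axis: "axis k 1 = p k *s e + q k *s u"
proof -
  have "L (axis k 1 - q k *s u) = 0" by (simp add: L_diff L_smult L_u q_def)
  from someI_ex[OF ker_L[OF this]] have "axis k 1 - q k *s u = p k *s e" unfolding p_def .
  then show ?thesis by (simp add: algebra_simps)
qed

lemma dz_frame: "smooth f \<Longrightarrow> dz k f z = p k * wirt e f z + q k * wirt u f z"
  and dzbar_frame: "smooth f \<Longrightarrow> dzbar k f z = cnj (p k) * wirtbar e f z + cnj (q k) * wirtbar u f z"
  unfolding dz_eq_wirt dzbar_eq_wirtbar frame_axis by (simp_all only: wirt_add wirtbar_add wirt_smult wirtbar_smult)

lemma vec2_frame: "(v :: complex^2) = (v $ 1 * p 1 + v $ 2 * p 2) *s e + (v $ 1 * q 1 + v $ 2 * q 2) *s u"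
proof -
  have "v = v $ 1 *s axis 1 1 + v $ 2 *s axis 2 1" using vec_sum_axis[of v] by (simp add: sum_2)
  also have "\<dots> = (v $ 1 * p 1 + v $ 2 * p 2) *s e + (v $ 1 * q 1 + v $ 2 * q 2) *s u"
    unfolding frame_axis by (simp add: vec_eq_iff algebra_simps)
  finally show ?thesis .
qed

lemma frame_dual:
  "e $ 1 * p 1 + e $ 2 * p 2 = 1" "e $ 1 * q 1 + e $ 2 * q 2 = 0"
  "u $ 1 * p 1 + u $ 2 * p 2 = 0" "u $ 1 * q 1 + u $ 2 * q 2 = 1"
proof -
  show eq: "e $ 1 * q 1 + e $ 2 * q 2 = 0" and uq: "u $ 1 * q 1 + u $ 2 * q 2 = 1"
    using L_coords[of e] L_coords[of u] by (simp_all add: L_e L_u q_def)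
  have *: "c = 0" if "c *s e = 0" for c using that e_neq_0 by (auto simp: vec_eq_iff)
  have "(e $ 1 * p 1 + e $ 2 * p 2 - 1) *s e = 0"
    using vec2_frame[of e] unfolding eq by (auto simp: vec_eq_iff algebra_simps)
  from *[OF this] show "e $ 1 * p 1 + e $ 2 * p 2 = 1" by simp
  have "(u $ 1 * p 1 + u $ 2 * p 2) *s e = 0"
    using vec2_frame[of u] unfolding uq by (auto simp: vec_eq_iff algebra_simps)
  from *[OF this] show "u $ 1 * p 1 + u $ 2 * p 2 = 0" .
qed

lemma frame_det: "p 1 * q 2 - p 2 * q 1 \<noteq> 0"
proof
  assume "p 1 * q 2 - p 2 * q 1 = 0"
  moreover have "(e $ 1 * u $ 2 - e $ 2 * u $ 1) * (p 1 * q 2 - p 2 * q 1) = 1"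
    using frame_dual by algebra
  ultimately show False by simp
qed

lemma frame_delta: "p k * e $ j + q k * u $ j = (if j = k then 1 else 0)"
  using arg_cong[OF frame_axis[of k], of "\<lambda>v. v $ j"] by (simp add: axis_def)

lemma frame_decomp: "p k * (e $ 1 * x 1 + e $ 2 * x 2) + q k * (u $ 1 * x 1 + u $ 2 * x 2) = x (k :: 2)"
proof -
  have "p k * (e $ 1 * x 1 + e $ 2 * x 2) + q k * (u $ 1 * x 1 + u $ 2 * x 2) =
      (p k * e $ 1 + q k * u $ 1) * x 1 + (p k * e $ 2 + q k * u $ 2) * x 2"
    by (simp add: algebra_simps)
  also have "\<dots> = x k" unfolding frame_delta using exhaust_2[of k] by auto
  finally show ?thesis .
qed

lemma wirt_frame_coords:
  fixes f :: "complex^2 \<Rightarrow> complex"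
  shows "smooth f \<Longrightarrow> wirt v f z = v $ 1 * dz 1 f z + v $ 2 * dz 2 f z"
  "smooth f \<Longrightarrow> wirtbar v f z = cnj (v $ 1) * dzbar 1 f z + cnj (v $ 2) * dzbar 2 f z"
  by (simp_all add: wirt_coords sum_2)

subsection \<open>The transversal coordinate\<close>

definition ht :: "complex^2 \<Rightarrow> complex" where "ht z = of_real (Im (L z))"

lemma bounded_linear_ht: "bounded_linear ht"
  unfolding ht_def[abs_def] by (rule bounded_linear_compose[OF bounded_linear_of_real bounded_linear_ImL])

lemma ht_smooth_on: "ht \<in> smooth_on \<Lambda>"
  using smooth_linear[OF bounded_linear_ht] L_real by (simp add: smooth_on_def periodic_def ht_def L_add)

lemma dz_ht: "dz k ht z = - (\<i> / 2) * q k" and dzbar_ht: "dzbar k ht z = \<i> / 2 * cnj (q k)"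
  by (simp_all add: dz_frame dzbar_frame smooth_onD(1)[OF ht_smooth_on] wirt_def wirtbar_def
    dir_deriv_linear[OF bounded_linear_ht]) (simp_all add: ht_def L_e L_u L_smult)

lemma invariant_affine:
  assumes f: "f \<in> smooth_on \<Lambda>" and inv: "\<And>v z. Im (L v) = 0 \<Longrightarrow> dir_deriv v f z = 0"
    and c: "\<And>z. dir_deriv (\<i> *s u) f z = b"
  shows "\<exists>a. f = (\<lambda>z. a + b * ht z)"
proof -
  note sf = smooth_onD(1)[OF f] and st = smooth_onD(1)[OF ht_smooth_on]
  have "dir_deriv v (\<lambda>z. f z - b * ht z) z = 0" for v z
  proof -
    have "dir_deriv v f z = dir_deriv (v - Im (L v) *\<^sub>R (\<i> *s u)) f z + dir_deriv (Im (L v) *\<^sub>R (\<i> *s u)) f z"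
      by (simp add: dir_deriv_minus_vec[OF sf])
    also have "\<dots> = Im (L v) *\<^sub>R b"
      by (simp add: inv L_diff L_scaleR L_iu dir_deriv_scaleR[OF sf] c)
    finally show ?thesis
      by (simp add: dir_deriv_smooth_diff dir_deriv_smooth_cmult sf st smooth_cmult dir_deriv_linear[OF bounded_linear_ht])
        (simp add: ht_def scaleR_conv_of_real)
  qed
  then obtain a where "(\<lambda>z. f z - b * ht z) = (\<lambda>z. a)"
    using ex_const_if_dir_deriv_0[OF smooth_diff[OF sf smooth_cmult[OF st]]] by blast
  then have "f z = a + b * ht z" for z by (metis diff_eq_eq)
  then show ?thesis by blast
qed

text \<open>Each \<open>dzbar j f\<close> is antiholomorphic and each \<open>dz j f\<close>
  holomorphic on the quotient, so all are constant. A constant differential integrates to 0 over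
  every period, hence vanishes on the hyperplane, and \<open>f\<close> depends on the height
  alone.\<close>

lemma pluriharmonic_affine:
  assumes f: "f \<in> smooth_on \<Lambda>" and ph: "\<And>i j z. dz i (dzbar j f) z = 0"
  shows "\<exists>a b. f = (\<lambda>z. a + b * ht z)"
proof -
  note sf = smooth_onD(1)[OF f]
  have "\<forall>j. \<exists>c. dzbar j f = (\<lambda>z. c)"
    using toroidal_const'[OF toroidal _ ph] f by (simp add: dzbar_eq_wirtbar smooth_on_wirtbar)
  moreover have "dzbar i (dz j f) z = 0" for i j z
    using ph[of j i z] by (simp add: dz_eq_wirt dzbar_eq_wirtbar wirt_commutes(2)[OF sf])
  then have "\<forall>j. \<exists>c. dz j f = (\<lambda>z. c)"
    using toroidal_const[OF toroidal] f by (simp add: dz_eq_wirt smooth_on_wirt)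
  ultimately obtain c d where cd: "\<And>j. dzbar j f = (\<lambda>z. c j)" "\<And>j. dz j f = (\<lambda>z. d j)" by metis
  have const: "dir_deriv v f z = dir_deriv v f 0" for v z
    by (simp add: dir_deriv_eq_wirt wirt_coords[OF sf] cd)
  have ls0: "dir_deriv l f 0 = 0" if "l \<in> \<Lambda>" for l
  proof -
    have "line_mean l (dir_deriv l f) 0 = f (0 + l) - f 0"
      using avg_line_deriv[OF sf, of 1 l 0] by (simp add: line_mean_def)
    moreover have "line_mean l (dir_deriv l f) 0 = dir_deriv l f 0"
    proof -
      have "cmod (line_mean l (dir_deriv l f) 0 - dir_deriv l f 0) \<le> 0"
        by (rule line_mean_near[OF smooth_dir_deriv[OF sf]]) (subst const, simp)
      then show ?thesis by simp
    qed
    ultimately show ?thesis using smooth_on_periodic[OF f that, of 0] by simp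
  qed
  have "subspace {v. dir_deriv v f 0 = 0}"
    by (auto simp: subspace_def dir_deriv_add[OF sf] dir_deriv_scaleR[OF sf] dir_deriv_zero[OF sf])
  then have "span (set ls) \<subseteq> {v. dir_deriv v f 0 = 0}"
    using ls_subset ls0 by (intro span_minimal) auto
  then have "dir_deriv v f z = 0" if "Im (L v) = 0" for v z
    using that span_ls const[of v z] by auto
  from invariant_affine[OF f this const] show ?thesis by blast
qed

subsection \<open>Approximation in the smooth topology\<close>

text \<open>The iterated disc mean is included because two potentials leave the remainder 2 A - A^2.
  It satisfies the same bound since the torus mean is constant along \<open>e\<close>.\<close>

lemma disc_mean_approx:
  assumes f: "f \<in> smooth_on \<Lambda>" and r: "r > 0"
  shows "\<forall>\<^sub>F n in sequentially. \<forall>z. \<bar>Im (L z)\<bar> \<le> T \<longrightarrow>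
      cmod (iter_deriv vs (disc_mean e (real (Suc n)) f) z - iter_deriv vs (mean f) z) \<le> r \<and>
      cmod (iter_deriv vs (disc_mean e (real (Suc n)) (disc_mean e (real (Suc n)) f)) z - iter_deriv vs (mean f) z) \<le> r"
proof -
  let ?f = "iter_deriv vs f"
  have g: "?f \<in> smooth_on \<Lambda>" by (rule smooth_on_iter_deriv[OF f])
  note sf = smooth_onD(1)[OF f]
  obtain R0 where R0: "\<And>R z. R \<ge> R0 \<Longrightarrow> \<bar>Im (L z)\<bar> \<le> T \<Longrightarrow> cmod (disc_mean e R ?f z - mean ?f z) \<le> r"
    using disc_mean_tendsto[OF g r, of T] by blast
  obtain N where N: "R0 \<le> real N" using real_arch_simple by blast
  show ?thesis
  proof (rule eventually_sequentiallyI[of N], intro allI impI)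
    fix n z assume n: "N \<le> n" and z: "\<bar>Im (L z)\<bar> \<le> T"
    define R where "R = real (Suc n)"
    have R: "R \<ge> R0" "R > 0" using n N by (auto simp: R_def)
    have "cmod (disc_mean e R (disc_mean e R ?f) z - mean ?f z) \<le> r"
    proof (rule disc_mean_near[OF smooth_disc(1)[OF smooth_onD(1)[OF g]] R(2)])
      fix w
      have "mean ?f (z + w *s e) = mean ?f z" by (rule mean_invariant[OF g]) (simp add: L_smult L_e)
      then show "cmod (disc_mean e R ?f (z + w *s e) - mean ?f z) \<le> r"
        using R0[OF R(1), of "z + w *s e"] z by (simp add: L_translate)
    qed
    then show "cmod (iter_deriv vs (disc_mean e (real (Suc n)) f) z - iter_deriv vs (mean f) z) \<le> r \<and>
      cmod (iter_deriv vs (disc_mean e (real (Suc n)) (disc_mean e (real (Suc n)) f)) z - iter_deriv vs (mean f) z) \<le> r"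
      using R0[OF R(1) z] by (simp add: R_def disc_mean_iter_deriv torus_mean_iter_deriv sf smooth_disc)
  qed
qed

text \<open>Surjectivity solves the equation along \<open>u\<close>; the torus mean of the solution
  has no derivative along \<open>e\<close> and still solves it, as the right-hand side is its own
  mean.\<close>

lemma ex_wirt_mean:
  assumes "f \<in> smooth_on \<Lambda>"
  shows "\<exists>g\<in>smooth_on \<Lambda>. \<forall>k z. dz k g z = q k * mean f z"
    and "\<exists>g\<in>smooth_on \<Lambda>. \<forall>k z. dzbar k g z = cnj (q k) * mean f z"
proof -
  have mm: "mean (mean f) = mean f"
    using invariant_mean[of "mean f"] mean_invariant[OF assms] smooth_torus_mean smooth_onD(1)[OF assms] by blast
  obtain h where h: "h \<in> smooth_on \<Lambda>" "wirt u h = mean f"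
    using wirt_surj[OF smooth_on_torus_mean[OF assms]] by blast
  have "dz k (mean h) z = q k * mean f z" for k z
    using torus_mean_wirt[OF smooth_onD(1)[OF h(1)], of ls u] h mm
    by (simp add: dz_frame smooth_torus_mean smooth_onD(1) wirt_e_mean)
  then show "\<exists>g\<in>smooth_on \<Lambda>. \<forall>k z. dz k g z = q k * mean f z"
    using smooth_on_torus_mean[OF h(1)] by blast
  obtain h' where h': "h' \<in> smooth_on \<Lambda>" "wirtbar u h' = mean f"
    using wirtbar_surj[OF smooth_on_torus_mean[OF assms]] by blast
  have "dzbar k (mean h') z = cnj (q k) * mean f z" for k z
    using torus_mean_wirtbar[OF smooth_onD(1)[OF h'(1)], of ls u] h' mm
    by (simp add: dzbar_frame smooth_torus_mean smooth_onD(1) wirtbar_e_mean)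
  then show "\<exists>g\<in>smooth_on \<Lambda>. \<forall>k z. dzbar k g z = cnj (q k) * mean f z"
    using smooth_on_torus_mean[OF h'(1)] by blast
qed

text \<open>Closedness turns \<open>dz k Fe\<close> into \<open>wirt e (F k)\<close>, so a disc
  potential of the single function \<open>Fe\<close> integrates both components up to disc means.
  These tend to torus means, and the mean form is \<open>p k * c\<close> plus
  \<open>q k * mean Fu\<close>: a constant form plus an exact one.\<close>

lemma closed_1form_approx:
  fixes F :: "2 \<Rightarrow> complex^2 \<Rightarrow> complex"
  assumes F: "\<And>k. F k \<in> smooth_on \<Lambda>" and cl: "dz 2 (F 1) = dz 1 (F 2)"
  shows "\<exists>g \<omega>. (\<forall>n. g n \<in> smooth_on \<Lambda>) \<and> (\<forall>k vs T r. r > 0 \<longrightarrow> (\<forall>\<^sub>F n::nat in sequentially. \<forall>z. \<bar>Im (L z)\<bar> \<le> T \<longrightarrow>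
      cmod (iter_deriv vs (\<lambda>z. dz k (g n) z + \<omega> k) z - iter_deriv vs (F k) z) \<le> r))"
proof -
  note sF = smooth_onD(1)[OF F]
  have cl': "dz k (F j) = dz j (F k)" for j k using cl exhaust_2[of j] exhaust_2[of k] by auto
  define Fe where "Fe = (\<lambda>z. e $ 1 * F 1 z + e $ 2 * F 2 z)"
  define Fu where "Fu = (\<lambda>z. u $ 1 * F 1 z + u $ 2 * F 2 z)"
  have Fe: "Fe \<in> smooth_on \<Lambda>" and Fu: "Fu \<in> smooth_on \<Lambda>"
    unfolding Fe_def Fu_def by (intro smooth_on_intros F)+
  note sFe = smooth_onD(1)[OF Fe] and sFu = smooth_onD(1)[OF Fu]
  have dFe: "dz k Fe z = wirt e (F k) z" and dFu: "dz k Fu z = wirt u (F k) z" for k z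
    unfolding wirt_frame_coords(1)[OF sF] cl'[of _ k]
    by (simp_all add: Fe_def Fu_def dz_eq_wirt wirt_simps sF)
  have "wirt u Fe z = wirt e Fu z" for z
    unfolding wirt_frame_coords(1)[OF sFe] wirt_frame_coords(1)[OF sFu] dFe dFu wirt_frame_coords(1)[OF sF]
    by (simp add: cl algebra_simps)
  then have "wirt u (mean Fe) = wirt e (mean Fu)"
    using torus_mean_wirt[OF sFe, of ls u] torus_mean_wirt[OF sFu, of ls e] by presburger
  \<comment> \<open>By closedness this height derivative comes from a derivative along
    \<open>e\<close> of a mean, which is 0. The constant \<open>c\<close> obtained here gives the
    holomorphic part \<open>\<omega>\<close>.\<close>
  then have "dir_deriv (\<i> *s u) (mean Fe) z = 0" for z
    using wirt_u_mean[OF Fe, of z] wirt_e_mean[OF Fu, of z] by simp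
  from invariant_affine[OF smooth_on_torus_mean[OF Fe] dir_deriv_mean[OF Fe] this]
  obtain c where c: "mean Fe = (\<lambda>z. c)" by auto
  obtain g0 where g0: "g0 \<in> smooth_on \<Lambda>" "\<And>k z. dz k g0 z = q k * mean Fu z"
    using ex_wirt_mean(1)[OF Fu] by blast
  have mF: "mean (F k) z = p k * c + q k * mean Fu z" for k z
  proof -
    have "F k = (\<lambda>z. p k * Fe z + q k * Fu z)"
      using frame_decomp[of k "\<lambda>j. F j _"] by (simp add: Fe_def Fu_def fun_eq_iff)
    then have "mean (F k) = (\<lambda>z. p k * mean Fe z + q k * mean Fu z)"
      by (simp only: torus_mean_plus torus_mean_cmult smooth_cmult sFe sFu)
    then show ?thesis using c by simp
  qed
  define g where "g n = (\<lambda>z. disc_pot e (real (Suc n)) Fe z + g0 z)" for n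
  have eq: "(\<lambda>z. dz k (g n) z + p k * c) = (\<lambda>z. F k z - disc_mean e (real (Suc n)) (F k) z + mean (F k) z)" for k n
  proof
    fix z
    have "dz k (disc_pot e (real (Suc n)) Fe) = disc_pot e (real (Suc n)) (dz k Fe)"
      unfolding dz_eq_wirt by (rule wirt_disc_comm[OF sFe])
    also have "dz k Fe = wirt e (F k)" using dFe by (rule ext)
    also have "disc_pot e (real (Suc n)) (wirt e (F k)) = wirt e (disc_pot e (real (Suc n)) (F k))"
      by (rule wirt_disc_comm[OF sF, symmetric])
    finally have "dz k (disc_pot e (real (Suc n)) Fe) z = F k z - disc_mean e (real (Suc n)) (F k) z"
      by (simp add: wirt_disc_pot[OF sF])
    then show "dz k (g n) z + p k * c = F k z - disc_mean e (real (Suc n)) (F k) z + mean (F k) z"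
      using g0(2)[of k z] unfolding g_def mF dz_eq_wirt
      by (simp add: wirt_plus smooth_disc sFe smooth_onD(1)[OF g0(1)])
  qed
  have "\<forall>\<^sub>F n::nat in sequentially. \<forall>z. \<bar>Im (L z)\<bar> \<le> T \<longrightarrow>
      cmod (iter_deriv vs (\<lambda>z. dz k (g n) z + p k * c) z - iter_deriv vs (F k) z) \<le> r" if "r > 0" for k vs T r
    using disc_mean_approx[OF F[of k] that, of T vs]
  proof eventually_elim
    case (elim n)
    have "iter_deriv vs (\<lambda>z. dz k (g n) z + p k * c) = (\<lambda>z. iter_deriv vs (F k) z -
        iter_deriv vs (disc_mean e (real (Suc n)) (F k)) z + iter_deriv vs (mean (F k)) z)"
      unfolding eq by (simp add: iter_deriv_plus iter_deriv_diff smooth_diff smooth_disc smooth_torus_mean sF)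
    then show ?case using elim by (simp add: norm_minus_commute)
  qed
  moreover have "g n \<in> smooth_on \<Lambda>" for n
    unfolding g_def by (intro smooth_on_plus smooth_on_disc Fe g0)
  ultimately show ?thesis by (intro exI[of _ g] exI[of _ "\<lambda>k. p k * c"]) blast
qed

end

section \<open>Contractions of (1,1)-forms and their means\<close>

text \<open>The form with coefficients \<open>F\<close>, evaluated on \<open>v\<close> and the
  conjugate of \<open>w\<close>.\<close>

definition contr :: "complex^2 \<Rightarrow> complex^2 \<Rightarrow> (2 \<Rightarrow> 2 \<Rightarrow> complex^2 \<Rightarrow> complex) \<Rightarrow> complex^2 \<Rightarrow> complex" where
  "contr v w F = (\<lambda>z. v $ 1 * (cnj (w $ 1) * F 1 1 z + cnj (w $ 2) * F 1 2 z) +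
     v $ 2 * (cnj (w $ 1) * F 2 1 z + cnj (w $ 2) * F 2 2 z))"

lemma contr_smooth_on: "(\<And>i j. F i j \<in> smooth_on \<Lambda>) \<Longrightarrow> contr v w F \<in> smooth_on \<Lambda>"
  unfolding contr_def by (intro smooth_on_intros)

lemma wirt_wirtbar_coords:
  fixes f :: "complex^2 \<Rightarrow> complex"
  assumes "smooth f"
  shows "wirt v (wirtbar w f) z = v $ 1 * (cnj (w $ 1) * dz 1 (dzbar 1 f) z + cnj (w $ 2) * dz 1 (dzbar 2 f) z) +
     v $ 2 * (cnj (w $ 1) * dz 2 (dzbar 1 f) z + cnj (w $ 2) * dz 2 (dzbar 2 f) z)"
proof -
  have w: "wirtbar w f = (\<lambda>z. cnj (w $ 1) * dzbar 1 f z + cnj (w $ 2) * dzbar 2 f z)"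
    by (rule ext) (simp add: wirt_coords[OF assms] sum_2)
  have "wirt v (wirtbar w f) z = v $ 1 * dz 1 (wirtbar w f) z + v $ 2 * dz 2 (wirtbar w f) z"
    by (simp add: wirt_coords(1)[OF smooth_wirtbar[OF assms]] sum_2)
  then show ?thesis unfolding w unfolding dz_eq_wirt dzbar_eq_wirtbar by (simp add: wirt_simps assms)
qed

lemma wirt_wirtbar_contr:
  assumes F: "\<And>i j. smooth (F i j)"
  shows "wirt v (wirtbar w (contr a b F)) z =
    a $ 1 * (cnj (b $ 1) * wirt v (wirtbar w (F 1 1)) z + cnj (b $ 2) * wirt v (wirtbar w (F 1 2)) z) +
    a $ 2 * (cnj (b $ 1) * wirt v (wirtbar w (F 2 1)) z + cnj (b $ 2) * wirt v (wirtbar w (F 2 2)) z)"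
  by (simp add: contr_def wirt_simps F)

text \<open>\<open>eq\<close> says that the single coefficient of a (2,2)-form vanishes. Evaluated
  on \<open>a\<close>, \<open>v\<close> and the conjugates of \<open>b\<close>, \<open>w\<close>,
  that form is an alternating sum of four second derivatives of contractions, solved here for one of
  them.\<close>

lemma ddbar_contr:
  assumes F: "\<And>i j. smooth (F i j)"
    and eq: "dz 1 (dzbar 1 (F 2 2)) z - dz 1 (dzbar 2 (F 2 1)) z - dz 2 (dzbar 1 (F 1 2)) z + dz 2 (dzbar 2 (F 1 1)) z = 0"
  shows "wirt a (wirtbar b (contr v w F)) z = wirt v (wirtbar b (contr a w F)) z + wirt a (wirtbar w (contr v b F)) z
    - wirt v (wirtbar w (contr a b F)) z"
  unfolding wirt_wirtbar_contr[OF F] wirt_wirtbar_coords[OF F] using eq by algebra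

lemma contr_axis: "contr (axis i 1) (axis j 1) F = F i j"
  using exhaust_2[of i] exhaust_2[of j] by (auto simp: contr_def axis_def fun_eq_iff)

context toroidal_frame
begin

lemma mean_wirt_e: "f \<in> smooth_on \<Lambda> \<Longrightarrow> mean (wirt e f) = (\<lambda>z. 0)"
  and mean_wirtbar_e: "f \<in> smooth_on \<Lambda> \<Longrightarrow> mean (wirtbar e f) = (\<lambda>z. 0)"
  by (simp_all add: fun_eq_iff torus_mean_wirt torus_mean_wirtbar smooth_onD(1) wirt_e_mean wirtbar_e_mean)

text \<open>Take \<open>a = b = u\<close> and \<open>v = w = e\<close> in
  \<open>ddbar_contr\<close>: each term on the right contains a derivative along \<open>e\<close>,
  and its torus mean is 0. So the mean of the contraction has vanishing second derivative in the
  height.\<close>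

lemma mean_contr_affine:
  assumes F: "\<And>i j. F i j \<in> smooth_on \<Lambda>"
    and eq: "\<And>z. dz 1 (dzbar 1 (F 2 2)) z - dz 1 (dzbar 2 (F 2 1)) z - dz 2 (dzbar 1 (F 1 2)) z + dz 2 (dzbar 2 (F 1 1)) z = 0"
  shows "\<exists>a b. mean (contr e e F) = (\<lambda>z. a + b * ht z)"
proof -
  note sF = smooth_onD(1)[OF F]
  define S where "S = contr e e F"
  have cs: "contr v w F \<in> smooth_on \<Lambda>" for v w by (rule contr_smooth_on[OF F])
  have S: "S \<in> smooth_on \<Lambda>" unfolding S_def by (rule cs)
  note sS = smooth_onD(1)[OF S] and sc = smooth_onD(1)[OF cs]
  have "wirt u (wirtbar u S) = (\<lambda>z. wirt e (wirtbar u (contr u e F)) z + wirt u (wirtbar e (contr e u F)) z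
      - wirt e (wirtbar e (contr u u F)) z)"
    unfolding S_def by (rule ext) (rule ddbar_contr[OF sF eq])
  then have "mean (wirt u (wirtbar u S)) = (\<lambda>z. mean (wirt e (wirtbar u (contr u e F))) z +
      mean (wirt u (wirtbar e (contr e u F))) z - mean (wirt e (wirtbar e (contr u u F))) z)"
    by (simp add: torus_mean_plus torus_mean_diff wirt_simps sc)
  also have "\<dots> = (\<lambda>z. 0)"
    by (simp add: wirt_commutes(2)[of "contr e u F" u e] mean_wirt_e mean_wirtbar_e smooth_on_wirt smooth_on_wirtbar cs sc)
  finally have 1: "mean (wirt u (wirtbar u S)) = (\<lambda>z. 0)" .
  let ?m' = "dir_deriv (\<i> *s u) (mean S)"
  have m': "?m' = mean (dir_deriv (\<i> *s u) S)" by (rule torus_mean_dir_deriv[OF sS, symmetric])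
  have "dir_deriv (\<i> *s u) ?m' z = 0" for z
  proof -
    have "wirtbar u (mean S) = (\<lambda>z. \<i> / 2 * ?m' z)"
      by (rule ext) (rule wirtbar_u_mean[OF S])
    then have "mean (wirtbar u S) = (\<lambda>z. \<i> / 2 * ?m' z)" by (simp add: torus_mean_wirtbar sS)
    moreover have "- (\<i> / 2) * dir_deriv (\<i> *s u) (mean (wirtbar u S)) z = 0"
      using wirt_u_mean[OF smooth_on_wirtbar[OF S], of u z] 1 by (simp add: torus_mean_wirt smooth_wirtbar sS)
    moreover have sm: "smooth ?m'" by (intro smooth_dir_deriv smooth_torus_mean sS)
    ultimately have "- (\<i> / 2) * (\<i> / 2 * dir_deriv (\<i> *s u) ?m' z) = 0"
      by (simp only: dir_deriv_smooth_cmult[OF sm])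
    then show ?thesis by simp
  qed
  moreover have "dir_deriv v ?m' z = 0" if "Im (L v) = 0" for v z
    unfolding m' by (rule dir_deriv_mean[OF smooth_on_dir_deriv[OF S] that])
  ultimately obtain b where b: "?m' = (\<lambda>z. b)"
    using invariant_affine[of ?m' 0] smooth_on_dir_deriv[OF smooth_on_torus_mean[OF S]] by auto
  have "\<exists>a. mean S = (\<lambda>z. a + b * ht z)"
    by (rule invariant_affine[OF smooth_on_torus_mean[OF S] dir_deriv_mean[OF S]]) (simp_all add: b)
  then show ?thesis unfolding S_def by blast
qed

lemma contr_frame:
  "F i j z = p i * (cnj (p j) * contr e e F z + cnj (q j) * contr e u F z) +
     q i * (cnj (p j) * contr u e F z + cnj (q j) * contr u u F z)"
proof -
  have r: "cnj (p j) * (cnj (e $ 1) * y 1 + cnj (e $ 2) * y 2) + cnj (q j) * (cnj (u $ 1) * y 1 + cnj (u $ 2) * y 2) = y j" for y :: "2 \<Rightarrow> complex"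
    using arg_cong[OF frame_decomp[of j "\<lambda>k. cnj (y k)"], of cnj] by simp
  have "F i j z = p i * (e $ 1 * F 1 j z + e $ 2 * F 2 j z) + q i * (u $ 1 * F 1 j z + u $ 2 * F 2 j z)"
    using frame_decomp[of i "\<lambda>k. F k j z"] by simp
  also have "\<dots> = p i * (cnj (p j) * contr e e F z + cnj (q j) * contr e u F z) +
     q i * (cnj (p j) * contr u e F z + cnj (q j) * contr u u F z)"
    unfolding contr_def r[of "\<lambda>k. F 1 k z", symmetric] r[of "\<lambda>k. F 2 k z", symmetric] by (simp add: algebra_simps)
  finally show ?thesis .
qed

text \<open>With \<open>a = b = e\<close>, \<open>ddbar_contr\<close> writes the double derivative
  of \<open>F i j\<close> along \<open>e\<close> as a \<open>dz i\<close> term and two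
  \<open>dzbar j\<close> terms. Two disc potentials recover \<open>F i j\<close> from it up to disc
  means, hence in the limit up to its torus mean. There \<open>Z\<close> removes the (e,e) part, and
  the other parts are integrated along \<open>u\<close>.\<close>

lemma closed_11form_approx:
  fixes F :: "2 \<Rightarrow> 2 \<Rightarrow> complex^2 \<Rightarrow> complex"
  assumes F: "\<And>i j. F i j \<in> smooth_on \<Lambda>"
    and eq: "\<And>z. dz 1 (dzbar 1 (F 2 2)) z - dz 1 (dzbar 2 (F 2 1)) z - dz 2 (dzbar 1 (F 1 2)) z + dz 2 (dzbar 2 (F 1 1)) z = 0"
    and Z: "\<And>z. mean (contr e e F) z = 0"
  shows "\<exists>\<alpha> \<beta>. (\<forall>n j. \<alpha> n j \<in> smooth_on \<Lambda>) \<and> (\<forall>n i. \<beta> n i \<in> smooth_on \<Lambda>) \<and>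
    (\<forall>i j vs T r. r > 0 \<longrightarrow> (\<forall>\<^sub>F n::nat in sequentially. \<forall>z. \<bar>Im (L z)\<bar> \<le> T \<longrightarrow>
      cmod (iter_deriv vs (\<lambda>z. dz i (\<alpha> n j) z - dzbar j (\<beta> n i) z) z - iter_deriv vs (F i j) z) \<le> r))"
proof -
  note sF = smooth_onD(1)[OF F]
  have cs: "contr v w F \<in> smooth_on \<Lambda>" for v w by (rule contr_smooth_on[OF F])
  note sc = smooth_onD(1)[OF cs]
  obtain g1 where g1: "g1 \<in> smooth_on \<Lambda>" "\<And>k z. dzbar k g1 z = cnj (q k) * mean (contr e u F) z"
    using ex_wirt_mean(2)[OF cs] by blast
  obtain g2 where g2: "g2 \<in> smooth_on \<Lambda>" "\<And>k z. dz k g2 z = q k * mean (contr u e F) z"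
    using ex_wirt_mean(1)[OF cs] by blast
  obtain g3 where g3: "g3 \<in> smooth_on \<Lambda>" "\<And>k z. dz k g3 z = q k * mean (contr u u F) z"
    using ex_wirt_mean(1)[OF cs] by blast
  note sg = smooth_onD(1)[OF g1(1)] smooth_onD(1)[OF g2(1)] smooth_onD(1)[OF g3(1)]
  let ?N = "\<lambda>n. disc_pot2 e (real (Suc n))" and ?A = "\<lambda>n. disc_mean e (real (Suc n))"
  \<comment> \<open>The (u,e) and (u,u) parts of the mean are integrated by \<open>dz\<close>. The
    (e,u) part has no \<open>u\<close> in its first slot, so its primitive \<open>g1\<close> goes
    into \<open>\<beta>\<close>.\<close>
  define \<alpha> where "\<alpha> n j = (\<lambda>z. ?N n (wirtbar e (contr e (axis j 1) F)) z + (cnj (p j) * g2 z + cnj (q j) * g3 z))" for n j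
  \<comment> \<open>The overall sign reflects that \<open>delbar\<close> of a (1,0)-form has the
    coefficients \<open>- dzbar j\<close>.\<close>
  define \<beta> where "\<beta> n i = (\<lambda>z. - (?N n (\<lambda>z. wirt e (contr (axis i 1) e F) z - dz i (contr e e F) z) z + p i * g1 z))" for n i
  have mF: "mean (F i j) z = p i * (cnj (q j) * mean (contr e u F) z) +
     q i * (cnj (p j) * mean (contr u e F) z + cnj (q j) * mean (contr u u F) z)" for i j z
  proof -
    have "F i j = (\<lambda>z. p i * (cnj (p j) * contr e e F z + cnj (q j) * contr e u F z) +
     q i * (cnj (p j) * contr u e F z + cnj (q j) * contr u u F z))" by (rule ext) (rule contr_frame)
    then show ?thesis by (simp add: torus_mean_plus torus_mean_cmult smooth_intros sc Z)
  qed
  have eq_AB: "(\<lambda>z. dz i (\<alpha> n j) z - dzbar j (\<beta> n i) z) =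
      (\<lambda>z. F i j z - 2 * ?A n (F i j) z + ?A n (?A n (F i j)) z + mean (F i j) z)" for n i j
  proof
    fix z
    have "?N n (wirt e (wirtbar e (F i j))) z = ?N n (\<lambda>z. wirt (axis i 1) (wirtbar e (contr e (axis j 1) F)) z +
        (wirt e (wirtbar (axis j 1) (contr (axis i 1) e F)) z - wirt (axis i 1) (wirtbar (axis j 1) (contr e e F)) z)) z"
    proof -
      have "wirt e (wirtbar e (F i j)) = (\<lambda>z. wirt (axis i 1) (wirtbar e (contr e (axis j 1) F)) z +
        (wirt e (wirtbar (axis j 1) (contr (axis i 1) e F)) z - wirt (axis i 1) (wirtbar (axis j 1) (contr e e F)) z))"
        using ddbar_contr[OF sF eq, of e e "axis i 1" "axis j 1"] by (simp add: contr_axis fun_eq_iff)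
      then show ?thesis by simp
    qed
    also have "\<dots> = ?N n (wirt (axis i 1) (wirtbar e (contr e (axis j 1) F))) z +
        ?N n (\<lambda>z. wirtbar (axis j 1) (wirt e (contr (axis i 1) e F)) z - wirtbar (axis j 1) (wirt (axis i 1) (contr e e F)) z) z"
      by (simp add: disc_pot2_simps wirt_simps sc wirt_commutes(2)[OF sc])
    also have "\<dots> = wirt (axis i 1) (?N n (wirtbar e (contr e (axis j 1) F))) z +
        wirtbar (axis j 1) (?N n (\<lambda>z. wirt e (contr (axis i 1) e F) z - wirt (axis i 1) (contr e e F) z)) z"
      by (simp add: disc_pot2_simps(3,4) wirt_simps sc)
    finally have "wirt (axis i 1) (?N n (wirtbar e (contr e (axis j 1) F))) z +
        wirtbar (axis j 1) (?N n (\<lambda>z. wirt e (contr (axis i 1) e F) z - wirt (axis i 1) (contr e e F) z)) z =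
        F i j z - 2 * ?A n (F i j) z + ?A n (?A n (F i j)) z"
      by (simp add: disc_pot2_wirt sF)
    moreover have "wirt (axis i 1) (\<lambda>z. cnj (p j) * g2 z + cnj (q j) * g3 z) z + wirtbar (axis j 1) (\<lambda>z. p i * g1 z) z = mean (F i j) z"
      using g1(2)[of j z] g2(2)[of i z] g3(2)[of i z] unfolding mF dz_eq_wirt dzbar_eq_wirtbar
      by (simp add: wirt_simps sg) (simp add: algebra_simps)
    moreover have "dz i (\<alpha> n j) z = wirt (axis i 1) (?N n (wirtbar e (contr e (axis j 1) F))) z +
        wirt (axis i 1) (\<lambda>z. cnj (p j) * g2 z + cnj (q j) * g3 z) z"
      unfolding \<alpha>_def dz_eq_wirt by (simp add: wirt_plus smooth_intros disc_pot2_simps(1) smooth_wirtbar sc sg)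
    moreover have "dzbar j (\<beta> n i) z = - (wirtbar (axis j 1) (?N n (\<lambda>z. wirt e (contr (axis i 1) e F) z - wirt (axis i 1) (contr e e F) z)) z +
        wirtbar (axis j 1) (\<lambda>z. p i * g1 z) z)"
      unfolding \<beta>_def dz_eq_wirt dzbar_eq_wirtbar
      by (subst wirtbar_minus) (simp_all add: wirtbar_plus smooth_intros disc_pot2_simps(1) smooth_wirt sc sg)
    ultimately show "dz i (\<alpha> n j) z - dzbar j (\<beta> n i) z =
      F i j z - 2 * ?A n (F i j) z + ?A n (?A n (F i j)) z + mean (F i j) z"
      by algebra
  qed
  have "\<forall>\<^sub>F n::nat in sequentially. \<forall>z. \<bar>Im (L z)\<bar> \<le> T \<longrightarrow>
      cmod (iter_deriv vs (\<lambda>z. dz i (\<alpha> n j) z - dzbar j (\<beta> n i) z) z - iter_deriv vs (F i j) z) \<le> r" if "r > 0" for i j vs T r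
  proof -
    \<comment> \<open>The error is (A^2 f - M) - 2 (A f - M), at most three times the bound for one
      disc mean.\<close>
    have r3: "r / 3 > 0" using that by simp
    show ?thesis using disc_mean_approx[OF F[of i j] r3, of T vs]
    proof eventually_elim
      case (elim n)
      have id: "iter_deriv vs (\<lambda>z. dz i (\<alpha> n j) z - dzbar j (\<beta> n i) z) = (\<lambda>z. iter_deriv vs (F i j) z -
        2 * iter_deriv vs (?A n (F i j)) z + iter_deriv vs (?A n (?A n (F i j))) z + iter_deriv vs (mean (F i j)) z)"
        unfolding eq_AB by (simp add: iter_deriv_plus iter_deriv_diff iter_deriv_cmult smooth_intros smooth_disc smooth_torus_mean sF)
      show ?case
      proof (intro allI impI)
        fix z assume z: "\<bar>Im (L z)\<bar> \<le> T"
        let ?M = "iter_deriv vs (mean (F i j)) z" and ?A1 = "iter_deriv vs (?A n (F i j)) z"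
          and ?A2 = "iter_deriv vs (?A n (?A n (F i j))) z"
        have "cmod (?A1 - ?M) \<le> r / 3" "cmod (?A2 - ?M) \<le> r / 3" using elim z by blast+
        moreover have "iter_deriv vs (\<lambda>z. dz i (\<alpha> n j) z - dzbar j (\<beta> n i) z) z - iter_deriv vs (F i j) z =
            (?A2 - ?M) - 2 * (?A1 - ?M)" unfolding id by (simp add: algebra_simps)
        moreover have "cmod ((?A2 - ?M) - 2 * (?A1 - ?M)) \<le> cmod (?A2 - ?M) + 2 * cmod (?A1 - ?M)"
          using norm_triangle_ineq4[of "?A2 - ?M" "2 * (?A1 - ?M)"] by (simp only: norm_mult norm_numeral)
        ultimately show "cmod (iter_deriv vs (\<lambda>z. dz i (\<alpha> n j) z - dzbar j (\<beta> n i) z) z - iter_deriv vs (F i j) z) \<le> r"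
          by simp
      qed
    qed
  qed
  moreover have "\<alpha> n j \<in> smooth_on \<Lambda>" "\<beta> n i \<in> smooth_on \<Lambda>" for n i j
    unfolding \<alpha>_def \<beta>_def dz_eq_wirt by (intro smooth_on_intros disc_pot2_simps(2) cs g1 g2 g3)+
  ultimately show ?thesis by (intro exI[of _ \<alpha>] exI[of _ \<beta>]) blast
qed

text \<open>Contracting an exact form with \<open>e\<close> in both slots leaves only derivatives
  along \<open>e\<close>, whose torus means vanish. The mean of this contraction is therefore an
  invariant of the class.\<close>

lemma mean_contr_exact:
  assumes a: "\<And>j. a j \<in> smooth_on \<Lambda>" and b: "\<And>i. b i \<in> smooth_on \<Lambda>"
  shows "mean (contr e e (\<lambda>i j z. dz i (a j) z - dzbar j (b i) z)) z = 0"
proof -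
  note s = smooth_onD(1)[OF a] smooth_onD(1)[OF b]
  define A where "A = (\<lambda>z. cnj (e $ 1) * a 1 z + cnj (e $ 2) * a 2 z)"
  define B where "B = (\<lambda>z. e $ 1 * b 1 z + e $ 2 * b 2 z)"
  have AB: "A \<in> smooth_on \<Lambda>" "B \<in> smooth_on \<Lambda>" unfolding A_def B_def by (intro smooth_on_intros a b)+
  note sAB = smooth_onD(1)[OF AB(1)] smooth_onD(1)[OF AB(2)]
  have "contr e e (\<lambda>i j z. dz i (a j) z - dzbar j (b i) z) = (\<lambda>z. wirt e A z - wirtbar e B z)"
    unfolding wirt_frame_coords(1)[OF sAB(1)] wirt_frame_coords(2)[OF sAB(2)]
    unfolding contr_def A_def B_def dz_eq_wirt dzbar_eq_wirtbar
    by (simp add: wirt_simps s fun_eq_iff) (simp add: algebra_simps)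
  then show ?thesis
    by (simp add: torus_mean_diff torus_mean_wirt torus_mean_wirtbar smooth_wirt smooth_wirtbar sAB
      wirt_e_mean wirtbar_e_mean AB)
qed

end

subsection \<open>Dimensions of quotients\<close>

text \<open>A basis element would itself lie in \<open>W\<close>, and the coefficients supported on
  it contradict independence. Hence every basis is empty, whichever one the choice operator
  selects.\<close>

lemma quotient_dim_eq_0:
  assumes vs: "vector_space sc" and "V \<subseteq> W" shows "quotient_dim sc V W = 0"
proof -
  interpret vector_space sc by (rule vs)
  have ex: "finite_quotient_basis sc V W {}"
    using assms by (auto simp: finite_quotient_basis_def)
  have "B = {}" if B: "finite_quotient_basis sc V W B" for B
  proof (rule ccontr)
    assume "B \<noteq> {}"
    then obtain b where b: "b \<in> B" by blast
    have fin: "finite B" and BV: "B \<subseteq> V" using B by (auto simp: finite_quotient_basis_def)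
    have "(\<Sum>x\<in>B. sc (if x = b then 1 else 0) x) = (\<Sum>x\<in>B. if x = b then b else 0)"
      by (intro sum.cong) auto
    also have "\<dots> = b" using fin b by simp
    finally have inW: "(\<Sum>x\<in>B. sc (if x = b then 1 else 0) x) \<in> W" using b BV assms(2) by auto
    have ind: "\<And>u. (\<Sum>x\<in>B. sc (u x) x) \<in> W \<Longrightarrow> \<forall>x\<in>B. u x = 0"
      using B by (simp add: finite_quotient_basis_def)
    from ind[OF inW] show False using b by auto
  qed
  from this[OF someI[of "finite_quotient_basis sc V W", OF ex]] show ?thesis
    using ex by (auto simp: quotient_dim_def zero_enat_def)
qed

lemma quotient_dim_eq_1:
  assumes vs: "vector_space sc" and W: "module.subspace sc W" and b: "b \<in> V"
    and ind: "\<And>c. sc c b \<in> W \<Longrightarrow> c = 0" and sp: "\<And>v. v \<in> V \<Longrightarrow> \<exists>c. v - sc c b \<in> W"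
  shows "quotient_dim sc V W = 1"
proof -
  have "finite_quotient_basis sc V W {b}"
    unfolding finite_quotient_basis_def using b ind sp by (auto intro: exI[of _ "\<lambda>_. _"])
  from quotient_dim_eq_card[OF vs W this] show ?thesis by (simp add: one_enat_def)
qed

lemma quotient_dim_eq_2:
  assumes vs: "vector_space sc" and W: "module.subspace sc W" and b: "b \<in> V" "b' \<in> V"
    and ind: "\<And>c d. sc c b + sc d b' \<in> W \<Longrightarrow> c = 0 \<and> d = 0"
    and sp: "\<And>v. v \<in> V \<Longrightarrow> \<exists>c d. v - (sc c b + sc d b') \<in> W"
  shows "quotient_dim sc V W = 2"
proof -
  interpret vector_space sc by (rule vs)
  have ne: "b \<noteq> b'"
  proof
    assume "b = b'"
    then have "sc 1 b + sc (- 1) b' = 0" by simp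
    then have "sc 1 b + sc (- 1) b' \<in> W" using subspace_0[OF W] by simp
    from ind[OF this] show False by simp
  qed
  have "\<exists>u. v - (\<Sum>x\<in>{b, b'}. sc (u x) x) \<in> W" if v: "v \<in> V" for v
  proof -
    obtain c d where "v - (sc c b + sc d b') \<in> W" using sp[OF v] by blast
    then show ?thesis using ne by (intro exI[of _ "\<lambda>x. if x = b then c else d"]) simp
  qed
  then have "finite_quotient_basis sc V W {b, b'}"
    unfolding finite_quotient_basis_def using b ind ne by auto
  from quotient_dim_eq_card[OF vs W this] show ?thesis using ne by (simp add: numeral_eq_enat)
qed

subsection \<open>Forms in two variables\<close>

text \<open>In the numeral type \<open>2\<close> the literal 2 denotes 0, so index 2 precedes index
  1. The signs in \<open>del\<close> and \<open>delbar\<close> follow this order.\<close>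

lemma less_2: "(2::2) < 1" "\<not> (1::2) < 2" "(2::2) \<noteq> 1"
proof -
  have z: "(2::2) = 0" by simp
  have "(0::2) < 1" by (simp add: less_bit0_def bit0.Rep_0 bit0.Rep_1)
  then show "(2::2) < 1" "\<not> (1::2) < 2" "(2::2) \<noteq> 1" unfolding z by auto
qed

lemma UNIV_2': "(UNIV :: 2 set) = {2, 1}"
  using exhaust_2 by auto

lemma set_2_cases:
  fixes I :: "2 set"
  obtains "I = {}" | i where "I = {i}" | "I = UNIV"
proof -
  have "I = {} \<or> I = {1} \<or> I = {2} \<or> I = UNIV"
    unfolding UNIV_2' using exhaust_2 by (cases "1 \<in> I"; cases "2 \<in> I") (auto; metis)+
  then show ?thesis using that by blast
qed

lemma card_UNIV_2: "card (UNIV :: 2 set) = 2"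
  by (simp add: UNIV_2' less_2(3))

lemma UNIV_2_diff: "UNIV - {1 :: 2} = {2}" "UNIV - {2 :: 2} = {1}"
  unfolding UNIV_2' using less_2(3) by auto

lemma card_less_2: "card {i. i < (1::2)} = 1" "card {i. i < (2::2)} = 0"
proof -
  have "{i. i < (1::2)} = {2}" "{i. i < (2::2)} = {}"
    using less_2 exhaust_2 by (auto, metis order_less_irrefl, metis order_less_irrefl)
  then show "card {i. i < (1::2)} = 1" "card {i. i < (2::2)} = 0" by simp_all
qed

lemma del_simps:
  fixes \<phi> :: "2 form"
  shows "del \<phi> {} J = (\<lambda>z. 0)" "del \<phi> {i} J = dz i (\<phi> {} J)"
    "del \<phi> UNIV J = (\<lambda>z. dz 2 (\<phi> {1} J) z - dz 1 (\<phi> {2} J) z)"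
  unfolding del_def
  by (simp_all add: fun_eq_iff Collect_conv_if card_less_2)
    (simp add: UNIV_2' UNIV_2_diff[unfolded UNIV_2'] card_less_2 less_2)

lemma delbar_simps:
  fixes \<phi> :: "2 form"
  shows "delbar \<phi> I {} = (\<lambda>z. 0)" "delbar \<phi> I {j} = (\<lambda>z. (-1) ^ card I * dzbar j (\<phi> I {}) z)"
    "delbar \<phi> I UNIV = (\<lambda>z. (-1) ^ card I * (dzbar 2 (\<phi> I {1}) z - dzbar 1 (\<phi> I {2}) z))"
  unfolding delbar_def
  by (simp_all add: fun_eq_iff Collect_conv_if card_less_2)
    (simp add: UNIV_2' UNIV_2_diff[unfolded UNIV_2'] card_less_2 less_2 power_add algebra_simps)

lemma formsI:
  assumes "\<And>I J. card I = r \<Longrightarrow> card J = s \<Longrightarrow> \<phi> I J \<in> smooth_on \<Lambda>"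
    and "\<And>I J. (card I, card J) \<noteq> (r, s) \<Longrightarrow> \<phi> I J = (\<lambda>z. 0)"
  shows "\<phi> \<in> forms \<Lambda> r s"
proof -
  have "\<phi> I J \<in> smooth_on \<Lambda>" for I J
    using assms(1)[of I J] assms(2)[of I J] smooth_on_const[of 0 \<Lambda>]
    by (cases "(card I, card J) = (r, s)") auto
  then show ?thesis using assms(2) by (auto simp: forms_def smooth_on_def zero_fun_def)
qed

lemma formsD:
  assumes "\<phi> \<in> forms \<Lambda> r s"
  shows "\<phi> I J \<in> smooth_on \<Lambda>" "(card I, card J) \<noteq> (r, s) \<Longrightarrow> \<phi> I J = (\<lambda>z. 0)"
  using assms by (auto simp: forms_def smooth_on_def zero_fun_def)

lemma form_eqI:
  assumes "\<phi> \<in> forms \<Lambda> r s" "\<psi> \<in> forms \<Lambda> r s"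
    and "\<And>I J. card I = r \<Longrightarrow> card J = s \<Longrightarrow> \<phi> I J = \<psi> I J"
  shows "\<phi> = \<psi>"
proof (intro ext)
  fix I J z
  show "\<phi> I J z = \<psi> I J z"
    using assms(3)[of I J] formsD(2)[OF assms(1), of I J] formsD(2)[OF assms(2), of I J]
    by (cases "(card I, card J) = (r, s)") auto
qed

lemma subspace_forms: "form.subspace (forms \<Lambda> r s)"
  unfolding form.subspace_def
  by (auto intro!: formsI smooth_on_plus smooth_on_cmult smooth_on_const
      simp: form_scale_def zero_fun_def plus_fun_def formsD)

definition mkform :: "nat \<Rightarrow> nat \<Rightarrow> (2 set \<Rightarrow> 2 set \<Rightarrow> complex^2 \<Rightarrow> complex) \<Rightarrow> 2 form" where
  "mkform r s F = (\<lambda>I J. if card I = r \<and> card J = s then F I J else (\<lambda>z. 0))"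

lemma mkform_forms: "(\<And>I J. F I J \<in> smooth_on \<Lambda>) \<Longrightarrow> mkform r s F \<in> forms \<Lambda> r s"
  by (rule formsI) (auto simp: mkform_def)

lemma dz_smooth_on: "f \<in> smooth_on \<Lambda> \<Longrightarrow> dz k f \<in> smooth_on \<Lambda>"
  and dzbar_smooth_on: "f \<in> smooth_on \<Lambda> \<Longrightarrow> dzbar k f \<in> smooth_on \<Lambda>"
  by (simp_all add: dz_eq_wirt dzbar_eq_wirtbar smooth_on_wirt smooth_on_wirtbar)

lemma dz_const [simp]: "dz k (\<lambda>z. c) = (\<lambda>z. 0)" and dzbar_const [simp]: "dzbar k (\<lambda>z. c) = (\<lambda>z. 0)"
  by (simp_all add: dz_eq_wirt dzbar_eq_wirtbar)

lemma del_forms: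
  fixes \<phi> :: "2 form"
  assumes "\<phi> \<in> forms \<Lambda> r s" shows "del \<phi> \<in> forms \<Lambda> (Suc r) s"
proof (rule formsI)
  fix I J :: "2 set"
  show "del \<phi> I J \<in> smooth_on \<Lambda>"
    by (cases I rule: set_2_cases)
      (simp_all add: del_simps smooth_on_const dz_smooth_on smooth_on_diff formsD[OF assms])
  assume "(card I, card J) \<noteq> (Suc r, s)"
  then show "del \<phi> I J = (\<lambda>z. 0)"
    by (cases I rule: set_2_cases) (auto simp: del_simps formsD(2)[OF assms] card_UNIV_2)
qed

lemma delbar_forms:
  fixes \<phi> :: "2 form"
  assumes "\<phi> \<in> forms \<Lambda> r s" shows "delbar \<phi> \<in> forms \<Lambda> r (Suc s)"
proof (rule formsI)
  fix I J :: "2 set"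
  show "delbar \<phi> I J \<in> smooth_on \<Lambda>"
    by (cases J rule: set_2_cases)
      (simp_all add: delbar_simps smooth_on_const dzbar_smooth_on smooth_on_cmult smooth_on_diff formsD[OF assms])
  assume "(card I, card J) \<noteq> (r, Suc s)"
  then show "delbar \<phi> I J = (\<lambda>z. 0)"
    by (cases J rule: set_2_cases) (auto simp: delbar_simps formsD(2)[OF assms] card_UNIV_2)
qed

lemma zero_in_forms: "0 \<in> forms \<Lambda> r s"
  using form.subspace_0[OF subspace_forms] .

lemma aeppli_numI:
  fixes \<phi> :: "2 form"
  assumes "\<phi> \<in> forms \<Lambda> r s"
    and "\<And>I J. card I = Suc r \<Longrightarrow> card J = Suc s \<Longrightarrow> del (delbar \<phi>) I J = (\<lambda>z. 0)"
  shows "\<phi> \<in> aeppli_num \<Lambda> r s"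
proof -
  have "del (delbar \<phi>) = 0"
    using assms(2) by (intro form_eqI[OF del_forms[OF delbar_forms[OF assms(1)]] zero_in_forms]) (simp add: zero_fun_def)
  then show ?thesis using assms(1) by (simp add: aeppli_num_def)
qed

lemma aeppli_numD:
  assumes "\<phi> \<in> aeppli_num \<Lambda> r s"
  shows "\<phi> \<in> forms \<Lambda> r s" "del (delbar \<phi>) I J z = 0"
  using assms by (auto simp: aeppli_num_def zero_fun_def)

subsection \<open>The topology on forms\<close>

lemma topspace_forms_top: "topspace (forms_top \<Lambda> r s) = forms \<Lambda> r s"
proof -
  let ?B = "{forms_ball \<Lambda> r s K vs e \<phi> |K vs e \<phi>. compact K \<and> 0 < e \<and> \<phi> \<in> forms \<Lambda> r s}"
  have "\<phi> \<in> \<Union> ?B" if "\<phi> \<in> forms \<Lambda> r s" for \<phi>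
  proof (rule UnionI)
    show "forms_ball \<Lambda> r s {} [] 1 \<phi> \<in> ?B"
      by (intro CollectI exI[of _ "{}"] exI[of _ "[]"] exI[of _ 1] exI[of _ \<phi>]) (simp add: that)
    show "\<phi> \<in> forms_ball \<Lambda> r s {} [] 1 \<phi>" using that by (simp add: forms_ball_def)
  qed
  moreover have "\<Union> ?B \<subseteq> forms \<Lambda> r s" by (auto simp: forms_ball_def)
  ultimately show ?thesis unfolding forms_top_def topology_generated_by_topspace by blast
qed

lemma forms_ball_open:
  assumes "compact K" "0 < e" "\<phi> \<in> forms \<Lambda> r s" shows "openin (forms_top \<Lambda> r s) (forms_ball \<Lambda> r s K vs e \<phi>)"
  unfolding forms_top_def using assms by (intro topology_generated_by_Basis) blast

text \<open>The balls form only a subbasis, so approximating several derivatives at once takes a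
  finite intersection of them.\<close>

lemma closure_approximable:
  assumes \<phi>: "\<phi> \<in> subtopology (forms_top \<Lambda> r s) V closure_of S" and V: "V \<subseteq> forms \<Lambda> r s"
    and K: "compact K" and e: "e > 0" and fin: "finite Vs"
  shows "\<exists>\<psi>\<in>S. \<psi> \<in> forms \<Lambda> r s \<and> (\<forall>vs\<in>Vs. \<forall>I J. \<forall>z\<in>K.
    cmod (iter_deriv vs (\<psi> I J) z - iter_deriv vs (\<phi> I J) z) < e)"
proof -
  have \<phi>V: "\<phi> \<in> V" using \<phi> by (auto simp: in_closure_of)
  then have \<phi>f: "\<phi> \<in> forms \<Lambda> r s" using V by blast
  let ?U = "(\<Inter>vs\<in>Vs. forms_ball \<Lambda> r s K vs e \<phi>) \<inter> topspace (forms_top \<Lambda> r s)"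
  have "openin (forms_top \<Lambda> r s) ?U"
    using fin forms_ball_open[OF K e \<phi>f] by (intro openin_INT) auto
  then have "openin (subtopology (forms_top \<Lambda> r s) V) (?U \<inter> V)" by (auto simp: openin_subtopology)
  moreover have "\<phi> \<in> ?U \<inter> V" using \<phi>V \<phi>f e by (auto simp: forms_ball_def topspace_forms_top)
  ultimately obtain \<psi> where "\<psi> \<in> S" "\<psi> \<in> ?U \<inter> V" using \<phi> by (meson in_closure_of)
  then show ?thesis by (intro bexI[of _ \<psi>]) (auto simp: forms_ball_def topspace_forms_top)
qed

text \<open>By induction over the generation of the topology, the sequence eventually enters each
  open set around \<open>\<phi>\<close>. A generating ball may be centred at another form; the
  distance of \<open>\<phi>\<close> to the centre attains its maximum on \<open>K\<close>, and what
  is left below the radius is the slack used.\<close>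

lemma closure_ofI:
  fixes \<phi> :: "('n::{finite,linorder}) form"
  assumes \<phi>: "\<phi> \<in> V" and S: "\<And>n. \<psi> n \<in> S" "\<And>n. \<psi> n \<in> V" and V: "V \<subseteq> forms \<Lambda> r s"
    and lim: "\<And>I J vs K d. compact K \<Longrightarrow> d > 0 \<Longrightarrow>
      \<forall>\<^sub>F n::nat in sequentially. \<forall>z\<in>K. cmod (iter_deriv vs (\<psi> n I J) z - iter_deriv vs (\<phi> I J) z) \<le> d"
  shows "\<phi> \<in> subtopology (forms_top \<Lambda> r s) V closure_of S"
proof -
  have ev: "\<forall>\<^sub>F n in sequentially. \<psi> n \<in> U" if U: "openin (forms_top \<Lambda> r s) U" "\<phi> \<in> U" for U
  proof -
    have "generate_topology_on {forms_ball \<Lambda> r s K vs e \<phi> |K vs e \<phi>. compact K \<and> 0 < e \<and> \<phi> \<in> forms \<Lambda> r s} U"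
      using U(1) unfolding forms_top_def by (simp add: openin_topology_generated_by_iff)
    then have "\<phi> \<in> U \<longrightarrow> (\<forall>\<^sub>F n in sequentially. \<psi> n \<in> U)"
    proof induction
      case (Int a b)
      then show ?case by (auto intro: eventually_conj)
    next
      case (UN K)
      show ?case
      proof
        assume "\<phi> \<in> \<Union> K"
        then obtain X where X: "X \<in> K" "\<phi> \<in> X" by blast
        then have "\<forall>\<^sub>F n in sequentially. \<psi> n \<in> X" using UN.IH by blast
        then show "\<forall>\<^sub>F n in sequentially. \<psi> n \<in> \<Union> K" by (rule eventually_mono) (use X in blast)
      qed
    next
      case (Basis U)
      then obtain K vs e \<phi>0 where U: "U = forms_ball \<Lambda> r s K vs e \<phi>0" and K: "compact K" "0 < e" "\<phi>0 \<in> forms \<Lambda> r s"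
        by blast
      show ?case
      proof
        assume \<phi>U: "\<phi> \<in> U"
        then have \<phi>f: "\<phi> \<in> forms \<Lambda> r s" using U by (simp add: forms_ball_def)
        have "\<forall>\<^sub>F n in sequentially. \<forall>z\<in>K. cmod (iter_deriv vs (\<psi> n I J) z - iter_deriv vs (\<phi>0 I J) z) < e" for I J
        proof (cases "K = {}")
          case False
          let ?d = "\<lambda>z. cmod (iter_deriv vs (\<phi> I J) z - iter_deriv vs (\<phi>0 I J) z)"
          have "continuous_on K ?d"
            using \<phi>f K(3) by (intro continuous_intros smooth_continuous smooth_iter_deriv) (auto simp: forms_def)
          then obtain z0 where z0: "z0 \<in> K" "\<And>z. z \<in> K \<Longrightarrow> ?d z \<le> ?d z0"
            using continuous_attains_sup[OF K(1) False] by blast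
          have "?d z0 < e" using \<phi>U z0(1) U by (simp add: forms_ball_def)
          then have "(e - ?d z0) / 2 > 0" by simp
          from lim[OF K(1) this] show ?thesis
          proof (eventually_elim, intro ballI)
            fix n z assume a: "\<forall>z\<in>K. cmod (iter_deriv vs (\<psi> n I J) z - iter_deriv vs (\<phi> I J) z) \<le> (e - ?d z0) / 2" and z: "z \<in> K"
            have "cmod (iter_deriv vs (\<psi> n I J) z - iter_deriv vs (\<phi>0 I J) z) \<le>
                cmod (iter_deriv vs (\<psi> n I J) z - iter_deriv vs (\<phi> I J) z) + ?d z"
              using norm_triangle_ineq[of "iter_deriv vs (\<psi> n I J) z - iter_deriv vs (\<phi> I J) z" "iter_deriv vs (\<phi> I J) z - iter_deriv vs (\<phi>0 I J) z"]
              by simp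
            then show "cmod (iter_deriv vs (\<psi> n I J) z - iter_deriv vs (\<phi>0 I J) z) < e"
              using a[rule_format, OF z] z0(2)[OF z] \<open>?d z0 < e\<close> by (simp add: field_simps)
          qed
        qed simp
        then have "\<forall>\<^sub>F n in sequentially. \<forall>I. \<forall>J. \<forall>z\<in>K. cmod (iter_deriv vs (\<psi> n I J) z - iter_deriv vs (\<phi>0 I J) z) < e"
          by (intro eventually_all_finite)
        then show "\<forall>\<^sub>F n in sequentially. \<psi> n \<in> U"
          by (rule eventually_mono) (use S V in \<open>auto simp: U forms_ball_def\<close>)
      qed
    qed simp
    then show ?thesis using U(2) by blast
  qed
  show ?thesis
    unfolding in_closure_of
  proof (intro conjI allI impI)
    show "\<phi> \<in> topspace (subtopology (forms_top \<Lambda> r s) V)"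
      using \<phi> V by (auto simp: topspace_forms_top)
    fix T assume T: "\<phi> \<in> T \<and> openin (subtopology (forms_top \<Lambda> r s) V) T"
    then obtain U where U: "openin (forms_top \<Lambda> r s) U" "T = U \<inter> V" by (auto simp: openin_subtopology)
    then obtain n where "\<psi> n \<in> U"
      using eventually_happens'[OF sequentially_bot ev[OF U(1)]] T by blast
    then show "\<exists>y. y \<in> S \<and> y \<in> T" using S U(2) by blast
  qed
qed

section \<open>Constant forms and coordinate derivatives\<close>

lemma iter_deriv_cnj: "smooth f \<Longrightarrow> iter_deriv vs (\<lambda>z. cnj (f z)) = (\<lambda>z. cnj (iter_deriv vs f z))"
  by (induction vs) (simp_all add: dir_deriv_cnj smooth_iter_deriv)

lemma holomorphic_const: "holomorphic (\<lambda>z. c)"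
  unfolding holomorphic_def by (intro allI exI[of _ "\<lambda>_. 0"]) auto

lemma fun_algebra_apply [simp]:
  "(\<phi> + \<psi>) I = \<phi> I + \<psi> I" "(\<phi> - \<psi>) I = \<phi> I - \<psi> I" "0 I = 0"
  for \<phi> \<psi> :: "'a \<Rightarrow> 'b::ab_group_add"
  by (simp_all add: plus_fun_def fun_diff_def zero_fun_def)

text \<open>Toroidality is applied to each coefficient; the holomorphic part of a denominator thus
  contributes only constants.\<close>

lemma holomorphic_forms_const:
  assumes "toroidal \<Lambda>" "\<omega> \<in> holomorphic_forms \<Lambda> r"
  shows "\<omega> \<in> forms \<Lambda> r 0" "\<exists>c. \<forall>I J z. \<omega> I J z = c I J"
proof -
  show f: "\<omega> \<in> forms \<Lambda> r 0" using assms(2) by (simp add: holomorphic_forms_def)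
  have "\<omega> I J constant_on UNIV" for I J
    using assms f by (auto simp: holomorphic_forms_def toroidal_def forms_def)
  then have "\<forall>I. \<forall>J. \<exists>c. \<forall>z. \<omega> I J z = c" by (auto simp: constant_on_def)
  then show "\<exists>c. \<forall>I J z. \<omega> I J z = c I J" by metis
qed

lemma antiholomorphic_forms_const:
  fixes \<Lambda> :: "(complex^2) set"
  assumes "toroidal \<Lambda>" "\<omega> \<in> antiholomorphic_forms \<Lambda> s"
  shows "\<omega> \<in> forms \<Lambda> 0 s" "\<exists>c. \<forall>I J z. \<omega> I J z = c I J"
proof -
  obtain \<eta> where \<eta>: "\<eta> \<in> holomorphic_forms \<Lambda> s" "\<omega> = conj_form \<eta>"
    using assms(2) by (auto simp: antiholomorphic_forms_def)
  note h = holomorphic_forms_const[OF assms(1) \<eta>(1)]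
  obtain c where c: "\<And>I J z. \<eta> I J z = c I J" using h(2) by blast
  show "\<exists>c. \<forall>I J z. \<omega> I J z = c I J" by (auto simp: \<eta>(2) conj_form_def c)
  show "\<omega> \<in> forms \<Lambda> 0 s"
  proof (rule formsI)
    fix I J :: "2 set"
    show "\<omega> I J \<in> smooth_on \<Lambda>"
      unfolding \<eta>(2) conj_form_def by (intro smooth_on_cmult smooth_on_cnj formsD(1)[OF h(1)])
    assume ne: "(card I, card J) \<noteq> (0, s)"
    have "\<eta> J I = (\<lambda>z. 0)" by (rule formsD(2)[OF h(1)]) (use ne in auto)
    then show "\<omega> I J = (\<lambda>z. 0)" by (simp add: \<eta>(2) conj_form_def)
  qed
qed

lemma const_holomorphic_form:
  fixes c :: "2 set \<Rightarrow> complex"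
  shows "mkform r 0 (\<lambda>I J z. c I) \<in> holomorphic_forms \<Lambda> r"
proof -
  have "mkform r 0 (\<lambda>I J z. c I) \<in> forms \<Lambda> r 0" by (rule mkform_forms[OF smooth_on_const])
  then show ?thesis by (simp add: holomorphic_forms_def) (simp add: mkform_def holomorphic_const)
qed

lemma const_antiholomorphic_form:
  fixes c :: "2 set \<Rightarrow> complex"
  shows "mkform 0 s (\<lambda>I J z. c J) \<in> antiholomorphic_forms \<Lambda> s"
proof -
  have "mkform 0 s (\<lambda>I J z. c J) = conj_form (mkform s 0 (\<lambda>I J z. cnj (c I)))"
    by (auto simp: conj_form_def mkform_def fun_eq_iff)
  then show ?thesis unfolding antiholomorphic_forms_def by (rule image_eqI[OF _ const_holomorphic_form])
qed

lemma mkform_0: "mkform r s (\<lambda>I J z. 0) = 0"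
  by (simp add: mkform_def fun_eq_iff)

lemma zero_holomorphic_form: "(0 :: 2 form) \<in> holomorphic_forms \<Lambda> r"
  and zero_antiholomorphic_form: "(0 :: 2 form) \<in> antiholomorphic_forms \<Lambda> s"
  using const_holomorphic_form[of r "\<lambda>_. 0" \<Lambda>] const_antiholomorphic_form[of s "\<lambda>_. 0" \<Lambda>]
  by (simp_all add: mkform_0)

lemma delbar_0: "delbar (0 :: 2 form) = 0" and del_0: "del (0 :: 2 form) = 0"
proof -
  have z: "dzbar k (0 :: complex^2 \<Rightarrow> complex) = (\<lambda>z. 0)" "dz k (0 :: complex^2 \<Rightarrow> complex) = (\<lambda>z. 0)" for k
    using dzbar_const[of k 0] dz_const[of k 0] by (simp_all add: zero_fun_def)
  show "delbar (0 :: 2 form) = 0" "del (0 :: 2 form) = 0"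
    by (simp_all add: delbar_def del_def fun_eq_iff z)
qed

lemma card_eq_1_2: "card (I :: 2 set) = Suc 0 \<longleftrightarrow> (\<exists>i. I = {i})"
  "card (I :: 2 set) = Suc (Suc 0) \<longleftrightarrow> I = UNIV" "card (I :: 2 set) = 0 \<longleftrightarrow> I = {}"
  using card_subset_eq[of UNIV I] by (auto simp: card_1_singleton_iff card_UNIV_2)

lemma dz_cmult: "smooth f \<Longrightarrow> dz k (\<lambda>z. c * f z) = (\<lambda>z. c * dz k f z)"
  and dzbar_cmult: "smooth f \<Longrightarrow> dzbar k (\<lambda>z. c * f z) = (\<lambda>z. c * dzbar k f z)"
  and dz_minus: "smooth f \<Longrightarrow> dz k (\<lambda>z. - f z) = (\<lambda>z. - dz k f z)"
  and dzbar_minus: "smooth f \<Longrightarrow> dzbar k (\<lambda>z. - f z) = (\<lambda>z. - dzbar k f z)"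
  and dz_diff: "smooth f \<Longrightarrow> smooth g \<Longrightarrow> dz k (\<lambda>z. f z - g z) = (\<lambda>z. dz k f z - dz k g z)"
  and dzbar_diff: "smooth f \<Longrightarrow> smooth g \<Longrightarrow> dzbar k (\<lambda>z. f z - g z) = (\<lambda>z. dzbar k f z - dzbar k g z)"
  and dz_plus: "smooth f \<Longrightarrow> smooth g \<Longrightarrow> dz k (\<lambda>z. f z + g z) = (\<lambda>z. dz k f z + dz k g z)"
  and dzbar_plus: "smooth f \<Longrightarrow> smooth g \<Longrightarrow> dzbar k (\<lambda>z. f z + g z) = (\<lambda>z. dzbar k f z + dzbar k g z)"
  and dz_cnj: "smooth f \<Longrightarrow> dz k (\<lambda>z. cnj (f z)) = (\<lambda>z. cnj (dzbar k f z))"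
  and dzbar_cnj: "smooth f \<Longrightarrow> dzbar k (\<lambda>z. cnj (f z)) = (\<lambda>z. cnj (dz k f z))"
  and dz_dz: "smooth f \<Longrightarrow> dz k (dz j f) = dz j (dz k f)"
  and dz_dzbar: "smooth f \<Longrightarrow> dz k (dzbar j f) = dzbar j (dz k f)"
  and dzbar_dzbar: "smooth f \<Longrightarrow> dzbar k (dzbar j f) = dzbar j (dzbar k f)"
  and smooth_dz: "smooth f \<Longrightarrow> smooth (dz k f)" and smooth_dzbar: "smooth f \<Longrightarrow> smooth (dzbar k f)"
  unfolding dz_eq_wirt dzbar_eq_wirtbar
  by (simp_all only: wirt_simps wirt_cnj wirtbar_cnj wirt_commutes(1)[of f "axis k 1" "axis j 1"]
      wirt_commutes(2)[of f "axis k 1" "axis j 1"] wirt_commutes(3)[of f "axis k 1" "axis j 1"])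

section \<open>Forms of type (1,0) and (0,1)\<close>

text \<open>A flag \<open>b\<close> selects type (1,0) or (0,1). In the second case the components
  are conjugated, so both types satisfy the same equations in \<open>dz\<close> and share one
  proof.\<close>

definition deg :: "bool \<Rightarrow> nat" where "deg b = (if b then Suc 0 else 0)"

definition comp1 :: "bool \<Rightarrow> 2 form \<Rightarrow> 2 \<Rightarrow> complex^2 \<Rightarrow> complex" where
  "comp1 b \<phi> k = (if b then \<phi> {k} {} else (\<lambda>z. cnj (\<phi> {} {k} z)))"

definition mk1 :: "bool \<Rightarrow> (2 \<Rightarrow> complex^2 \<Rightarrow> complex) \<Rightarrow> 2 form" where
  "mk1 b F = mkform (deg b) (deg (\<not> b))
     (\<lambda>I J. if b then F (the_elem I) else (\<lambda>z. cnj (F (the_elem J) z)))"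

definition curl :: "(2 \<Rightarrow> complex^2 \<Rightarrow> complex) \<Rightarrow> complex^2 \<Rightarrow> complex" where
  "curl F = (\<lambda>z. dz 2 (F 1) z - dz 1 (F 2) z)"

lemma comp1_mk1: "comp1 b (mk1 b F) k = F k"
  by (simp add: comp1_def mk1_def mkform_def deg_def)

lemma comp1_smooth_on: "\<phi> \<in> forms \<Lambda> r s \<Longrightarrow> comp1 b \<phi> k \<in> smooth_on \<Lambda>"
  using formsD(1)[of \<phi> \<Lambda> r s] by (auto simp: comp1_def intro!: smooth_on_cnj)

lemma mk1_forms: "(\<And>k. F k \<in> smooth_on \<Lambda>) \<Longrightarrow> mk1 b F \<in> forms \<Lambda> (deg b) (deg (\<not> b))"
  unfolding mk1_def by (intro mkform_forms) (auto intro: smooth_on_cnj)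

lemma comp1_linear:
  "comp1 b (\<phi> + \<psi>) k = (\<lambda>z. comp1 b \<phi> k z + comp1 b \<psi> k z)"
  "comp1 b (\<phi> - \<psi>) k = (\<lambda>z. comp1 b \<phi> k z - comp1 b \<psi> k z)"
  "comp1 b (form_scale c \<phi>) k = (\<lambda>z. (if b then c else cnj c) * comp1 b \<phi> k z)"
  "comp1 b 0 k = (\<lambda>z. 0)"
  by (auto simp: comp1_def form_scale_def fun_eq_iff)

lemma curl_linear:
  assumes "\<And>k. smooth (F k)" "\<And>k. smooth (G k)"
  shows "curl (\<lambda>k z. F k z + G k z) z = curl F z + curl G z"
    "curl (\<lambda>k z. F k z - G k z) z = curl F z - curl G z" "curl (\<lambda>k z. c * F k z) z = c * curl F z"
  using assms by (simp_all add: curl_def dz_plus dz_diff dz_cmult algebra_simps)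

lemma curl_smooth_on: "(\<And>k. F k \<in> smooth_on \<Lambda>) \<Longrightarrow> curl F \<in> smooth_on \<Lambda>"
  unfolding curl_def by (intro smooth_on_diff dz_smooth_on)

text \<open>The numerator condition says that the curl is holomorphic, which on a toroidal group
  makes it constant.\<close>

lemma aeppli_num_1:
  assumes \<phi>: "\<phi> \<in> forms \<Lambda> (deg b) (deg (\<not> b))"
  shows "\<phi> \<in> aeppli_num \<Lambda> (deg b) (deg (\<not> b)) \<longleftrightarrow> (\<forall>j z. dzbar j (curl (comp1 b \<phi>)) z = 0)"
proof -
  have s: "smooth (\<phi> I J)" for I J by (rule smooth_onD(1)[OF formsD(1)[OF \<phi>]])
  have "\<phi> \<in> aeppli_num \<Lambda> (deg b) (deg (\<not> b))"
    if *: "if b then \<forall>j z. del (delbar \<phi>) UNIV {j} z = 0 else \<forall>j z. del (delbar \<phi>) {j} UNIV z = 0"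
  proof (rule aeppli_numI[OF \<phi>])
    fix I J :: "2 set" assume "card I = Suc (deg b)" "card J = Suc (deg (\<not> b))"
    then show "del (delbar \<phi>) I J = (\<lambda>z. 0)"
      using * by (cases b) (auto simp: deg_def card_eq_1_2 fun_eq_iff)
  qed
  then have "\<phi> \<in> aeppli_num \<Lambda> (deg b) (deg (\<not> b)) \<longleftrightarrow>
      (if b then \<forall>j z. del (delbar \<phi>) UNIV {j} z = 0 else \<forall>j z. del (delbar \<phi>) {j} UNIV z = 0)"
    using aeppli_numD(2)[of \<phi> \<Lambda> "deg b" "deg (\<not> b)"] by auto
  also have "\<dots> \<longleftrightarrow> (\<forall>j z. dzbar j (curl (comp1 b \<phi>)) z = 0)"
  proof (cases b)
    case True
    have "del (delbar \<phi>) UNIV {j} z = - dzbar j (curl (comp1 b \<phi>)) z" for j z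
      using True s by (simp add: del_simps delbar_simps comp1_def curl_def dz_cmult[of _ _ "-1", simplified]
        dzbar_diff smooth_dz smooth_dzbar dz_dzbar)
    then show ?thesis using True by simp
  next
    case False
    have "del (delbar \<phi>) {j} UNIV z = cnj (dzbar j (curl (comp1 b \<phi>)) z)" for j z
      using False s by (simp add: del_simps delbar_simps comp1_def curl_def
        dzbar_diff dz_diff smooth_dz smooth_dzbar dz_cnj dzbar_cnj smooth_cnj)
    then show ?thesis using False by simp
  qed
  finally show ?thesis .
qed

text \<open>Mixed derivatives of the potential cancel in the curl, and the (anti)holomorphic summand
  is constant by toroidality.\<close>

lemma aeppli_denom_1:
  assumes tor: "toroidal \<Lambda>" and \<psi>: "\<psi> \<in> aeppli_denom \<Lambda> (deg b) (deg (\<not> b))"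
  shows "\<psi> \<in> forms \<Lambda> (deg b) (deg (\<not> b)) \<and> curl (comp1 b \<psi>) = (\<lambda>z. 0)"
proof (cases b)
  case True
  obtain \<alpha> \<omega> where a: "\<alpha> \<in> forms \<Lambda> 0 0" "\<omega> \<in> holomorphic_forms \<Lambda> (Suc 0)" "\<psi> = del \<alpha> + \<omega>"
    using \<psi> True by (auto simp: deg_def)
  note h = holomorphic_forms_const[OF tor a(2)]
  obtain c where c: "\<And>I J z. \<omega> I J z = c I J" using h(2) by blast
  have s: "smooth (\<alpha> I J)" for I J by (rule smooth_onD(1)[OF formsD(1)[OF a(1)]])
  have "comp1 b \<psi> k = (\<lambda>z. dz k (\<alpha> {} {}) z + c {k} {})" for k
    using True by (simp add: comp1_def a(3) fun_eq_iff del_simps c)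
  then have "curl (comp1 b \<psi>) = (\<lambda>z. 0)"
    by (simp add: curl_def dz_plus smooth_dz s dz_dz[OF s, of 2 1])
  moreover have "\<psi> \<in> forms \<Lambda> (Suc 0) 0"
    unfolding a(3) by (rule form.subspace_add[OF subspace_forms del_forms[OF a(1)] h(1)])
  ultimately show ?thesis using True by (simp add: deg_def)
next
  case False
  obtain \<beta> \<omega> where a: "\<beta> \<in> forms \<Lambda> 0 0" "\<omega> \<in> antiholomorphic_forms \<Lambda> (Suc 0)" "\<psi> = delbar \<beta> + \<omega>"
    using \<psi> False by (auto simp: deg_def)
  note h = antiholomorphic_forms_const[OF tor a(2)]
  obtain c where c: "\<And>I J z. \<omega> I J z = c I J" using h(2) by blast
  have s: "smooth (\<beta> I J)" for I J by (rule smooth_onD(1)[OF formsD(1)[OF a(1)]])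
  have "comp1 b \<psi> k = (\<lambda>z. dz k (\<lambda>z. cnj (\<beta> {} {} z)) z + cnj (c {} {k}))" for k
    using False by (simp add: comp1_def a(3) fun_eq_iff delbar_simps c dz_cnj s)
  then have "curl (comp1 b \<psi>) = (\<lambda>z. 0)"
    by (simp add: curl_def dz_plus smooth_dz smooth_cnj s dz_dz[OF smooth_cnj[OF s], of 2 1])
  moreover have "\<psi> \<in> forms \<Lambda> 0 (Suc 0)"
    unfolding a(3) by (rule form.subspace_add[OF subspace_forms delbar_forms[OF a(1)] h(1)])
  ultimately show ?thesis using False by (simp add: deg_def)
qed

lemma mk1_exact:
  assumes g: "g \<in> smooth_on \<Lambda>"
  shows "mk1 b (\<lambda>k z. dz k g z + \<omega> k) \<in> aeppli_denom \<Lambda> (deg b) (deg (\<not> b))"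
proof (cases b)
  case True
  let ?\<alpha> = "mkform 0 0 (\<lambda>_ _. g)"
  have "mk1 b (\<lambda>k z. dz k g z + \<omega> k) = del ?\<alpha> + mkform (Suc 0) 0 (\<lambda>I J z. \<omega> (the_elem I))"
  proof (rule form_eqI)
    show "mk1 b (\<lambda>k z. dz k g z + \<omega> k) \<in> forms \<Lambda> (Suc 0) 0"
      using mk1_forms[of "\<lambda>k z. dz k g z + \<omega> k" \<Lambda> b] True g
      by (simp add: deg_def smooth_on_plus smooth_on_const dz_smooth_on)
    show "del ?\<alpha> + mkform (Suc 0) 0 (\<lambda>I J z. \<omega> (the_elem I)) \<in> forms \<Lambda> (Suc 0) 0"
      by (intro form.subspace_add[OF subspace_forms] del_forms mkform_forms g smooth_on_const)
  qed (use True in \<open>auto simp: card_eq_1_2 mk1_def mkform_def deg_def del_simps fun_eq_iff\<close>)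
  moreover have "?\<alpha> \<in> forms \<Lambda> 0 0" by (intro mkform_forms g)
  ultimately show ?thesis using True const_holomorphic_form[of "Suc 0" "\<lambda>I. \<omega> (the_elem I)" \<Lambda>]
    by (auto simp: deg_def)
next
  case False
  let ?\<beta> = "mkform 0 0 (\<lambda>_ _ z. cnj (g z))"
  have "mk1 b (\<lambda>k z. dz k g z + \<omega> k) = delbar ?\<beta> + mkform 0 (Suc 0) (\<lambda>I J z. cnj (\<omega> (the_elem J)))"
  proof (rule form_eqI)
    show "mk1 b (\<lambda>k z. dz k g z + \<omega> k) \<in> forms \<Lambda> 0 (Suc 0)"
      using mk1_forms[of "\<lambda>k z. dz k g z + \<omega> k" \<Lambda> b] False g
      by (simp add: deg_def smooth_on_plus smooth_on_const dz_smooth_on)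
    show "delbar ?\<beta> + mkform 0 (Suc 0) (\<lambda>I J z. cnj (\<omega> (the_elem J))) \<in> forms \<Lambda> 0 (Suc 0)"
      by (intro form.subspace_add[OF subspace_forms] delbar_forms mkform_forms smooth_on_cnj g smooth_on_const)
  qed (use False in \<open>auto simp: card_eq_1_2 mk1_def mkform_def deg_def delbar_simps fun_eq_iff dzbar_cnj smooth_onD(1)[OF g]\<close>)
  moreover have "?\<beta> \<in> forms \<Lambda> 0 0" by (intro mkform_forms smooth_on_cnj g)
  ultimately show ?thesis using False const_antiholomorphic_form[of "Suc 0" "\<lambda>I. cnj (\<omega> (the_elem I))" \<Lambda>]
    by (auto simp: deg_def)
qed

lemma comp1_iter_deriv_diff:
  assumes "\<phi> \<in> forms \<Lambda> r s" "\<psi> \<in> forms \<Lambda> r s"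
  shows "cmod (iter_deriv vs (comp1 b \<psi> k) z - iter_deriv vs (comp1 b \<phi> k) z) =
    (if b then cmod (iter_deriv vs (\<psi> {k} {}) z - iter_deriv vs (\<phi> {k} {}) z)
     else cmod (iter_deriv vs (\<psi> {} {k}) z - iter_deriv vs (\<phi> {} {k}) z))"
proof (cases b)
  case False
  have "smooth (\<phi> I J)" "smooth (\<psi> I J)" for I J
    using smooth_onD(1)[OF formsD(1)[OF assms(1)]] smooth_onD(1)[OF formsD(1)[OF assms(2)]] by auto
  then show ?thesis using False
    by (simp add: comp1_def iter_deriv_cnj flip: complex_cnj_diff)
qed (simp add: comp1_def)

lemma iter_deriv_diff_le_comp1:
  assumes \<phi>: "\<phi> \<in> forms \<Lambda> (deg b) (deg (\<not> b))" and \<psi>: "\<psi> \<in> forms \<Lambda> (deg b) (deg (\<not> b))" and d: "d \<ge> 0"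
    and le: "\<And>k. cmod (iter_deriv vs (comp1 b \<psi> k) z - iter_deriv vs (comp1 b \<phi> k) z) \<le> d"
  shows "cmod (iter_deriv vs (\<psi> I J) z - iter_deriv vs (\<phi> I J) z) \<le> d"
proof (cases "(card I, card J) = (deg b, deg (\<not> b))")
  case True
  then show ?thesis
    using le[unfolded comp1_iter_deriv_diff[OF \<phi> \<psi>]] by (cases b) (auto simp: deg_def card_eq_1_2)
next
  case False
  then show ?thesis using formsD(2)[OF \<phi> False] formsD(2)[OF \<psi> False] d by simp
qed

lemma dz_diff_less:
  assumes "cmod (iter_deriv [axis k 1] f z - iter_deriv [axis k 1] g z) < r"
    "cmod (iter_deriv [axis k \<i>] f z - iter_deriv [axis k \<i>] g z) < r"
  shows "cmod (dz k f z - dz k g z) < r"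
proof -
  let ?a = "dir_deriv (axis k 1) f z - dir_deriv (axis k 1) g z"
    and ?b = "dir_deriv (axis k \<i>) f z - dir_deriv (axis k \<i>) g z"
  have "dz k f z - dz k g z = (?a - \<i> * ?b) / 2" by (simp add: dz_def field_simps)
  moreover have "cmod (?a - \<i> * ?b) \<le> cmod ?a + cmod ?b"
    using norm_triangle_ineq4[of ?a "\<i> * ?b"] by (simp add: norm_mult)
  ultimately have "cmod (dz k f z - dz k g z) \<le> (cmod ?a + cmod ?b) / 2"
    by (simp only: norm_divide norm_numeral) simp
  then show ?thesis using assms by simp
qed

section \<open>Aeppli spaces in the top degrees, degree zero and degree one\<close>

context toroidal_frame
begin

lemma compact_strip: "compact K \<Longrightarrow> \<exists>T. \<forall>z\<in>K. \<bar>Im (L z)\<bar> \<le> T"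
proof -
  assume "compact K"
  then have "bounded ((\<lambda>z. Im (L z)) ` K)"
    by (intro compact_imp_bounded compact_continuous_image bounded_linear.continuous_on[OF bounded_linear_ImL] continuous_on_id)
  then show ?thesis unfolding bounded_iff by auto
qed

text \<open>Such a form has one coefficient for each \<open>J\<close>. Spreading a function
  \<open>g\<close> over the two components with weights \<open>u $ 2\<close> and
  \<open>- u $ 1\<close> produces a form whose \<open>del\<close> is \<open>wirt u g\<close>, so
  surjectivity of \<open>wirt u\<close> is enough.\<close>

lemma del_surj:
  assumes \<phi>: "\<phi> \<in> forms \<Lambda> (Suc (Suc 0)) s"
  shows "\<exists>\<alpha>\<in>forms \<Lambda> (Suc 0) s. del \<alpha> = \<phi>"
proof -
  have "\<forall>J. \<exists>g\<in>smooth_on \<Lambda>. wirt u g = \<phi> UNIV J" using wirt_surj formsD(1)[OF \<phi>] by blast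
  then obtain g where g: "\<And>J. g J \<in> smooth_on \<Lambda>" "\<And>J. wirt u (g J) = \<phi> UNIV J" by metis
  note sg = smooth_onD(1)[OF g(1)]
  let ?\<alpha> = "mkform (Suc 0) s (\<lambda>I J z. (if I = {1} then u $ 2 else - u $ 1) * g J z)"
  have \<alpha>: "?\<alpha> \<in> forms \<Lambda> (Suc 0) s" by (intro mkform_forms smooth_on_cmult g(1))
  moreover have "del ?\<alpha> = \<phi>"
  proof (rule form_eqI[OF del_forms[OF \<alpha>] \<phi>])
    fix I J :: "2 set" assume I: "card I = Suc (Suc 0)" and J: "card J = s"
    have ne: "{2::2} \<noteq> {1}" using less_2(3) by auto
    have "wirt u (g J) z = u $ 1 * dz 1 (g J) z + u $ 2 * dz 2 (g J) z" for z
      by (rule wirt_frame_coords(1)[OF sg])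
    then show "del ?\<alpha> I J = \<phi> I J"
      using I J ne unfolding card_eq_1_2
      by (simp add: del_simps mkform_def dz_cmult dz_minus smooth_cmult sg flip: g(2)) (simp add: fun_eq_iff algebra_simps)
  qed
  ultimately show ?thesis by blast
qed

lemma delbar_surj:
  assumes \<phi>: "\<phi> \<in> forms \<Lambda> r (Suc (Suc 0))"
  shows "\<exists>\<beta>\<in>forms \<Lambda> r (Suc 0). delbar \<beta> = \<phi>"
proof -
  have "\<forall>I. \<exists>g\<in>smooth_on \<Lambda>. wirtbar u g = \<phi> I UNIV" using wirtbar_surj formsD(1)[OF \<phi>] by blast
  then obtain g where g: "\<And>I. g I \<in> smooth_on \<Lambda>" "\<And>I. wirtbar u (g I) = \<phi> I UNIV" by metis
  note sg = smooth_onD(1)[OF g(1)]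
  let ?\<beta> = "mkform r (Suc 0) (\<lambda>I J z. ((-1) ^ r * (if J = {1} then cnj (u $ 2) else - cnj (u $ 1))) * g I z)"
  have \<beta>: "?\<beta> \<in> forms \<Lambda> r (Suc 0)" by (intro mkform_forms smooth_on_cmult g(1))
  moreover have "delbar ?\<beta> = \<phi>"
  proof (rule form_eqI[OF delbar_forms[OF \<beta>] \<phi>])
    fix I J :: "2 set" assume I: "card I = r" and J: "card J = Suc (Suc 0)"
    have ne: "{2::2} \<noteq> {1}" using less_2(3) by auto
    have e: "(-1) ^ r * ((-1) ^ r * x) = x" for x :: complex
      by (simp add: mult.assoc[symmetric] power_mult_distrib[symmetric])
    have "wirtbar u (g I) z = cnj (u $ 1) * dzbar 1 (g I) z + cnj (u $ 2) * dzbar 2 (g I) z" for z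
      by (rule wirt_frame_coords(2)[OF sg])
    then show "delbar ?\<beta> I J = \<phi> I J"
      using I J ne unfolding card_eq_1_2
      by (simp add: delbar_simps mkform_def dzbar_cmult dzbar_minus smooth_cmult sg flip: g(2)) (simp add: fun_eq_iff algebra_simps e)
  qed
  ultimately show ?thesis by blast
qed

text \<open>In these bidegrees every form is already exact for one of the two operators, so the
  other summand of the denominator is taken to be 0.\<close>

lemma aeppli_dims_0:
  "aeppli_dim \<Lambda> (Suc (Suc 0)) 0 = 0" "aeppli_dim \<Lambda> 0 (Suc (Suc 0)) = 0"
  "aeppli_dim \<Lambda> (Suc (Suc 0)) (Suc 0) = 0" "aeppli_dim \<Lambda> (Suc 0) (Suc (Suc 0)) = 0"
  "aeppli_dim \<Lambda> (Suc (Suc 0)) (Suc (Suc 0)) = 0"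
proof -
  have V: "\<phi> \<in> forms \<Lambda> r s" if "\<phi> \<in> aeppli_num \<Lambda> r s" for r s and \<phi> :: "2 form"
    using that by (simp add: aeppli_num_def)
  have 1: "aeppli_num \<Lambda> (Suc (Suc 0)) (Suc s) \<subseteq> aeppli_denom \<Lambda> (Suc (Suc 0)) (Suc s)" for s
  proof
    fix \<phi> assume "\<phi> \<in> aeppli_num \<Lambda> (Suc (Suc 0)) (Suc s)"
    then obtain \<alpha> where "\<alpha> \<in> forms \<Lambda> (Suc 0) (Suc s)" "del \<alpha> = \<phi>" using del_surj[OF V] by blast
    then show "\<phi> \<in> aeppli_denom \<Lambda> (Suc (Suc 0)) (Suc s)" unfolding aeppli_denom.simps
      by (intro CollectI exI[of _ \<alpha>] exI[of _ 0] conjI zero_in_forms) (simp_all add: delbar_0)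
  qed
  have 2: "aeppli_num \<Lambda> (Suc 0) (Suc (Suc 0)) \<subseteq> aeppli_denom \<Lambda> (Suc 0) (Suc (Suc 0))"
  proof
    fix \<phi> assume "\<phi> \<in> aeppli_num \<Lambda> (Suc 0) (Suc (Suc 0))"
    then obtain \<beta> where "\<beta> \<in> forms \<Lambda> (Suc 0) (Suc 0)" "delbar \<beta> = \<phi>" using delbar_surj[OF V] by blast
    then show "\<phi> \<in> aeppli_denom \<Lambda> (Suc 0) (Suc (Suc 0))" unfolding aeppli_denom.simps
      by (intro CollectI exI[of _ 0] exI[of _ \<beta>] conjI zero_in_forms) (simp_all add: del_0)
  qed
  have 3: "aeppli_num \<Lambda> (Suc (Suc 0)) 0 \<subseteq> aeppli_denom \<Lambda> (Suc (Suc 0)) 0"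
  proof
    fix \<phi> assume "\<phi> \<in> aeppli_num \<Lambda> (Suc (Suc 0)) 0"
    then obtain \<alpha> where "\<alpha> \<in> forms \<Lambda> (Suc 0) 0" "del \<alpha> = \<phi>" using del_surj[OF V] by blast
    then show "\<phi> \<in> aeppli_denom \<Lambda> (Suc (Suc 0)) 0" unfolding aeppli_denom.simps
      by (intro CollectI exI[of _ \<alpha>] exI[of _ 0] conjI zero_holomorphic_form) simp_all
  qed
  have 4: "aeppli_num \<Lambda> 0 (Suc (Suc 0)) \<subseteq> aeppli_denom \<Lambda> 0 (Suc (Suc 0))"
  proof
    fix \<phi> assume "\<phi> \<in> aeppli_num \<Lambda> 0 (Suc (Suc 0))"
    then obtain \<beta> where "\<beta> \<in> forms \<Lambda> 0 (Suc 0)" "delbar \<beta> = \<phi>" using delbar_surj[OF V] by blast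
    then show "\<phi> \<in> aeppli_denom \<Lambda> 0 (Suc (Suc 0))" unfolding aeppli_denom.simps
      by (intro CollectI exI[of _ \<beta>] exI[of _ 0] conjI zero_antiholomorphic_form) simp_all
  qed
  show "aeppli_dim \<Lambda> (Suc (Suc 0)) 0 = 0" "aeppli_dim \<Lambda> 0 (Suc (Suc 0)) = 0"
    "aeppli_dim \<Lambda> (Suc (Suc 0)) (Suc 0) = 0" "aeppli_dim \<Lambda> (Suc 0) (Suc (Suc 0)) = 0"
    "aeppli_dim \<Lambda> (Suc (Suc 0)) (Suc (Suc 0)) = 0"
    unfolding aeppli_dim_def
    by (rule quotient_dim_eq_0[OF form.vector_space_axioms], rule 1 2 3 4)+
qed

lemma aeppli_denom_00: "\<phi> \<in> aeppli_denom \<Lambda> 0 0 \<longleftrightarrow> \<phi> \<in> forms \<Lambda> 0 0 \<and> (\<exists>c. \<phi> {} {} = (\<lambda>z. c))"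
proof
  assume "\<phi> \<in> aeppli_denom \<Lambda> 0 0"
  then obtain \<omega> \<eta> where w: "\<omega> \<in> holomorphic_forms \<Lambda> 0" "\<eta> \<in> antiholomorphic_forms \<Lambda> 0" "\<phi> = \<omega> + \<eta>" by auto
  note h = holomorphic_forms_const[OF toroidal w(1)] antiholomorphic_forms_const[OF toroidal w(2)]
  obtain c d where "\<And>I J z. \<omega> I J z = c I J" "\<And>I J z. \<eta> I J z = d I J" using h by blast
  then have "\<phi> {} {} = (\<lambda>z. c {} {} + d {} {})" by (simp add: w(3) fun_eq_iff)
  then show "\<phi> \<in> forms \<Lambda> 0 0 \<and> (\<exists>c. \<phi> {} {} = (\<lambda>z. c))"
    using form.subspace_add[OF subspace_forms h(1) h(3)] by (auto simp: w(3))
next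
  assume "\<phi> \<in> forms \<Lambda> 0 0 \<and> (\<exists>c. \<phi> {} {} = (\<lambda>z. c))"
  then obtain c where c: "\<phi> \<in> forms \<Lambda> 0 0" "\<phi> {} {} = (\<lambda>z. c)" by blast
  have "\<phi> = mkform 0 0 (\<lambda>I J z. c)"
    by (rule form_eqI[OF c(1) mkform_forms[OF smooth_on_const]]) (auto simp: card_eq_1_2 c(2) mkform_def)
  then have "\<phi> \<in> holomorphic_forms \<Lambda> 0" using const_holomorphic_form[of 0 "\<lambda>_. c" \<Lambda>] by simp
  then show "\<phi> \<in> aeppli_denom \<Lambda> 0 0" unfolding aeppli_denom.simps
    by (intro CollectI exI[of _ \<phi>] exI[of _ 0] conjI zero_antiholomorphic_form) simp_all
qed

lemma ht_values: "ht 0 = 0" "ht (\<i> *s u) = 1"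
  by (simp_all add: ht_def L_iu)

text \<open>The numerator consists of functions affine in the height and the denominator of
  constants. The class of \<open>ht\<close> is a basis; its values at 0 and \<open>\<i> *s u\<close>
  show that it is not constant.\<close>

lemma aeppli_dim_00: "aeppli_dim \<Lambda> 0 0 = 1"
  unfolding aeppli_dim_def
proof (rule quotient_dim_eq_1[OF form.vector_space_axioms])
  let ?b = "mkform 0 0 (\<lambda>_ _. ht)"
  have b: "?b \<in> forms \<Lambda> 0 0" by (intro mkform_forms ht_smooth_on)
  have b0: "?b {} {} = ht" by (simp add: mkform_def)
  note sub = form.subspace_add[OF subspace_forms] form.subspace_scale[OF subspace_forms] form.subspace_diff[OF subspace_forms]
  show "form.subspace (aeppli_denom \<Lambda> 0 0)"
    unfolding form.subspace_def
  proof (intro conjI ballI allI)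
    show "0 \<in> aeppli_denom \<Lambda> 0 0" unfolding aeppli_denom_00 by (auto simp: zero_in_forms fun_eq_iff)
    fix \<phi> assume \<phi>: "\<phi> \<in> aeppli_denom \<Lambda> 0 0"
    then show "form_scale c \<phi> \<in> aeppli_denom \<Lambda> 0 0" for c
      unfolding aeppli_denom_00 by (auto simp: form_scale_def fun_eq_iff intro: sub(2)[unfolded form_scale_def])
    show "\<phi> + \<psi> \<in> aeppli_denom \<Lambda> 0 0" if "\<psi> \<in> aeppli_denom \<Lambda> 0 0" for \<psi>
      using \<phi> that unfolding aeppli_denom_00 by (auto simp: fun_eq_iff intro: sub(1))
  qed
  show "?b \<in> aeppli_num \<Lambda> 0 0"
  proof (rule aeppli_numI[OF b])
    fix I J :: "2 set" assume "card I = Suc 0" "card J = Suc 0"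
    then obtain i j where "I = {i}" "J = {j}" by (auto simp: card_eq_1_2)
    moreover have "dzbar j ht = (\<lambda>z. \<i> / 2 * cnj (q j))" using dzbar_ht by (rule ext)
    ultimately show "del (delbar ?b) I J = (\<lambda>z. 0)" by (simp add: del_simps delbar_simps b0)
  qed
  show "c = 0" if "form_scale c ?b \<in> aeppli_denom \<Lambda> 0 0" for c
  proof -
    have "\<exists>d. form_scale c ?b {} {} = (\<lambda>z. d)" using that by (simp only: aeppli_denom_00)
    then obtain d where d: "form_scale c ?b {} {} = (\<lambda>z. d)" ..
    show ?thesis using fun_cong[OF d, of 0] fun_cong[OF d, of "\<i> *s u"] by (simp add: form_scale_def b0 ht_values)
  qed
  show "\<exists>c. \<phi> - form_scale c ?b \<in> aeppli_denom \<Lambda> 0 0" if \<phi>: "\<phi> \<in> aeppli_num \<Lambda> 0 0" for \<phi>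
  proof -
    note f = aeppli_numD(1)[OF \<phi>]
    have "dz i (dzbar j (\<phi> {} {})) z = 0" for i j z
      using aeppli_numD(2)[OF \<phi>, of "{i}" "{j}" z] by (simp add: del_simps delbar_simps)
    from pluriharmonic_affine[OF formsD(1)[OF f] this]
    obtain a c where ac: "\<phi> {} {} = (\<lambda>z. a + c * ht z)" by blast
    then have "(\<phi> - form_scale c ?b) {} {} = (\<lambda>z. a)"
      by (simp add: fun_eq_iff form_scale_def b0)
    then show ?thesis unfolding aeppli_denom_00 using sub(3)[OF f sub(2)[OF b]] by blast
  qed
qed

text \<open>Vanishing of the curl involves first derivatives at a point, so it passes to limits.
  Conversely, disc potentials exhibit a form without curl as a limit of exact plus constant
  forms.\<close>

lemma closure_1form:
  "subtopology (forms_top \<Lambda> (deg b) (deg (\<not> b))) (aeppli_num \<Lambda> (deg b) (deg (\<not> b))) closure_of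
     aeppli_denom \<Lambda> (deg b) (deg (\<not> b)) =
   {\<phi> \<in> forms \<Lambda> (deg b) (deg (\<not> b)). curl (comp1 b \<phi>) = (\<lambda>z. 0)}"
proof (intro equalityI subsetI)
  let ?r = "deg b" and ?s = "deg (\<not> b)"
  have V: "aeppli_num \<Lambda> ?r ?s \<subseteq> forms \<Lambda> ?r ?s" by (auto simp: aeppli_num_def)
  fix \<phi> :: "2 form"
  {
    assume \<phi>: "\<phi> \<in> subtopology (forms_top \<Lambda> ?r ?s) (aeppli_num \<Lambda> ?r ?s) closure_of aeppli_denom \<Lambda> ?r ?s"
    then have \<phi>f: "\<phi> \<in> forms \<Lambda> ?r ?s" using V by (auto simp: in_closure_of)
    have "curl (comp1 b \<phi>) z = 0" for z
    proof (rule ccontr)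
      assume nz: "curl (comp1 b \<phi>) z \<noteq> 0"
      define d where "d = cmod (curl (comp1 b \<phi>) z) / 2"
      have d: "d > 0" using nz by (simp add: d_def)
      \<comment> \<open>The four real first derivatives determine the curl; each of its two terms
        errs by less than half the modulus \<open>2 * d\<close> that is to be refuted.\<close>
      let ?Vs = "{[axis 1 1], [axis 1 \<i>], [axis 2 1], [axis 2 \<i>]}"
      obtain \<psi> where \<psi>: "\<psi> \<in> aeppli_denom \<Lambda> ?r ?s" "\<psi> \<in> forms \<Lambda> ?r ?s"
        "\<And>vs I J. vs \<in> ?Vs \<Longrightarrow> cmod (iter_deriv vs (\<psi> I J) z - iter_deriv vs (\<phi> I J) z) < d"
      proof -
        have "\<exists>\<psi>\<in>aeppli_denom \<Lambda> ?r ?s. \<psi> \<in> forms \<Lambda> ?r ?s \<and> (\<forall>vs\<in>?Vs. \<forall>I J. \<forall>z\<in>{z}.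
            cmod (iter_deriv vs (\<psi> I J) z - iter_deriv vs (\<phi> I J) z) < d)"
          by (rule closure_approximable[OF \<phi> V _ d]) auto
        then show thesis using that by blast
      qed
      have c: "cmod (iter_deriv vs (comp1 b \<psi> k) z - iter_deriv vs (comp1 b \<phi> k) z) < d" if "vs \<in> ?Vs" for vs k
        unfolding comp1_iter_deriv_diff[OF \<phi>f \<psi>(2)] using \<psi>(3)[OF that] by simp
      have "cmod (dz 2 (comp1 b \<psi> 1) z - dz 2 (comp1 b \<phi> 1) z) < d" "cmod (dz 1 (comp1 b \<psi> 2) z - dz 1 (comp1 b \<phi> 2) z) < d"
        by (intro dz_diff_less c; simp)+
      moreover have "curl (comp1 b \<psi>) z = 0" using aeppli_denom_1[OF toroidal \<psi>(1)] by simp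
      then have "curl (comp1 b \<phi>) z = (dz 1 (comp1 b \<psi> 2) z - dz 1 (comp1 b \<phi> 2) z) - (dz 2 (comp1 b \<psi> 1) z - dz 2 (comp1 b \<phi> 1) z)"
        by (simp add: curl_def)
      ultimately have "cmod (curl (comp1 b \<phi>) z) < 2 * d"
        using norm_triangle_ineq4[of "dz 1 (comp1 b \<psi> 2) z - dz 1 (comp1 b \<phi> 2) z" "dz 2 (comp1 b \<psi> 1) z - dz 2 (comp1 b \<phi> 1) z"]
        by simp
      then show False by (simp add: d_def)
    qed
    then show "\<phi> \<in> {\<phi> \<in> forms \<Lambda> ?r ?s. curl (comp1 b \<phi>) = (\<lambda>z. 0)}" using \<phi>f by auto
  }
  assume "\<phi> \<in> {\<phi> \<in> forms \<Lambda> ?r ?s. curl (comp1 b \<phi>) = (\<lambda>z. 0)}"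
  then have \<phi>f: "\<phi> \<in> forms \<Lambda> ?r ?s" and cl: "curl (comp1 b \<phi>) = (\<lambda>z. 0)" by auto
  have inV: "\<psi> \<in> aeppli_num \<Lambda> ?r ?s" if "\<psi> \<in> forms \<Lambda> ?r ?s" "curl (comp1 b \<psi>) = (\<lambda>z. 0)" for \<psi>
    using aeppli_num_1[OF that(1)] that(2) by simp
  have "dz 2 (comp1 b \<phi> 1) = dz 1 (comp1 b \<phi> 2)" using cl by (simp add: curl_def fun_eq_iff)
  from closed_1form_approx[OF comp1_smooth_on[OF \<phi>f] this]
  obtain g \<omega> where g: "\<And>n. g n \<in> smooth_on \<Lambda>" and lim: "\<And>k vs T r. r > 0 \<Longrightarrow> \<forall>\<^sub>F n::nat in sequentially.
      \<forall>z. \<bar>Im (L z)\<bar> \<le> T \<longrightarrow> cmod (iter_deriv vs (\<lambda>z. dz k (g n) z + \<omega> k) z - iter_deriv vs (comp1 b \<phi> k) z) \<le> r"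
    by blast
  define \<psi> where "\<psi> n = mk1 b (\<lambda>k z. dz k (g n) z + \<omega> k)" for n
  have \<psi>: "\<psi> n \<in> aeppli_denom \<Lambda> ?r ?s" for n unfolding \<psi>_def by (rule mk1_exact[OF g])
  note \<psi>f = aeppli_denom_1[OF toroidal \<psi>]
  show "\<phi> \<in> subtopology (forms_top \<Lambda> ?r ?s) (aeppli_num \<Lambda> ?r ?s) closure_of aeppli_denom \<Lambda> ?r ?s"
  proof (rule closure_ofI[OF inV[OF \<phi>f cl] \<psi> _ V])
    show "\<psi> n \<in> aeppli_num \<Lambda> ?r ?s" for n using inV \<psi>f by blast
    fix I J :: "2 set" and vs and K :: "(complex^2) set" and d :: real assume K: "compact K" and d: "d > 0"
    obtain T where T: "\<And>z. z \<in> K \<Longrightarrow> \<bar>Im (L z)\<bar> \<le> T" using compact_strip[OF K] by blast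
    have "\<forall>\<^sub>F n in sequentially. \<forall>k. \<forall>z. \<bar>Im (L z)\<bar> \<le> T \<longrightarrow>
        cmod (iter_deriv vs (\<lambda>z. dz k (g n) z + \<omega> k) z - iter_deriv vs (comp1 b \<phi> k) z) \<le> d"
      by (intro eventually_all_finite lim d)
    then show "\<forall>\<^sub>F n in sequentially. \<forall>z\<in>K. cmod (iter_deriv vs (\<psi> n I J) z - iter_deriv vs (\<phi> I J) z) \<le> d"
    proof (eventually_elim, intro ballI)
      fix n z assume "\<forall>k. \<forall>z. \<bar>Im (L z)\<bar> \<le> T \<longrightarrow>
        cmod (iter_deriv vs (\<lambda>z. dz k (g n) z + \<omega> k) z - iter_deriv vs (comp1 b \<phi> k) z) \<le> d" and z: "z \<in> K"
      then show "cmod (iter_deriv vs (\<psi> n I J) z - iter_deriv vs (\<phi> I J) z) \<le> d"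
        using T[OF z] d \<psi>f by (intro iter_deriv_diff_le_comp1[OF \<phi>f]) (auto simp: \<psi>_def comp1_mk1)
    qed
  qed
qed

text \<open>The constant value of the curl is the coordinate on the quotient. The form with
  components \<open>p k * ht\<close> generates it, its curl being a nonzero multiple of the frame
  determinant.\<close>

lemma aeppli_hausdorff_dim_1: "aeppli_hausdorff_dim \<Lambda> (deg b) (deg (\<not> b)) = 1"
  unfolding aeppli_hausdorff_dim_def closure_1form
proof (rule quotient_dim_eq_1[OF form.vector_space_axioms])
  let ?r = "deg b" and ?s = "deg (\<not> b)"
  let ?Z = "{\<phi> \<in> forms \<Lambda> ?r ?s. curl (comp1 b \<phi>) = (\<lambda>z. 0)}"
  note sub = form.subspace_add[OF subspace_forms] form.subspace_scale[OF subspace_forms] form.subspace_diff[OF subspace_forms]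
  have s: "smooth (comp1 b \<phi> k)" if "\<phi> \<in> forms \<Lambda> ?r ?s" for \<phi> k
    by (rule smooth_onD(1)[OF comp1_smooth_on[OF that]])
  have curl_add: "curl (comp1 b (\<phi> + \<psi>)) z = curl (comp1 b \<phi>) z + curl (comp1 b \<psi>) z"
    if "\<phi> \<in> forms \<Lambda> ?r ?s" "\<psi> \<in> forms \<Lambda> ?r ?s" for \<phi> \<psi> z
    using curl_linear(1)[OF s[OF that(1)] s[OF that(2)]] by (simp add: comp1_linear(1)[abs_def])
  have curl_diff: "curl (comp1 b (\<phi> - \<psi>)) z = curl (comp1 b \<phi>) z - curl (comp1 b \<psi>) z"
    if "\<phi> \<in> forms \<Lambda> ?r ?s" "\<psi> \<in> forms \<Lambda> ?r ?s" for \<phi> \<psi> z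
    using curl_linear(2)[OF s[OF that(1)] s[OF that(2)]] by (simp add: comp1_linear(2)[abs_def])
  have curl_scale: "curl (comp1 b (form_scale c \<phi>)) z = (if b then c else cnj c) * curl (comp1 b \<phi>) z"
    if "\<phi> \<in> forms \<Lambda> ?r ?s" for \<phi> c z
    using curl_linear(3)[OF s[OF that] s[OF that]] by (simp add: comp1_linear(3)[abs_def])
  show "form.subspace ?Z"
    unfolding form.subspace_def
    by (auto simp: sub zero_in_forms curl_add curl_scale fun_eq_iff comp1_linear(4)[abs_def]) (simp add: curl_def)
  let ?b = "mk1 b (\<lambda>k z. p k * ht z)"
  have b: "?b \<in> forms \<Lambda> ?r ?s" by (intro mk1_forms smooth_on_cmult ht_smooth_on)
  define \<delta> where "\<delta> = \<i> / 2 * (p 2 * q 1 - p 1 * q 2)"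
  have \<delta>: "\<delta> \<noteq> 0" using frame_det by (auto simp: \<delta>_def)
  have curl_b: "curl (comp1 b ?b) z = \<delta>" for z
    by (simp add: curl_def comp1_mk1 dz_cmult smooth_onD(1)[OF ht_smooth_on])
      (simp add: dz_ht \<delta>_def field_simps)
  then have cb: "curl (comp1 b ?b) = (\<lambda>z. \<delta>)" by (rule ext)
  show "?b \<in> aeppli_num \<Lambda> ?r ?s" using aeppli_num_1[OF b] by (simp add: cb)
  show "c = 0" if "form_scale c ?b \<in> ?Z" for c
    using that curl_scale[OF b, of c 0] \<delta> by (auto simp: cb split: if_splits)
  show "\<exists>c. \<phi> - form_scale c ?b \<in> ?Z" if \<phi>: "\<phi> \<in> aeppli_num \<Lambda> ?r ?s" for \<phi>
  proof -
    have f: "\<phi> \<in> forms \<Lambda> ?r ?s" by (rule aeppli_numD(1)[OF \<phi>])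
    have "dzbar j (curl (comp1 b \<phi>)) z = 0" for j z using iffD1[OF aeppli_num_1[OF f] \<phi>] by simp
    from toroidal_const[OF toroidal curl_smooth_on[OF comp1_smooth_on[OF f]] this]
    obtain a where a: "curl (comp1 b \<phi>) = (\<lambda>z. a)" ..
    \<comment> \<open>Scaling acts on the conjugated components by the conjugate factor, hence the
      second case.\<close>
    define c where "c = (if b then a / \<delta> else cnj (a / \<delta>))"
    have "curl (comp1 b (\<phi> - form_scale c ?b)) = (\<lambda>z. 0)"
      using \<delta> by (simp add: fun_eq_iff curl_diff f sub(2)[OF b] curl_scale[OF b] a cb c_def)
    then show ?thesis using sub(3)[OF f sub(2)[OF b]] by blast
  qed
qed

end

section \<open>Forms of type (1,1)\<close>

definition comp11 :: "2 form \<Rightarrow> 2 \<Rightarrow> 2 \<Rightarrow> complex^2 \<Rightarrow> complex" where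
  "comp11 \<phi> i j = \<phi> {i} {j}"

definition mk11 :: "(2 \<Rightarrow> 2 \<Rightarrow> complex^2 \<Rightarrow> complex) \<Rightarrow> 2 form" where
  "mk11 F = mkform (Suc 0) (Suc 0) (\<lambda>I J. F (the_elem I) (the_elem J))"

text \<open>Up to sign the only coefficient of \<open>del (delbar \<phi>)\<close>, written in the
  shape that \<open>ddbar_contr\<close> expects.\<close>

definition ddbar11 :: "(2 \<Rightarrow> 2 \<Rightarrow> complex^2 \<Rightarrow> complex) \<Rightarrow> complex^2 \<Rightarrow> complex" where
  "ddbar11 F = (\<lambda>z. dz 1 (dzbar 1 (F 2 2)) z - dz 1 (dzbar 2 (F 2 1)) z - dz 2 (dzbar 1 (F 1 2)) z + dz 2 (dzbar 2 (F 1 1)) z)"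

lemma comp11_mk11: "comp11 (mk11 F) = F"
  by (simp add: comp11_def mk11_def mkform_def fun_eq_iff)

lemma mk11_forms: "(\<And>i j. F i j \<in> smooth_on \<Lambda>) \<Longrightarrow> mk11 F \<in> forms \<Lambda> (Suc 0) (Suc 0)"
  unfolding mk11_def by (intro mkform_forms)

lemma comp11_smooth_on: "\<phi> \<in> forms \<Lambda> r s \<Longrightarrow> comp11 \<phi> i j \<in> smooth_on \<Lambda>"
  unfolding comp11_def by (rule formsD(1))

lemma comp11_linear:
  "comp11 (\<phi> + \<psi>) = (\<lambda>i j z. comp11 \<phi> i j z + comp11 \<psi> i j z)"
  "comp11 (\<phi> - \<psi>) = (\<lambda>i j z. comp11 \<phi> i j z - comp11 \<psi> i j z)"
  "comp11 (form_scale c \<phi>) = (\<lambda>i j z. c * comp11 \<phi> i j z)"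
  "comp11 0 = (\<lambda>i j z. 0)"
  by (auto simp: comp11_def form_scale_def fun_eq_iff)

lemma ddbar11_linear:
  assumes "\<And>i j. smooth (F i j)" "\<And>i j. smooth (G i j)"
  shows "ddbar11 (\<lambda>i j z. F i j z + G i j z) z = ddbar11 F z + ddbar11 G z"
    "ddbar11 (\<lambda>i j z. F i j z - G i j z) z = ddbar11 F z - ddbar11 G z"
    "ddbar11 (\<lambda>i j z. c * F i j z) z = c * ddbar11 F z"
  using assms
  by (simp_all add: ddbar11_def dz_plus dzbar_plus dz_diff dzbar_diff dz_cmult dzbar_cmult smooth_dzbar algebra_simps)

lemma contr_linear:
  "contr v w (\<lambda>i j z. F i j z + G i j z) = (\<lambda>z. contr v w F z + contr v w G z)"
  "contr v w (\<lambda>i j z. F i j z - G i j z) = (\<lambda>z. contr v w F z - contr v w G z)"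
  "contr v w (\<lambda>i j z. c * F i j z) = (\<lambda>z. c * contr v w F z)"
  by (simp_all add: contr_def fun_eq_iff algebra_simps)

lemma ddbar11_exact:
  assumes "\<And>j. smooth (a j)" "\<And>i. smooth (b i)"
  shows "ddbar11 (\<lambda>i j z. dz i (a j) z - dzbar j (b i) z) z = 0"
  using assms
  by (simp add: ddbar11_def dz_diff dzbar_diff smooth_dz smooth_dzbar dz_dzbar dz_dz[of _ 2 1] dzbar_dzbar[of _ 2 1])

lemma aeppli_num_11:
  assumes \<phi>: "\<phi> \<in> forms \<Lambda> (Suc 0) (Suc 0)"
  shows "\<phi> \<in> aeppli_num \<Lambda> (Suc 0) (Suc 0) \<longleftrightarrow> (\<forall>z. ddbar11 (comp11 \<phi>) z = 0)"
proof -
  have s: "smooth (\<phi> I J)" for I J by (rule smooth_onD(1)[OF formsD(1)[OF \<phi>]])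
  have eq: "del (delbar \<phi>) UNIV UNIV z = - ddbar11 (comp11 \<phi>) z" for z
    using s by (simp add: del_simps delbar_simps comp11_def ddbar11_def dz_minus dz_diff smooth_dzbar smooth_diff)
  show ?thesis
  proof
    assume "\<phi> \<in> aeppli_num \<Lambda> (Suc 0) (Suc 0)"
    from aeppli_numD(2)[OF this, of UNIV UNIV] show "\<forall>z. ddbar11 (comp11 \<phi>) z = 0" by (simp add: eq)
  next
    assume *: "\<forall>z. ddbar11 (comp11 \<phi>) z = 0"
    show "\<phi> \<in> aeppli_num \<Lambda> (Suc 0) (Suc 0)"
    proof (rule aeppli_numI[OF \<phi>])
      fix I J :: "2 set" assume "card I = Suc (Suc 0)" "card J = Suc (Suc 0)"
      then have "I = UNIV" "J = UNIV" by (simp_all only: card_eq_1_2)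
      then show "del (delbar \<phi>) I J = (\<lambda>z. 0)" using * by (simp add: fun_eq_iff eq)
    qed
  qed
qed

lemma aeppli_denom_11:
  assumes "\<psi> \<in> aeppli_denom \<Lambda> (Suc 0) (Suc 0)"
  shows "\<psi> \<in> forms \<Lambda> (Suc 0) (Suc 0)"
    "\<exists>a b. (\<forall>j. a j \<in> smooth_on \<Lambda>) \<and> (\<forall>i. b i \<in> smooth_on \<Lambda>) \<and>
      comp11 \<psi> = (\<lambda>i j z. dz i (a j) z - dzbar j (b i) z)"
proof -
  obtain \<alpha> \<beta> where a: "\<alpha> \<in> forms \<Lambda> 0 (Suc 0)" "\<beta> \<in> forms \<Lambda> (Suc 0) 0" "\<psi> = del \<alpha> + delbar \<beta>"
    using assms by auto
  show "\<psi> \<in> forms \<Lambda> (Suc 0) (Suc 0)"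
    unfolding a(3) by (rule form.subspace_add[OF subspace_forms del_forms[OF a(1)] delbar_forms[OF a(2)]])
  have "comp11 \<psi> = (\<lambda>i j z. dz i (\<alpha> {} {j}) z - dzbar j (\<beta> {i} {}) z)"
    by (simp add: comp11_def a(3) fun_eq_iff del_simps delbar_simps)
  then show "\<exists>a b. (\<forall>j. a j \<in> smooth_on \<Lambda>) \<and> (\<forall>i. b i \<in> smooth_on \<Lambda>) \<and>
      comp11 \<psi> = (\<lambda>i j z. dz i (a j) z - dzbar j (b i) z)"
    using formsD(1)[OF a(1)] formsD(1)[OF a(2)]
    by (intro exI[of _ "\<lambda>j. \<alpha> {} {j}"] exI[of _ "\<lambda>i. \<beta> {i} {}"]) auto
qed

lemma mk11_exact:
  assumes a: "\<And>j. a j \<in> smooth_on \<Lambda>" and b: "\<And>i. b i \<in> smooth_on \<Lambda>"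
  shows "mk11 (\<lambda>i j z. dz i (a j) z - dzbar j (b i) z) \<in> aeppli_denom \<Lambda> (Suc 0) (Suc 0)"
proof -
  let ?\<alpha> = "mkform 0 (Suc 0) (\<lambda>I J. a (the_elem J))" and ?\<beta> = "mkform (Suc 0) 0 (\<lambda>I J. b (the_elem I))"
  have f: "?\<alpha> \<in> forms \<Lambda> 0 (Suc 0)" "?\<beta> \<in> forms \<Lambda> (Suc 0) 0" by (intro mkform_forms a b)+
  have "mk11 (\<lambda>i j z. dz i (a j) z - dzbar j (b i) z) = del ?\<alpha> + delbar ?\<beta>"
  proof (rule form_eqI)
    show "mk11 (\<lambda>i j z. dz i (a j) z - dzbar j (b i) z) \<in> forms \<Lambda> (Suc 0) (Suc 0)"
      by (intro mk11_forms smooth_on_diff dz_smooth_on dzbar_smooth_on a b)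
    show "del ?\<alpha> + delbar ?\<beta> \<in> forms \<Lambda> (Suc 0) (Suc 0)"
      by (rule form.subspace_add[OF subspace_forms del_forms[OF f(1)] delbar_forms[OF f(2)]])
  qed (auto simp: card_eq_1_2 mk11_def mkform_def del_simps delbar_simps fun_eq_iff)
  then show ?thesis using f unfolding aeppli_denom.simps by blast
qed

context toroidal_frame
begin

text \<open>The torus mean of the contraction with \<open>e\<close> is an integral over a compact
  cell, hence continuous, and it vanishes on exact forms. Conversely
  \<open>closed_11form_approx\<close> approximates every numerator form that it kills.\<close>

lemma closure_11form:
  "subtopology (forms_top \<Lambda> (Suc 0) (Suc 0)) (aeppli_num \<Lambda> (Suc 0) (Suc 0)) closure_of
     aeppli_denom \<Lambda> (Suc 0) (Suc 0) =
   {\<phi> \<in> aeppli_num \<Lambda> (Suc 0) (Suc 0). mean (contr e e (comp11 \<phi>)) = (\<lambda>z. 0)}"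
proof (intro equalityI subsetI)
  have V: "aeppli_num \<Lambda> (Suc 0) (Suc 0) \<subseteq> forms \<Lambda> (Suc 0) (Suc 0)" by (auto simp: aeppli_num_def)
  fix \<phi> :: "2 form"
  {
    assume \<phi>: "\<phi> \<in> subtopology (forms_top \<Lambda> (Suc 0) (Suc 0)) (aeppli_num \<Lambda> (Suc 0) (Suc 0)) closure_of
      aeppli_denom \<Lambda> (Suc 0) (Suc 0)"
    then have \<phi>V: "\<phi> \<in> aeppli_num \<Lambda> (Suc 0) (Suc 0)" by (auto simp: in_closure_of)
    note \<phi>f = aeppli_numD(1)[OF \<phi>V]
    have "mean (contr e e (comp11 \<phi>)) z = 0" for z
    proof (rule ccontr)
      let ?S = "\<lambda>\<phi>. contr e e (comp11 \<phi>)"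
      assume nz: "mean (?S \<phi>) z \<noteq> 0"
      \<comment> \<open>Coefficient errors of size \<open>d\<close> change the contraction by at
        most \<open>C * d\<close>; the \<open>C + 1\<close> in the choice of \<open>d\<close> makes
        this strictly smaller than the modulus of the mean.\<close>
      define C where "C = (cmod (e $ 1) + cmod (e $ 2)) * (cmod (e $ 1) + cmod (e $ 2))"
      have C: "C \<ge> 0" by (simp add: C_def)
      define d where "d = cmod (mean (?S \<phi>) z) / (2 * (C + 1))"
      have d: "d > 0" using nz C by (simp add: d_def)
      have K: "compact ((\<lambda>v. z + v) ` cell ls)" by (intro compact_continuous_image continuous_intros compact_cell)
      have "\<exists>\<psi>\<in>aeppli_denom \<Lambda> (Suc 0) (Suc 0). \<psi> \<in> forms \<Lambda> (Suc 0) (Suc 0) \<and>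
          (\<forall>vs\<in>{[]}. \<forall>I J. \<forall>z\<in>(\<lambda>v. z + v) ` cell ls. cmod (iter_deriv vs (\<psi> I J) z - iter_deriv vs (\<phi> I J) z) < d)"
        by (rule closure_approximable[OF \<phi> V K d]) simp
      then obtain \<psi> where \<psi>: "\<psi> \<in> aeppli_denom \<Lambda> (Suc 0) (Suc 0)" "\<psi> \<in> forms \<Lambda> (Suc 0) (Suc 0)"
        and near: "\<And>I J v. v \<in> cell ls \<Longrightarrow> cmod (\<psi> I J (z + v) - \<phi> I J (z + v)) < d" by auto
      obtain a b where ab: "\<And>j. a j \<in> smooth_on \<Lambda>" "\<And>i. b i \<in> smooth_on \<Lambda>"
        "comp11 \<psi> = (\<lambda>i j z. dz i (a j) z - dzbar j (b i) z)"
        using aeppli_denom_11(2)[OF \<psi>(1)] by blast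
      have "mean (?S \<psi>) = (\<lambda>z. 0)" unfolding ab(3) by (rule ext) (rule mean_contr_exact[OF ab(1,2)])
      moreover have s: "smooth (?S \<psi>)" "smooth (?S \<phi>)"
        by (rule smooth_onD(1)[OF contr_smooth_on[OF comp11_smooth_on[OF \<psi>(2)]]],
            rule smooth_onD(1)[OF contr_smooth_on[OF comp11_smooth_on[OF \<phi>f]]])
      ultimately have "mean (\<lambda>z. ?S \<psi> z - ?S \<phi> z) z = - mean (?S \<phi>) z" by (simp add: torus_mean_diff)
      moreover have "cmod (mean (\<lambda>z. ?S \<psi> z - ?S \<phi> z) z - 0) \<le> C * d"
      proof (rule torus_mean_near)
        show "smooth (\<lambda>z. ?S \<psi> z - ?S \<phi> z)" by (intro smooth_diff s)
        fix v assume v: "v \<in> cell ls"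
        define D where "D i j = \<psi> {i} {j} (z + v) - \<phi> {i} {j} (z + v)" for i j
        have D: "cmod (D i j) \<le> d" for i j unfolding D_def using near[OF v] by (rule less_imp_le)
        have row: "cmod (cnj (e $ 1) * x + cnj (e $ 2) * y) \<le> (cmod (e $ 1) + cmod (e $ 2)) * d" if "cmod x \<le> d" "cmod y \<le> d" for x y
          using norm_triangle_ineq[of "cnj (e $ 1) * x" "cnj (e $ 2) * y"]
            mult_left_mono[OF that(1), of "cmod (e $ 1)"] mult_left_mono[OF that(2), of "cmod (e $ 2)"]
          by (simp add: norm_mult distrib_right)
        have "?S \<psi> (z + v) - ?S \<phi> (z + v) - 0 =
            e $ 1 * (cnj (e $ 1) * D 1 1 + cnj (e $ 2) * D 1 2) + e $ 2 * (cnj (e $ 1) * D 2 1 + cnj (e $ 2) * D 2 2)"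
          by (simp add: contr_def comp11_def D_def algebra_simps)
        also have "cmod \<dots> \<le> cmod (e $ 1) * ((cmod (e $ 1) + cmod (e $ 2)) * d) + cmod (e $ 2) * ((cmod (e $ 1) + cmod (e $ 2)) * d)"
          by (rule order_trans[OF norm_triangle_ineq]) (unfold norm_mult, intro add_mono mult_left_mono row D norm_ge_zero)
        also have "\<dots> = C * d" by (simp add: C_def algebra_simps)
        finally show "cmod (?S \<psi> (z + v) - ?S \<phi> (z + v) - 0) \<le> C * d" .
      qed
      ultimately have "cmod (mean (?S \<phi>) z) \<le> C * d" by simp
      also have "\<dots> < 2 * (C + 1) * d" using C d by (simp add: algebra_simps add_strict_increasing2)
      also have "\<dots> = cmod (mean (?S \<phi>) z)" using C by (simp add: d_def)
      finally show False by simp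
    qed
    then show "\<phi> \<in> {\<phi> \<in> aeppli_num \<Lambda> (Suc 0) (Suc 0). mean (contr e e (comp11 \<phi>)) = (\<lambda>z. 0)}"
      using \<phi>V by auto
  }
  assume "\<phi> \<in> {\<phi> \<in> aeppli_num \<Lambda> (Suc 0) (Suc 0). mean (contr e e (comp11 \<phi>)) = (\<lambda>z. 0)}"
  then have \<phi>V: "\<phi> \<in> aeppli_num \<Lambda> (Suc 0) (Suc 0)" and Z: "\<And>z. mean (contr e e (comp11 \<phi>)) z = 0" by auto
  note \<phi>f = aeppli_numD(1)[OF \<phi>V]
  have eq: "ddbar11 (comp11 \<phi>) z = 0" for z using aeppli_num_11[OF \<phi>f] \<phi>V by blast
  obtain \<alpha> \<beta> where ab: "\<And>n j. \<alpha> n j \<in> smooth_on \<Lambda>" "\<And>n i. \<beta> n i \<in> smooth_on \<Lambda>"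
    and lim: "\<And>i j vs T r. r > 0 \<Longrightarrow> \<forall>\<^sub>F n::nat in sequentially. \<forall>z. \<bar>Im (L z)\<bar> \<le> T \<longrightarrow>
      cmod (iter_deriv vs (\<lambda>z. dz i (\<alpha> n j) z - dzbar j (\<beta> n i) z) z - iter_deriv vs (comp11 \<phi> i j) z) \<le> r"
    using closed_11form_approx[OF comp11_smooth_on[OF \<phi>f] eq[unfolded ddbar11_def] Z] by blast
  define \<psi> where "\<psi> n = mk11 (\<lambda>i j z. dz i (\<alpha> n j) z - dzbar j (\<beta> n i) z)" for n
  have \<psi>: "\<psi> n \<in> aeppli_denom \<Lambda> (Suc 0) (Suc 0)" for n unfolding \<psi>_def by (rule mk11_exact[OF ab])
  note \<psi>f = aeppli_denom_11(1)[OF \<psi>]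
  show "\<phi> \<in> subtopology (forms_top \<Lambda> (Suc 0) (Suc 0)) (aeppli_num \<Lambda> (Suc 0) (Suc 0)) closure_of
      aeppli_denom \<Lambda> (Suc 0) (Suc 0)"
  proof (rule closure_ofI[OF \<phi>V \<psi> _ V])
    show "\<psi> n \<in> aeppli_num \<Lambda> (Suc 0) (Suc 0)" for n
      unfolding aeppli_num_11[OF \<psi>f] unfolding \<psi>_def comp11_mk11
      by (intro allI ddbar11_exact smooth_onD(1)[OF ab(1)] smooth_onD(1)[OF ab(2)])
    fix I J :: "2 set" and vs and K :: "(complex^2) set" and d :: real assume K: "compact K" and d: "d > 0"
    obtain T where T: "\<And>z. z \<in> K \<Longrightarrow> \<bar>Im (L z)\<bar> \<le> T" using compact_strip[OF K] by blast
    show "\<forall>\<^sub>F n in sequentially. \<forall>z\<in>K. cmod (iter_deriv vs (\<psi> n I J) z - iter_deriv vs (\<phi> I J) z) \<le> d"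
    proof (cases "(card I, card J) = (Suc 0, Suc 0)")
      case True
      then obtain i j where ij: "I = {i}" "J = {j}" by (auto simp: card_eq_1_2)
      have c: "\<psi> n I J = (\<lambda>z. dz i (\<alpha> n j) z - dzbar j (\<beta> n i) z)" "\<phi> I J = comp11 \<phi> i j" for n
        by (simp_all add: ij \<psi>_def mk11_def mkform_def comp11_def)
      show ?thesis unfolding c by (rule eventually_mono[OF lim[OF d]]) (use T in blast)
    next
      case False
      then show ?thesis using d by (simp add: formsD(2)[OF \<phi>f False] formsD(2)[OF \<psi>f False])
    qed
  qed
qed

lemma mean_ht: "mean ht = ht" and mean_const: "mean (\<lambda>z. c) = (\<lambda>z. c)"
  by (rule invariant_mean; simp add: smooth_onD(1)[OF ht_smooth_on] ht_def L_add)+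

text \<open>The two coefficients of the affine mean are the coordinates on the quotient. As
  \<open>p\<close> is dual to \<open>e\<close>, the form with coefficients
  \<open>p i * cnj (p j) * g z\<close> contracts to \<open>g\<close>, and the choices g = 1 and g =
  \<open>ht\<close> realise both coordinates.\<close>

lemma aeppli_hausdorff_dim_11: "aeppli_hausdorff_dim \<Lambda> (Suc 0) (Suc 0) = 2"
  unfolding aeppli_hausdorff_dim_def closure_11form
proof (rule quotient_dim_eq_2[OF form.vector_space_axioms])
  let ?N = "aeppli_num \<Lambda> (Suc 0) (Suc 0)" and ?F = "forms \<Lambda> (Suc 0) (Suc 0)"
  let ?m = "\<lambda>\<phi>. mean (contr e e (comp11 \<phi>))"
  let ?Z = "{\<phi> \<in> ?N. ?m \<phi> = (\<lambda>z. 0)}"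
  note sub = form.subspace_add[OF subspace_forms] form.subspace_scale[OF subspace_forms] form.subspace_diff[OF subspace_forms]
  note f = aeppli_numD(1)
  have s: "smooth (comp11 \<phi> i j)" if "\<phi> \<in> ?N" for \<phi> i j
    by (rule smooth_onD(1)[OF comp11_smooth_on[OF f[OF that]]])
  have sc: "smooth (contr e e (comp11 \<phi>))" if "\<phi> \<in> ?N" for \<phi>
    by (rule smooth_onD(1)[OF contr_smooth_on[OF comp11_smooth_on[OF f[OF that]]]])
  have dd: "ddbar11 (comp11 \<phi>) z = 0" if "\<phi> \<in> ?N" for \<phi> z using aeppli_num_11[OF f[OF that]] that by blast
  have N_add: "\<phi> + \<psi> \<in> ?N" if "\<phi> \<in> ?N" "\<psi> \<in> ?N" for \<phi> \<psi>
    using aeppli_num_11[OF sub(1)[OF f[OF that(1)] f[OF that(2)]]] that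
    by (simp add: comp11_linear ddbar11_linear s dd)
  have N_diff: "\<phi> - \<psi> \<in> ?N" if "\<phi> \<in> ?N" "\<psi> \<in> ?N" for \<phi> \<psi>
    using aeppli_num_11[OF sub(3)[OF f[OF that(1)] f[OF that(2)]]] that
    by (simp add: comp11_linear ddbar11_linear s dd)
  have N_scale: "form_scale c \<phi> \<in> ?N" if "\<phi> \<in> ?N" for \<phi> c
    using aeppli_num_11[OF sub(2)[OF f[OF that]]] that
    by (simp add: comp11_linear ddbar11_linear(3)[OF s s] dd)
  have N_0: "0 \<in> ?N"
    using aeppli_num_11[OF zero_in_forms] by (simp add: comp11_linear ddbar11_def)
  have m_add: "?m (\<phi> + \<psi>) z = ?m \<phi> z + ?m \<psi> z" if "\<phi> \<in> ?N" "\<psi> \<in> ?N" for \<phi> \<psi> z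
    using that by (simp add: comp11_linear contr_linear torus_mean_plus sc)
  have m_diff: "?m (\<phi> - \<psi>) z = ?m \<phi> z - ?m \<psi> z" if "\<phi> \<in> ?N" "\<psi> \<in> ?N" for \<phi> \<psi> z
    using that by (simp add: comp11_linear contr_linear torus_mean_diff sc)
  have m_scale: "?m (form_scale c \<phi>) z = c * ?m \<phi> z" for \<phi> c z
    by (simp add: comp11_linear contr_linear torus_mean_cmult)
  have m_0: "?m 0 = (\<lambda>z. 0)" by (simp add: comp11_linear contr_def mean_const)
  show "form.subspace ?Z"
    unfolding form.subspace_def by (auto simp: N_0 m_0 N_add N_scale m_add m_scale fun_eq_iff)
  let ?b1 = "mk11 (\<lambda>i j z. p i * cnj (p j))" and ?b2 = "mk11 (\<lambda>i j z. p i * cnj (p j) * ht z)"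
  have bf: "?b1 \<in> ?F" "?b2 \<in> ?F" by (intro mk11_forms smooth_on_const smooth_on_cmult ht_smooth_on)+
  show b1: "?b1 \<in> ?N" using aeppli_num_11[OF bf(1)] by (simp add: comp11_mk11 ddbar11_def)
  show b2: "?b2 \<in> ?N"
  proof -
    have "dzbar j ht = (\<lambda>z. \<i> / 2 * cnj (q j))" for j using dzbar_ht by (rule ext)
    then show ?thesis using aeppli_num_11[OF bf(2)]
      by (simp add: comp11_mk11 ddbar11_def dzbar_cmult smooth_onD(1)[OF ht_smooth_on])
  qed
  have pe: "contr e e (\<lambda>i j z. p i * cnj (p j) * g z) = g" for g
  proof
    fix z
    have "contr e e (\<lambda>i j z. p i * cnj (p j) * g z) z =
        (e $ 1 * p 1 + e $ 2 * p 2) * cnj (e $ 1 * p 1 + e $ 2 * p 2) * g z"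
      by (simp add: contr_def algebra_simps)
    then show "contr e e (\<lambda>i j z. p i * cnj (p j) * g z) z = g z" by (simp add: frame_dual)
  qed
  have m1: "?m ?b1 = (\<lambda>z. 1)" using pe[of "\<lambda>z. 1"] by (simp add: comp11_mk11 mean_const)
  have m2: "?m ?b2 = ht" by (simp add: comp11_mk11 pe mean_ht)
  have m12: "?m (form_scale c ?b1 + form_scale d ?b2) z = c + d * ht z" for c d z
    using b1 b2 by (simp add: m_add N_scale m_scale m1 m2)
  show "c = 0 \<and> d = 0" if "form_scale c ?b1 + form_scale d ?b2 \<in> ?Z" for c d
  proof -
    have "c + d * ht z = 0" for z using that m12[of c d z] by simp
    from this[of 0] this[of "\<i> *s u"] show ?thesis by (simp add: ht_values)
  qed
  show "\<exists>c d. \<phi> - (form_scale c ?b1 + form_scale d ?b2) \<in> ?Z" if \<phi>: "\<phi> \<in> ?N" for \<phi>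
  proof -
    obtain a b where ab: "?m \<phi> = (\<lambda>z. a + b * ht z)"
      using mean_contr_affine[of "comp11 \<phi>", OF comp11_smooth_on[OF f[OF \<phi>]] dd[OF \<phi>, unfolded ddbar11_def]] by blast
    have B: "form_scale a ?b1 + form_scale b ?b2 \<in> ?N" by (intro N_add N_scale b1 b2)
    have "?m (\<phi> - (form_scale a ?b1 + form_scale b ?b2)) = (\<lambda>z. 0)"
      by (simp add: fun_eq_iff m_diff[OF \<phi> B] m12 ab)
    then show ?thesis using N_diff[OF \<phi> B] by blast
  qed
qed

end

theorem theorem1p3:
  fixes \<Lambda> :: "(complex^2) set"
  assumes "theta_toroidal \<Lambda>"
    and "\<not> compact_space (quotient_top \<Lambda>)"
  shows "aeppli_dim \<Lambda> 0 0 = 1 \<and>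
    aeppli_hausdorff_dim \<Lambda> 1 0 = 1 \<and>
    aeppli_hausdorff_dim \<Lambda> 0 1 = 1 \<and>
    aeppli_hausdorff_dim \<Lambda> 1 1 = 2 \<and>
    aeppli_dim \<Lambda> 2 0 = 0 \<and>
    aeppli_dim \<Lambda> 0 2 = 0 \<and>
    aeppli_dim \<Lambda> 2 1 = 0 \<and>
    aeppli_dim \<Lambda> 1 2 = 0 \<and>
    aeppli_dim \<Lambda> 2 2 = 0"
proof -
  obtain L e u ls where "toroidal_frame \<Lambda> L e u ls"
    using ex_toroidal_frame[of \<Lambda>] assms by (auto simp: theta_toroidal_def)
  then interpret toroidal_frame \<Lambda> L e u ls .
  show ?thesis
    using aeppli_dim_00 aeppli_hausdorff_dim_1[of True] aeppli_hausdorff_dim_1[of False]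
      aeppli_hausdorff_dim_11 aeppli_dims_0
    by (simp add: deg_def numeral_2_eq_2)
qed

end
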